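(* Let $f_{i,j}:\mathbb{R}^p\to\mathbb{R}$ ($1\le i\le n$, $1\le j\le m_i$) be differentiable functions, each $\ell$-smooth (i.e. with $\ell$-Lipschitz gradient). Let $f_i=\frac1{m_i}\sum_{j=1}^{m_i}f_{i,j}$ and $F=\frac1n\sum_{i=1}^n f_i$, and suppose that $F$ is $\mu$-strongly convex with $\mu>0$ (the individual $f_i$ need not be strongly convex). Let $\mathbf{x}^*$ be the unique minimizer of $F$. Let $n$ nodes communicate over a strongly connected directed graph, with row stochastic weight matrix $\underline A$ and column stochastic weight matrix $\underline B$ as in the context. Write $M=\max_i m_i$, $m=\min_i m_i$, $\kappa=\ell/\mu$, and let $\boldsymbol\pi_r,\boldsymbol\pi_c,h_r,h_c,\sigma_A,\sigma_B$ be as in the context. Let $$\psi:=\frac{\sqrt{h_rh_c}}{n\,(\boldsymbol\pi_r^\top\boldsymbol\pi_c)},\qquad \overline\alpha:=\min\left\{\frac{1}{35\,\ell\sqrt{h_rh_c}},\ \frac{m}{288\,M n\kappa\ell\,(\boldsymbol\pi_r^\top\boldsymbol\pi_c)},\ \frac{1}{9\,\mu M\,(\boldsymbol\pi_r^\top\boldsymbol\pi_c)}\right\}.$$ Consider the algorithm AB-SAGA (defined in the context) with constant step-size $\alpha$ and with $c=\lceil\overline c\rceil$, $d=\lceil\overline d\rceil$, where $$\overline d:=\frac{\log\left(\frac{1265\,\kappa}{\boldsymbol\pi_r^\top\boldsymbol\pi_c}\sqrt{\frac{nMh_c}{m}}\right)}{\log\frac1{\sigma_B}},\qquad \overline c:=\frac{\log\left(\frac{90512\,nM\kappa}{m(1-\sigma_B^{2d})}\sqrt{\frac{h_rh_c}{\boldsymbol\pi_r^\top\boldsymbol\pi_c}}\right)}{\log\frac1{\sigma_A}}.$$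 Then: (1) For every $\alpha\in(0,\overline\alpha)$, AB-SAGA converges linearly to $\mathbf{x}^*$: there exist $C<\infty$ and $\gamma\in(0,1)$ such that $\mathbb{E}\|\mathbf{x}_i^k-\mathbf{x}^*\|_2^2\le C\gamma^k$ for every node $i$ and all $k\ge 0$. (2) The directivity constant satisfies $\psi\ge1$, and for $\alpha=\overline\alpha$ AB-SAGA achieves an $\epsilon$-optimal solution in $$\Gamma=\mathcal{O}\left(\max\left\{\kappa\psi,\ \frac{\kappa^2M}{m},\ M\right\}\log\frac1\epsilon\right)$$ component-gradient computations per node, with $c+d$ communication rounds per iteration.
   Context: Weights. $\underline A=\{\underline a_{ir}\}$ and $\underline B=\{\underline b_{ir}\}$ are nonnegative primitive $n\times n$ matrices, with $\underline A$ row stochastic ($\underline A\mathbf 1_n=\mathbf 1_n$) and $\underline B$ column stochastic ($\mathbf 1_n^\top\underline B=\mathbf 1_n^\top$). They are compatible with the graph: the $(i,r)$ entry is nonzero if and only if node $i$ can receive information from node $r$ (a node always has access to its own information). $\boldsymbol\pi_r$ is the left Perron eigenvector of $\underline A$ and $\boldsymbol\pi_c$ the right Perron eigenvector of $\underline B$, both for eigenvalue $1$, positive, with entries summing to $1$. Thus $\underline A^\infty:=\lim_k\underline A^k=\mathbf 1_n\boldsymbol\pi_r^\top$ and $\underline B^\infty:=\lim_k\underline B^k=\boldsymbol\pi_c\mathbf 1_n^\top$. $h_r$ (resp. $h_c$) is the ratio of the largest to the smallest entry of $\boldsymbol\pi_r$ (resp. $\boldsymbol\pi_c$). Contraction factors.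 $\sigma_A:=|||\underline A-\underline A^\infty|||_{\boldsymbol\pi_r}$ and $\sigma_B:=|||\underline B-\underline B^\infty|||_{\boldsymbol\pi_c}$, where these are the matrix norms induced by the weighted Euclidean norms $\|\mathbf x\|_{\boldsymbol\pi_r}=\|\mathrm{diag}(\sqrt{\boldsymbol\pi_r})\,\mathbf x\|_2$ and $\|\mathbf x\|_{\boldsymbol\pi_c}=\|\mathrm{diag}(\sqrt{\boldsymbol\pi_c})^{-1}\mathbf x\|_2$ (square roots entrywise). It is a standing assumption that $\sigma_A,\sigma_B\in(0,1)$. Algorithm AB-SAGA. Parameters: step-size $\alpha>0$ and positive integers $c,d$ (communication rounds for the two updates). Let $a_{ir}$ denote the entries of $\underline A^c$ and $b_{ir}$ the entries of $\underline B^d$. Initialize with arbitrary $\mathbf x_i^0\in\mathbb R^p$, $\mathbf w_i^0=\mathbf g_i^0=\nabla f_i(\mathbf x_i^0)$, and $\mathbf v_{i,j}^1=\mathbf x_i^0$ for all $j\in\{1,\dots,m_i\}$. For $k=0,1,2,\dots$, each node $i$ performs: - $\mathbf x_i^{k+1}=\sum_{r=1}^n a_{ir}(\mathbf x_r^k-\alpha\mathbf w_r^k)$; - draw $s_i^{k+1}$ uniformly at random from $\{1,\dots,m_i\}$, independently over nodes, over iterations and of the past; - $\mathbf g_i^{k+1}=\nabla f_{i,s_i^{k+1}}(\mathbf x_i^{k+1})-\nabla f_{i,s_i^{k+1}}(\mathbf v_{i,s_i^{k+1}}^{k+1})+\frac1{m_i}\sum_{j=1}^{m_i}\nabla f_{i,j}(\mathbf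 v_{i,j}^{k+1})$; - $\mathbf w_i^{k+1}=\sum_{r=1}^n b_{ir}(\mathbf w_r^k+\mathbf g_r^{k+1}-\mathbf g_r^k)$; - $\mathbf v_{i,j}^{k+2}=\mathbf x_i^{k+1}$ if $j=s_i^{k+1}$, and $\mathbf v_{i,j}^{k+2}=\mathbf v_{i,j}^{k+1}$ otherwise. The gradients $\nabla f_{i,j}(\mathbf v_{i,j}^k)$ are stored in a table at node $i$, so that each iteration requires one new component-gradient evaluation per node. Complexity convention. The iterates at iteration $k$ are $\epsilon$-optimal if $\mathbb E\|\mathbf x_i^k-\mathbf x^*\|_2^2\le\epsilon$ for every node $i$. The $\mathcal O$-bound on $\Gamma$ means: there are a universal constant $C_1$ and a constant $C_0\ge e$, which may depend on the problem data and the initialization but not on $\epsilon$, such that for every $\epsilon\in(0,1)$ the iterates are $\epsilon$-optimal once at least $C_1\max\{\kappa\psi,\kappa^2M/m,M\}\log(C_0/\epsilon)$ component gradients have been computed per node. *)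

theory Defs
  imports
    "HOL-Probability.Probability"
    "Graph_Theory.Graph_Theory"
    "Jordan_Normal_Form.Char_Poly"
begin

unbundle no vec_syntax
no_notation inner (infix "\<bullet>" 70)

(* Points of R^p are vectors in carrier_vec p, and nodes are numbered 0, ..., n - 1, so that both
   n and p are ordinary natural numbers that a formula can quantify over.  Node i holds the
   component functions f i j with j < m i.  Only the values of a function on carrier_vec p matter. *)

definition vnorm :: "real vec \<Rightarrow> real" where
  "vnorm x = sqrt (x \<bullet> x)"

subsection \<open>Smooth and strongly convex functions\<close>

(* Frechet differentiability on R^p; the library's derivatives need a normed type. *)
definition has_gradient :: "nat \<Rightarrow> (real vec \<Rightarrow> real) \<Rightarrow> real vec \<Rightarrow> real vec \<Rightarrow> bool" where
  "has_gradient p f x g \<longleftrightarrow>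
     g \<in> carrier_vec p \<and>
     (\<forall>e>0. \<exists>\<delta>>0. \<forall>y \<in> carrier_vec p. vnorm (y - x) < \<delta> \<longrightarrow>
        \<bar>f y - f x - g \<bullet> (y - x)\<bar> \<le> e * vnorm (y - x))"

definition grad :: "nat \<Rightarrow> (real vec \<Rightarrow> real) \<Rightarrow> real vec \<Rightarrow> real vec" where
  "grad p f x = (THE g. has_gradient p f x g)"

definition smooth_fun :: "nat \<Rightarrow> real \<Rightarrow> (real vec \<Rightarrow> real) \<Rightarrow> bool" where
  "smooth_fun p L f \<longleftrightarrow>
     (\<forall>x \<in> carrier_vec p. \<exists>g. has_gradient p f x g) \<and>
     (\<forall>x \<in> carrier_vec p. \<forall>y \<in> carrier_vec p.
        vnorm (grad p f x - grad p f y) \<le> L * vnorm (x - y))"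

definition strongly_convex :: "nat \<Rightarrow> real \<Rightarrow> (real vec \<Rightarrow> real) \<Rightarrow> bool" where
  "strongly_convex p \<mu> F \<longleftrightarrow>
     (\<forall>x \<in> carrier_vec p. \<forall>y \<in> carrier_vec p. \<forall>t \<in> {0..1}.
        F (t \<cdot>\<^sub>v x + (1 - t) \<cdot>\<^sub>v y)
          \<le> t * F x + (1 - t) * F y - \<mu> / 2 * t * (1 - t) * (vnorm (x - y))\<^sup>2)"

definition node_obj :: "(nat \<Rightarrow> nat) \<Rightarrow> (nat \<Rightarrow> nat \<Rightarrow> real vec \<Rightarrow> real) \<Rightarrow> nat \<Rightarrow> real vec \<Rightarrow> real" where
  "node_obj m f i x = (\<Sum>j<m i. f i j x) / real (m i)"

definition global_obj :: "nat \<Rightarrow> (nat \<Rightarrow> nat) \<Rightarrow> (nat \<Rightarrow> nat \<Rightarrow> real vec \<Rightarrow> real) \<Rightarrow> real vec \<Rightarrow> real" where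
  "global_obj n m f x = (\<Sum>i<n. node_obj m f i x) / real n"

locale finite_sum_problem =
  fixes n p :: nat and m :: "nat \<Rightarrow> nat" and f :: "nat \<Rightarrow> nat \<Rightarrow> real vec \<Rightarrow> real"
    and L \<mu> :: real and xs :: "real vec"
  assumes n_pos: "n \<ge> 1"
    and p_pos: "p \<ge> 1"
    and m_pos: "\<And>i. i < n \<Longrightarrow> m i \<ge> 1"
    and smooth: "\<And>i j. i < n \<Longrightarrow> j < m i \<Longrightarrow> smooth_fun p L (f i j)"
    and mu_pos: "\<mu> > 0"
    and strongly_convex: "strongly_convex p \<mu> (global_obj n m f)"
    and minimizer: "is_arg_min (global_obj n m f) (\<lambda>x. x \<in> carrier_vec p) xs"

subsection \<open>Weight matrices\<close>

definition primitive_mat :: "real mat \<Rightarrow> bool" where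
  "primitive_mat A \<longleftrightarrow>
     square_mat A \<and>
     (\<forall>i<dim_row A. \<forall>r<dim_row A. A $$ (i,r) \<ge> 0) \<and>
     (\<exists>k\<ge>1. \<forall>i<dim_row A. \<forall>r<dim_row A. (A ^\<^sub>m k) $$ (i,r) > 0)"

abbreviation ones :: "nat \<Rightarrow> real vec" where
  "ones n \<equiv> Matrix.vec n (\<lambda>_. 1)"

(* The entrywise limit of the powers of A. *)
definition mat_lim :: "real mat \<Rightarrow> real mat" where
  "mat_lim A = Matrix.mat (dim_row A) (dim_col A) (\<lambda>(i,r). lim (\<lambda>k. (A ^\<^sub>m k) $$ (i,r)))"

definition norm_r :: "real vec \<Rightarrow> real vec \<Rightarrow> real" where
  "norm_r pr x = vnorm (mat_diag (dim_vec pr) (\<lambda>i. sqrt (pr $ i)) *\<^sub>v x)"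

definition norm_c :: "real vec \<Rightarrow> real vec \<Rightarrow> real" where
  "norm_c pc x = vnorm (mat_diag (dim_vec pc) (\<lambda>i. inverse (sqrt (pc $ i))) *\<^sub>v x)"

definition induced_norm :: "(real vec \<Rightarrow> real) \<Rightarrow> real mat \<Rightarrow> real" where
  "induced_norm N X = Sup {N (X *\<^sub>v x) |x. x \<in> carrier_vec (dim_col X) \<and> N x = 1}"

definition sigma_A :: "real mat \<Rightarrow> real vec \<Rightarrow> real" where
  "sigma_A A pr = induced_norm (norm_r pr) (A - mat_lim A)"

definition sigma_B :: "real mat \<Rightarrow> real vec \<Rightarrow> real" where
  "sigma_B B pc = induced_norm (norm_c pc) (B - mat_lim B)"

(* An arc (r,i) of G means that node i receives information from node r. *)
locale directed_network =
  fixes n :: nat and G :: "nat pair_pre_digraph" and A B :: "real mat" and pr pc :: "real vec"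
  assumes graph: "pair_fin_digraph G" "pverts G = {..<n}" "strongly_connected (with_proj G)"
    and A_dim: "A \<in> carrier_mat n n" and B_dim: "B \<in> carrier_mat n n"
    and A_prim: "primitive_mat A" and B_prim: "primitive_mat B"
    and A_compat: "\<And>i r. i < n \<Longrightarrow> r < n \<Longrightarrow> A $$ (i,r) \<noteq> 0 \<longleftrightarrow> i = r \<or> (r,i) \<in> parcs G"
    and B_compat: "\<And>i r. i < n \<Longrightarrow> r < n \<Longrightarrow> B $$ (i,r) \<noteq> 0 \<longleftrightarrow> i = r \<or> (r,i) \<in> parcs G"
    and A_row_stochastic: "A *\<^sub>v ones n = ones n"
    and B_col_stochastic: "transpose_mat B *\<^sub>v ones n = ones n"
    and pr_eigen: "eigenvector (transpose_mat A) pr 1"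
    and pr_pos: "\<And>i. i < n \<Longrightarrow> pr $ i > 0" and pr_sum: "(\<Sum>i<n. pr $ i) = 1"
    and pc_eigen: "eigenvector B pc 1"
    and pc_pos: "\<And>i. i < n \<Longrightarrow> pc $ i > 0" and pc_sum: "(\<Sum>i<n. pc $ i) = 1"
    and sigma_A: "sigma_A A pr \<in> {0<..<1}"
    and sigma_B: "sigma_B B pc \<in> {0<..<1}"

subsection \<open>Constants\<close>

definition max_size :: "nat \<Rightarrow> (nat \<Rightarrow> nat) \<Rightarrow> nat" where
  "max_size n m = Max (m ` {..<n})"

definition min_size :: "nat \<Rightarrow> (nat \<Rightarrow> nat) \<Rightarrow> nat" where
  "min_size n m = Min (m ` {..<n})"

(* h_r = entry_ratio pr and h_c = entry_ratio pc. *)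
definition entry_ratio :: "real vec \<Rightarrow> real" where
  "entry_ratio v = Max (set\<^sub>v v) / Min (set\<^sub>v v)"

definition psi :: "nat \<Rightarrow> real vec \<Rightarrow> real vec \<Rightarrow> real" where
  "psi n pr pc = sqrt (entry_ratio pr * entry_ratio pc) / (real n * (pr \<bullet> pc))"

definition alpha_bar :: "nat \<Rightarrow> (nat \<Rightarrow> nat) \<Rightarrow> real \<Rightarrow> real \<Rightarrow> real vec \<Rightarrow> real vec \<Rightarrow> real" where
  "alpha_bar n m L \<mu> pr pc =
     Min {1 / (35 * L * sqrt (entry_ratio pr * entry_ratio pc)),
          real (min_size n m) / (288 * real (max_size n m) * real n * (L / \<mu>) * L * (pr \<bullet> pc)),
          1 / (9 * \<mu> * real (max_size n m) * (pr \<bullet> pc))}"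

definition d_bar ::
  "nat \<Rightarrow> (nat \<Rightarrow> nat) \<Rightarrow> real \<Rightarrow> real \<Rightarrow> real mat \<Rightarrow> real vec \<Rightarrow> real vec \<Rightarrow> real" where
  "d_bar n m L \<mu> B pr pc =
     ln (1265 * (L / \<mu>) / (pr \<bullet> pc)
           * sqrt (real n * real (max_size n m) * entry_ratio pc / real (min_size n m)))
       / ln (1 / sigma_B B pc)"

definition rounds_B ::
  "nat \<Rightarrow> (nat \<Rightarrow> nat) \<Rightarrow> real \<Rightarrow> real \<Rightarrow> real mat \<Rightarrow> real vec \<Rightarrow> real vec \<Rightarrow> nat" where
  "rounds_B n m L \<mu> B pr pc = nat \<lceil>d_bar n m L \<mu> B pr pc\<rceil>"

definition c_bar ::
  "nat \<Rightarrow> (nat \<Rightarrow> nat) \<Rightarrow> real \<Rightarrow> real \<Rightarrow> real mat \<Rightarrow> real mat \<Rightarrow> real vec \<Rightarrow> real vec \<Rightarrow> real" where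
  "c_bar n m L \<mu> A B pr pc =
     ln (90512 * real n * real (max_size n m) * (L / \<mu>)
           / (real (min_size n m) * (1 - sigma_B B pc ^ (2 * rounds_B n m L \<mu> B pr pc)))
           * sqrt (entry_ratio pr * entry_ratio pc / (pr \<bullet> pc)))
       / ln (1 / sigma_A A pr)"

definition rounds_A ::
  "nat \<Rightarrow> (nat \<Rightarrow> nat) \<Rightarrow> real \<Rightarrow> real \<Rightarrow> real mat \<Rightarrow> real mat \<Rightarrow> real vec \<Rightarrow> real vec \<Rightarrow> nat" where
  "rounds_A n m L \<mu> A B pr pc = nat \<lceil>c_bar n m L \<mu> A B pr pc\<rceil>"

subsection \<open>The algorithm AB-SAGA\<close>

(* s_i^k is the coordinate (k, i) of a sample, k >= 1: the draws are independent and s_i^k is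
   uniform on the m i component indices of node i. *)
definition draws :: "nat \<Rightarrow> (nat \<Rightarrow> nat) \<Rightarrow> (nat \<times> nat \<Rightarrow> nat) measure" where
  "draws n m = PiM ({1..} \<times> {..<n}) (\<lambda>(k,i). uniform_count_measure {..<m i})"

(* The k-th state is (x^k, w^k, g^k, v^(k+1)).  One iteration mixes c times with A and d times
   with B. *)
fun ab_saga ::
  "nat \<Rightarrow> nat \<Rightarrow> (nat \<Rightarrow> nat) \<Rightarrow> (nat \<Rightarrow> nat \<Rightarrow> real vec \<Rightarrow> real) \<Rightarrow> real mat \<Rightarrow> real mat \<Rightarrow> nat \<Rightarrow> nat
    \<Rightarrow> real \<Rightarrow> (nat \<Rightarrow> real vec) \<Rightarrow> (nat \<times> nat \<Rightarrow> nat) \<Rightarrow> nat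
    \<Rightarrow> (nat \<Rightarrow> real vec) \<times> (nat \<Rightarrow> real vec) \<times> (nat \<Rightarrow> real vec) \<times> (nat \<Rightarrow> nat \<Rightarrow> real vec)" where
  "ab_saga n p m f A B c d \<alpha> x0 \<omega> 0 =
     (x0, \<lambda>i. grad p (node_obj m f i) (x0 i), \<lambda>i. grad p (node_obj m f i) (x0 i), \<lambda>i j. x0 i)"
| "ab_saga n p m f A B c d \<alpha> x0 \<omega> (Suc k) =
     (let (x, w, g, v) = ab_saga n p m f A B c d \<alpha> x0 \<omega> k;
          s = (\<lambda>i. \<omega> (Suc k, i));
          x' = (\<lambda>i. finsum_vec TYPE(real) p
                      (\<lambda>r. (A ^\<^sub>m c) $$ (i,r) \<cdot>\<^sub>v (x r - \<alpha> \<cdot>\<^sub>v w r)) {..<n});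
          g' = (\<lambda>i. grad p (f i (s i)) (x' i) - grad p (f i (s i)) (v i (s i))
                    + (1 / real (m i)) \<cdot>\<^sub>v
                        finsum_vec TYPE(real) p (\<lambda>j. grad p (f i j) (v i j)) {..<m i});
          w' = (\<lambda>i. finsum_vec TYPE(real) p
                      (\<lambda>r. (B ^\<^sub>m d) $$ (i,r) \<cdot>\<^sub>v (w r + g' r - g r)) {..<n});
          v' = (\<lambda>i j. if j = s i then x' i else v i j)
      in (x', w', g', v'))"

(* The integrand depends on finitely many draws, each with finitely many values, so it is
   integrable and the integral is a genuine expectation. *)
definition mean_sq_error ::
  "nat \<Rightarrow> nat \<Rightarrow> (nat \<Rightarrow> nat) \<Rightarrow> (nat \<Rightarrow> nat \<Rightarrow> real vec \<Rightarrow> real) \<Rightarrow> real mat \<Rightarrow> real mat \<Rightarrow> nat \<Rightarrow> nat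
    \<Rightarrow> real \<Rightarrow> (nat \<Rightarrow> real vec) \<Rightarrow> real vec \<Rightarrow> nat \<Rightarrow> nat \<Rightarrow> real" where
  "mean_sq_error n p m f A B c d \<alpha> x0 xs k i =
     (LINT \<omega>|draws n m. (vnorm (fst (ab_saga n p m f A B c d \<alpha> x0 \<omega> k) i - xs))\<^sup>2)"

(* Component gradients computed by node i in the initialization and the first k iterations, which
   produce x^k: m i of them to fill the table at x^0, then one per iteration. *)
definition grad_evals :: "(nat \<Rightarrow> nat) \<Rightarrow> nat \<Rightarrow> nat \<Rightarrow> nat" where
  "grad_evals m k i = m i + k"

end

(* The error of the averaged iterate, the disagreement between the nodes, the error of the gradient
   tables, the gradient tracking error and the size of the gradient estimates form a Lyapunov
   function that is a weighted sum of squares and contracts, in conditional expectation given the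
   past, by the factor 1 - min (\<alpha> n \<mu> (\<pi>_r . \<pi>_c) / 4) (1 / (2 M)).  The Markov state has to consist of
   x^(k+1), w^k, g^k and v^(k+1), because x^(k+1) is already determined when s^(k+1) is drawn; then the
   estimate g^(k+1) is unbiased given the state.  The many communication rounds make the
   disagreement and tracking errors contract so strongly that they only perturb plain gradient
   descent with SAGA noise; only the marginal distribution of each draw matters, not the independence
   of the nodes.  Since the integrands depend on finitely many draws, all expectations are finite
   averages. *)

theory Submission
  imports Defs
begin

text \<open>Weighting the nodes by \<open>pr\<close> exposes gradient descent for F: mixing with A
  leaves this mean unchanged, and with exact tracking w would be \<open>pc\<close> times the sum of
  the estimates, so the mean moves with the effective step-size \<eta> = \<alpha> n (\<pi>_r .
  \<pi>_c). This is where the rate \<theta> = \<eta> \<mu> comes from. Paying for it out of the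
  decrease \<theta> asks for \<eta> L^2 M / m to be a small multiple of \<mu>, which is the second
  entry of the step-size minimum and the source of \<kappa>^2 M / m. The tracking error is driven by
  the difference of two consecutive estimates; hence the previous estimate has to be remembered in
  the Lyapunov function. Estimates are measured from the node gradients at the minimizer, which sum
  to zero although the single ones need not vanish, so that their sum is small near the
  optimum.\<close>

subsection \<open>Finite averages and the distribution of the draws\<close>

text \<open>By the conventions for division by zero, the average over an empty or infinite set is 0,
  so linearity and monotonicity hold for every \<open>S\<close>; only rules that evaluate a constant
  ask for a finite nonempty set.\<close>

definition avg :: "'a set \<Rightarrow> ('a \<Rightarrow> real) \<Rightarrow> real" where
  "avg S h = (\<Sum>s\<in>S. h s) / real (card S)"

lemma avg_cong: "(\<And>s. s \<in> S \<Longrightarrow> h s = k s) \<Longrightarrow> avg S h = avg S k"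
  unfolding avg_def by (simp cong: sum.cong)

lemma avg_add: "avg S (\<lambda>s. h s + k s) = avg S h + avg S k"
  by (simp add: avg_def sum.distrib add_divide_distrib)

lemma avg_diff: "avg S (\<lambda>s. h s - k s) = avg S h - avg S k"
  by (simp add: avg_def sum_subtractf diff_divide_distrib)

lemma avg_cmult: "avg S (\<lambda>s. c * h s) = c * avg S h"
  by (simp add: avg_def sum_distrib_left)

lemma avg_sum: "avg S (\<lambda>s. \<Sum>i\<in>I. h i s) = (\<Sum>i\<in>I. avg S (h i))"
  unfolding avg_def by (subst sum.swap) (simp add: sum_divide_distrib)

lemma avg_const: "finite S \<Longrightarrow> S \<noteq> {} \<Longrightarrow> avg S (\<lambda>_. c) = c"
  by (simp add: avg_def)

lemma avg_mono: "(\<And>s. s \<in> S \<Longrightarrow> h s \<le> k s) \<Longrightarrow> avg S h \<le> avg S k"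
  unfolding avg_def by (intro divide_right_mono sum_mono) auto

lemma avg_nonneg: "(\<And>s. s \<in> S \<Longrightarrow> 0 \<le> h s) \<Longrightarrow> 0 \<le> avg S h"
  unfolding avg_def by (intro divide_nonneg_nonneg sum_nonneg) auto

lemma avg_variance_le:
  fixes h :: "'a \<Rightarrow> real"
  assumes "finite S" "S \<noteq> {}"
  shows "avg S (\<lambda>s. (h s - avg S h)\<^sup>2) \<le> avg S (\<lambda>s. (h s)\<^sup>2)"
proof -
  have "avg S (\<lambda>s. (h s - avg S h)\<^sup>2)
      = avg S (\<lambda>s. (h s)\<^sup>2 - 2 * avg S h * h s + (avg S h)\<^sup>2)"
    by (intro avg_cong) (simp add: power2_eq_square algebra_simps)
  also have "\<dots> = avg S (\<lambda>s. (h s)\<^sup>2) - (avg S h)\<^sup>2"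
    using assms by (simp add: avg_add avg_diff avg_cmult avg_const power2_eq_square)
  finally show ?thesis by simp
qed

lemma avg_square_le:
  fixes h :: "'a \<Rightarrow> real"
  assumes "finite S" "S \<noteq> {}"
  shows "(avg S h)\<^sup>2 \<le> avg S (\<lambda>s. (h s)\<^sup>2)"
proof -
  have "0 \<le> avg S (\<lambda>s. (h s - avg S h)\<^sup>2)"
    by (intro avg_nonneg) simp
  also have "\<dots> = avg S (\<lambda>s. (h s)\<^sup>2 - 2 * avg S h * h s + (avg S h)\<^sup>2)"
    by (intro avg_cong) (simp add: power2_eq_square algebra_simps)
  also have "\<dots> = avg S (\<lambda>s. (h s)\<^sup>2) - (avg S h)\<^sup>2"
    using assms by (simp add: avg_add avg_diff avg_cmult avg_const power2_eq_square)
  finally show ?thesis by simp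
qed

text \<open>Written as a product with factor 1 at all other coordinates, \<open>h (s i)\<close> lets
  the sum over the product set factor, and the other factors cancel against the cardinality. So a
  quantity of one node sees only the marginal of its own draw.\<close>

lemma avg_PiE_component:
  assumes I: "finite I" "i \<in> I"
    and A: "\<And>i. i \<in> I \<Longrightarrow> finite (A i)" "\<And>i. i \<in> I \<Longrightarrow> A i \<noteq> {}"
  shows "avg (PiE I A) (\<lambda>s. h (s i)) = avg (A i) h"
proof -
  have "(\<Sum>s\<in>PiE I A. h (s i)) = (\<Sum>s\<in>PiE I A. \<Prod>r\<in>I. if r = i then h (s r) else 1)"
    using I by (intro sum.cong) (auto simp: prod.remove[of I i])
  also have "\<dots> = (\<Prod>r\<in>I. \<Sum>j\<in>A r. if r = i then h j else 1)"
    using I A by (subst prod_sum_PiE) auto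
  also have "\<dots> = (\<Sum>j\<in>A i. h j) * (\<Prod>r\<in>I - {i}. real (card (A r)))"
    using I by (subst prod.remove[of I i]) (auto intro!: prod.cong)
  finally have *: "(\<Sum>s\<in>PiE I A. h (s i)) = (\<Sum>j\<in>A i. h j) * (\<Prod>r\<in>I - {i}. real (card (A r)))" .
  have "real (card (PiE I A)) = real (card (A i)) * (\<Prod>r\<in>I - {i}. real (card (A r)))"
    using I by (simp add: card_PiE prod.remove[of I i])
  moreover have "(\<Prod>r\<in>I - {i}. real (card (A r))) \<noteq> 0"
    using I A by (auto simp: card_eq_0_iff)
  ultimately show ?thesis
    unfolding avg_def * by simp
qed

abbreviation round_draws :: "nat \<Rightarrow> (nat \<Rightarrow> nat) \<Rightarrow> (nat \<Rightarrow> nat) set" where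
  "round_draws n m \<equiv> PiE {..<n} (\<lambda>i. {..<m i})"

abbreviation first_draws :: "nat \<Rightarrow> (nat \<Rightarrow> nat) \<Rightarrow> nat \<Rightarrow> (nat \<times> nat \<Rightarrow> nat) set" where
  "first_draws n m k \<equiv> PiE ({1..k} \<times> {..<n}) (\<lambda>(l, i). {..<m i})"

text \<open>\<open>k\<close> is the index of the added round, so a history of \<open>k\<close>
  rounds is extended with \<open>Suc k\<close>. At nodes from \<open>n\<close> on the new row
  inherits \<open>undefined\<close> from an extensional \<open>s\<close>, which keeps the history
  extensional.\<close>

definition add_round :: "nat \<Rightarrow> (nat \<times> nat \<Rightarrow> nat) \<Rightarrow> (nat \<Rightarrow> nat) \<Rightarrow> nat \<times> nat \<Rightarrow> nat" where
  "add_round k \<omega> s = (\<lambda>(l, i). if l = k then s i else \<omega> (l, i))"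

lemma finite_round_draws: "finite (round_draws n m)"
  by (intro finite_PiE) auto

lemma finite_first_draws: "finite (first_draws n m k)"
  by (intro finite_PiE) auto

lemma round_draws_nonempty: "(\<And>i. i < n \<Longrightarrow> m i \<ge> 1) \<Longrightarrow> round_draws n m \<noteq> {}"
  by (auto simp: PiE_eq_empty_iff lessThan_empty_iff Suc_le_eq)

lemma first_draws_nonempty: "(\<And>i. i < n \<Longrightarrow> m i \<ge> 1) \<Longrightarrow> first_draws n m k \<noteq> {}"
  by (auto simp: PiE_eq_empty_iff lessThan_empty_iff Suc_le_eq)

lemma bij_betw_add_round:
  "bij_betw (\<lambda>(\<omega>, s). add_round (Suc k) \<omega> s)
     (first_draws n m k \<times> round_draws n m) (first_draws n m (Suc k))"
proof (rule bij_betw_byWitness[where f' =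
    "\<lambda>\<omega>. (restrict \<omega> ({1..k} \<times> {..<n}), \<lambda>i. \<omega> (Suc k, i))"], goal_cases)
  case 1
  then show ?case
  proof (intro ballI, clarsimp, intro conjI ext, goal_cases)
    case (1 \<omega> s x) then show ?case
      by (cases x) (auto simp: add_round_def PiE_def extensional_def)
  next
    case (2 \<omega> s x) then show ?case
      by (auto simp: add_round_def PiE_def extensional_def)
  qed
next
  case 2
  then show ?case
  proof (intro ballI, clarsimp, intro ext, goal_cases)
    case (1 \<omega> x) then show ?case
      by (cases x) (auto simp: add_round_def PiE_def extensional_def restrict_def)
  qed
next
  case 3
  then show ?case
    by (auto simp: add_round_def PiE_def extensional_def Pi_def split: if_splits)
next
  case 4
  then show ?case
    by (auto simp: PiE_def extensional_def Pi_def)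
qed

text \<open>The tower property: the inner average is the conditional expectation given the first
  \<open>k\<close> rounds.\<close>

lemma avg_first_draws_Suc:
  "avg (first_draws n m (Suc k)) F
     = avg (first_draws n m k) (\<lambda>\<omega>. avg (round_draws n m) (\<lambda>s. F (add_round (Suc k) \<omega> s)))"
proof -
  have "(\<Sum>\<omega>\<in>first_draws n m (Suc k). F \<omega>)
      = (\<Sum>(\<omega>, s)\<in>first_draws n m k \<times> round_draws n m. F (add_round (Suc k) \<omega> s))"
    using sum.reindex_bij_betw[OF bij_betw_add_round[of k n m], of F]
    by (simp add: case_prod_unfold)
  also have "\<dots> = (\<Sum>\<omega>\<in>first_draws n m k. \<Sum>s\<in>round_draws n m. F (add_round (Suc k) \<omega> s))"
    by (simp add: sum.cartesian_product)
  finally have *: "(\<Sum>\<omega>\<in>first_draws n m (Suc k). F \<omega>)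
    = (\<Sum>\<omega>\<in>first_draws n m k. \<Sum>s\<in>round_draws n m. F (add_round (Suc k) \<omega> s))" .
  have "card (first_draws n m (Suc k)) = card (first_draws n m k) * card (round_draws n m)"
    using bij_betw_same_card[OF bij_betw_add_round[of k n m]] by (simp add: card_cartesian_product)
  then show ?thesis
    unfolding avg_def * by (simp add: sum_divide_distrib divide_divide_eq_left mult.commute)
qed

lemma PiM_uniform_count_measure:
  assumes I: "finite I" and A: "\<And>i. i \<in> I \<Longrightarrow> finite (A i)" "\<And>i. i \<in> I \<Longrightarrow> A i \<noteq> {}"
  shows "PiM I (\<lambda>i. uniform_count_measure (A i)) = uniform_count_measure (PiE I A)"
proof -
  \<comment> \<open>\<open>product_prob_space\<close> asks for a probability measure at every index,
    so the indices outside \<open>I\<close> receive a one-point set.\<close>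
  define A' where "A' i = (if i \<in> I then A i else {undefined})" for i
  have A': "finite (A' i)" "A' i \<noteq> {}" for i
    using A by (auto simp: A'_def)
  have eq: "PiM I (\<lambda>i. uniform_count_measure (A i)) = PiM I (\<lambda>i. uniform_count_measure (A' i))"
           "PiE I A = PiE I A'"
    by (auto simp: A'_def intro!: PiM_cong PiE_cong)
  interpret product_prob_space "\<lambda>i. uniform_count_measure (A' i)" I
    using A' by (simp add: product_prob_space_def product_prob_space_axioms_def
      product_sigma_finite_def prob_space_uniform_count_measure prob_space_imp_sigma_finite)
  have "PiM I (\<lambda>i. uniform_count_measure (A' i)) = uniform_count_measure (PiE I A')"
  proof (rule measure_eqI_finite[of _ "PiE I A'"])
    have "sets (PiM I (\<lambda>i. uniform_count_measure (A' i))) = sets (PiM I (\<lambda>i. count_space (A' i)))"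
      by (intro sets_PiM_cong) (auto simp: sets_uniform_count_measure)
    also have "\<dots> = Pow (PiE I A')"
      using A' by (subst count_space_PiM_finite[OF I]) (auto simp: countable_finite)
    finally show "sets (PiM I (\<lambda>i. uniform_count_measure (A' i))) = Pow (PiE I A')" .
    show "sets (uniform_count_measure (PiE I A')) = Pow (PiE I A')"
      by (simp add: sets_uniform_count_measure)
    show fin: "finite (PiE I A')"
      using A' I by (intro finite_PiE) auto
    fix a assume a: "a \<in> PiE I A'"
    then have s: "{a} = PiE I (\<lambda>i. {a i})"
      by (intro PiE_singleton[symmetric]) (simp add: PiE_def)
    have "emeasure (PiM I (\<lambda>i. uniform_count_measure (A' i))) {a}
        = (\<Prod>i\<in>I. emeasure (uniform_count_measure (A' i)) {a i})"
      unfolding s using a I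
      by (intro emeasure_PiM) (auto simp: sets_uniform_count_measure)
    also have "\<dots> = (\<Prod>i\<in>I. ennreal (1 / real (card (A' i))))"
      using a A' by (intro prod.cong refl) (subst emeasure_uniform_count_measure, auto)
    also have "\<dots> = ennreal (1 / real (card (PiE I A')))"
      using I by (simp add: prod_ennreal card_PiE prod_dividef)
    also have "\<dots> = emeasure (uniform_count_measure (PiE I A')) {a}"
      using a fin by (simp add: emeasure_uniform_count_measure)
    finally show "emeasure (PiM I (\<lambda>i. uniform_count_measure (A' i))) {a}
      = emeasure (uniform_count_measure (PiE I A')) {a}" .
  qed
  then show ?thesis using eq by simp
qed

text \<open>The integrand sees only a finite marginal of the infinite product, and there every
  function is measurable. Dependence on the first \<open>k\<close> rounds is demanded for in-range
  samples only, since nothing is known about \<open>f i j\<close> with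
  \<open>j \<ge> m i\<close>.\<close>

lemma integral_draws:
  assumes m: "\<And>i. i < n \<Longrightarrow> m i \<ge> 1"
    and F: "\<And>\<omega>. (\<And>l i. 1 \<le> l \<Longrightarrow> i < n \<Longrightarrow> \<omega> (l, i) < m i)
      \<Longrightarrow> F (restrict \<omega> ({1..k} \<times> {..<n})) = F \<omega>"
  shows "(LINT \<omega>|draws n m. F \<omega>) = avg (first_draws n m k) F"
proof -
  let ?J = "{1..k} \<times> {..<n}" and ?I = "{1..} \<times> {..<n}"
  \<comment> \<open>Nodes from \<open>n\<close> on get the one-point space on 0, because
    \<open>m i\<close> may be 0 there and every factor has to be a probability space.\<close>
  define U where "U = (\<lambda>(l::nat, i). uniform_count_measure (if i < n then {..<m i} else {0}))"
  have draws: "draws n m = PiM ?I U"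
    unfolding draws_def U_def by (intro PiM_cong) auto
  interpret product_prob_space U ?I
  proof -
    have "prob_space (U x)" for x
      using m by (cases x) (auto simp: U_def lessThan_empty_iff Suc_le_eq
        intro!: prob_space_uniform_count_measure)
    then show "product_prob_space U"
      by (simp add: product_prob_space_def product_prob_space_axioms_def
        product_sigma_finite_def prob_space_imp_sigma_finite)
  qed
  have J: "PiM ?J U = uniform_count_measure (first_draws n m k)"
  proof -
    have "PiM ?J U = PiM ?J (\<lambda>x. uniform_count_measure ((\<lambda>(l, i). {..<m i}) x))"
      by (intro PiM_cong) (auto simp: U_def)
    also have "\<dots> = uniform_count_measure (first_draws n m k)"
      using m by (intro PiM_uniform_count_measure) (auto simp: lessThan_empty_iff Suc_le_eq)
    finally show ?thesis .
  qed
  have "(LINT \<omega>|draws n m. F \<omega>) = (LINT \<omega>|PiM ?I U. F (restrict \<omega> ?J))"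
    unfolding draws
  proof (intro Bochner_Integration.integral_cong refl)
    fix \<omega> assume "\<omega> \<in> space (PiM ?I U)"
    then have "\<omega> x \<in> space (U x)" if "x \<in> ?I" for x
      using that by (auto simp: space_PiM)
    then have "\<omega> (l, i) < m i" if "1 \<le> l" "i < n" for l i
      using that by (force simp: U_def space_uniform_count_measure)
    then show "F \<omega> = F (restrict \<omega> ?J)"
      by (intro F[symmetric])
  qed
  also have "\<dots> = (LINT \<omega>|distr (PiM ?I U) (PiM ?J U) (\<lambda>\<omega>. restrict \<omega> ?J). F \<omega>)"
  proof (intro integral_distr[symmetric] measurable_restrict_subset)
    show "F \<in> borel_measurable (PiM ?J U)"
      unfolding J by (auto simp: measurable_def sets_uniform_count_measure space_uniform_count_measure)
  qed auto
  also have "\<dots> = (LINT \<omega>|PiM ?J U. F \<omega>)"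
    by (subst distr_PiM_restrict_finite) auto
  also have "\<dots> = avg (first_draws n m k) F"
    by (simp only: J integral_uniform_count_measure[OF finite_first_draws] avg_def)
  finally show ?thesis .
qed

section \<open>Squared norms in coordinates\<close>

text \<open>The estimates are carried out on real coordinate functions, so that vectors and their
  carrier conditions appear only at the interface to the algorithm.\<close>

definition sqn :: "nat \<Rightarrow> (nat \<Rightarrow> real) \<Rightarrow> real" where
  "sqn p u = (\<Sum>q<p. (u q)\<^sup>2)"

lemma sqn_nonneg [simp]: "0 \<le> sqn p u"
  by (simp add: sqn_def sum_nonneg)

lemma scalar_prod_coord:
  "y \<in> carrier_vec p \<Longrightarrow> x \<bullet> y = (\<Sum>q<p. x $ q * y $ q)"
  by (simp add: scalar_prod_def lessThan_atLeast0)

lemma vnorm_square: "x \<in> carrier_vec p \<Longrightarrow> (vnorm x)\<^sup>2 = sqn p (\<lambda>q. x $ q)"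
  by (simp add: vnorm_def scalar_prod_coord sqn_def power2_eq_square sum_nonneg)

lemma vnorm_nonneg: "x \<in> carrier_vec p \<Longrightarrow> 0 \<le> vnorm x"
  by (simp add: vnorm_def scalar_prod_coord sum_nonneg)

lemma vnorm_smult: "x \<in> carrier_vec p \<Longrightarrow> vnorm (c \<cdot>\<^sub>v x) = \<bar>c\<bar> * vnorm x"
  by (simp add: vnorm_def real_sqrt_mult flip: power2_eq_square mult.assoc)

lemma vnorm_square_minus:
  "x \<in> carrier_vec p \<Longrightarrow> y \<in> carrier_vec p \<Longrightarrow> (vnorm (x - y))\<^sup>2 = sqn p (\<lambda>q. x $ q - y $ q)"
  by (subst vnorm_square[of _ p]) (auto simp: sqn_def)

subsection \<open>Gradients\<close>

text \<open>On a line, uniqueness of the gradient, its vanishing at a minimum and the strong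
  convexity inequality all become statements about one-dimensional derivatives.\<close>

lemma has_gradient_line:
  assumes g: "has_gradient p f x g" and x: "x \<in> carrier_vec p" and u: "u \<in> carrier_vec p"
  shows "((\<lambda>t. f (x + t \<cdot>\<^sub>v u)) has_real_derivative g \<bullet> u) (at 0)"
  unfolding has_field_derivative_iff LIM_eq
proof (intro allI impI)
  fix r :: real assume r: "r > 0"
  have nu: "0 \<le> vnorm u" using u by (rule vnorm_nonneg)
  \<comment> \<open>The summand 1 covers \<open>u = 0\<close>; the factor 2 turns the weak
    inequality of \<open>has_gradient\<close> into the strict one of the limit.\<close>
  have "r / (2 * (1 + vnorm u)) > 0"
    using r nu by simp
  then obtain \<delta> where \<delta>: "\<delta> > 0" and
    *: "\<And>y. y \<in> carrier_vec p \<Longrightarrow> vnorm (y - x) < \<delta> \<Longrightarrow>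
        \<bar>f y - f x - g \<bullet> (y - x)\<bar> \<le> r / (2 * (1 + vnorm u)) * vnorm (y - x)"
    using g unfolding has_gradient_def by blast
  have gc: "g \<in> carrier_vec p"
    using g by (simp add: has_gradient_def)
  show "\<exists>s>0. \<forall>t. t \<noteq> 0 \<and> norm (t - 0) < s \<longrightarrow>
    norm ((f (x + t \<cdot>\<^sub>v u) - f (x + 0 \<cdot>\<^sub>v u)) / (t - 0) - g \<bullet> u) < r"
  proof (intro exI[of _ "\<delta> / (1 + vnorm u)"] conjI allI impI)
    show "0 < \<delta> / (1 + vnorm u)" using \<delta> nu by simp
    fix t :: real assume t: "t \<noteq> 0 \<and> norm (t - 0) < \<delta> / (1 + vnorm u)"
    have d: "(x + t \<cdot>\<^sub>v u) - x = t \<cdot>\<^sub>v u"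
      using x u by (intro eq_vecI) auto
    have x0: "x + 0 \<cdot>\<^sub>v u = x"
      using x u by (intro eq_vecI) auto
    have n: "vnorm (t \<cdot>\<^sub>v u) = \<bar>t\<bar> * vnorm u"
      using u by (rule vnorm_smult)
    have "\<bar>t\<bar> * (1 + vnorm u) < \<delta>"
      using t nu by (simp add: field_simps)
    then have "\<bar>t\<bar> * vnorm u < \<delta>"
      by (simp add: algebra_simps)
    then have "\<bar>f (x + t \<cdot>\<^sub>v u) - f x - t * (g \<bullet> u)\<bar> \<le> r / (2 * (1 + vnorm u)) * (\<bar>t\<bar> * vnorm u)"
      using *[of "x + t \<cdot>\<^sub>v u"] x u gc by (simp add: d n)
    also have "\<dots> = \<bar>t\<bar> * (r / 2 * (vnorm u / (1 + vnorm u)))"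
      by simp
    also have "\<dots> \<le> \<bar>t\<bar> * (r / 2 * 1)"
      using nu r by (intro mult_left_mono) auto
    finally have "\<bar>f (x + t \<cdot>\<^sub>v u) - f x - t * (g \<bullet> u)\<bar> \<le> \<bar>t\<bar> * (r / 2)"
      by simp
    moreover have "f (x + t \<cdot>\<^sub>v u) - f x - t * (g \<bullet> u)
        = t * ((f (x + t \<cdot>\<^sub>v u) - f x) / t - g \<bullet> u)"
      using t by (simp add: field_simps)
    ultimately have "\<bar>(f (x + t \<cdot>\<^sub>v u) - f x) / t - g \<bullet> u\<bar> \<le> r / 2"
      using t by (simp add: abs_mult)
    then show "norm ((f (x + t \<cdot>\<^sub>v u) - f (x + 0 \<cdot>\<^sub>v u)) / (t - 0) - g \<bullet> u) < r"
      using r by (simp add: x0)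
  qed
qed

lemma vec_eq_0_if_scalar_prods:
  fixes g :: "real vec"
  assumes "g \<in> carrier_vec p" "\<And>u. u \<in> carrier_vec p \<Longrightarrow> g \<bullet> u = 0"
  shows "g = 0\<^sub>v p"
proof (intro eq_vecI)
  fix q assume "q < dim_vec (0\<^sub>v p :: real vec)"
  then show "g $ q = 0\<^sub>v p $ q"
    using assms(2)[of "unit_vec p q"] assms(1) by (simp add: scalar_prod_right_unit)
qed (use assms in auto)

text \<open>Directional derivatives determine a gradient, which justifies the definite description
  in \<open>grad\<close>.\<close>

lemma grad_eq:
  assumes g: "has_gradient p f x g" and x: "x \<in> carrier_vec p"
  shows "grad p f x = g"
  unfolding grad_def
proof (rule the_equality)
  fix g' assume g': "has_gradient p f x g'"
  have c: "g \<in> carrier_vec p" "g' \<in> carrier_vec p"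
    using g g' by (auto simp: has_gradient_def)
  have "g' - g = 0\<^sub>v p"
  proof (rule vec_eq_0_if_scalar_prods)
    fix u :: "real vec" assume u: "u \<in> carrier_vec p"
    have "g' \<bullet> u = g \<bullet> u"
      using DERIV_unique[OF has_gradient_line[OF g' x u] has_gradient_line[OF g x u]] .
    then show "(g' - g) \<bullet> u = 0"
      using c u by (simp add: minus_scalar_prod_distrib)
  qed (use c in auto)
  then have "(g' - g) $ q = 0" if "q < p" for q
    using that by simp
  then show "g' = g"
    using c by (intro eq_vecI) auto
qed (use g in auto)

lemma has_gradient_lincomb:
  assumes "finite I" and x: "x \<in> carrier_vec p"
    and "\<And>i. i \<in> I \<Longrightarrow> has_gradient p (f i) x (g i)"
  shows "has_gradient p (\<lambda>y. \<Sum>i\<in>I. c i * f i y) x (Matrix.vec p (\<lambda>q. \<Sum>i\<in>I. c i * g i $ q))"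
  using assms(1,3)
proof (induction I rule: finite_induct)
  case empty
  have "Matrix.vec p (\<lambda>q. 0 :: real) = 0\<^sub>v p" by auto
  then show ?case
    using x by (auto simp: has_gradient_def intro!: exI[of _ 1] mult_nonneg_nonneg vnorm_nonneg[of _ p])
next
  case (insert a I)
  let ?g = "Matrix.vec p (\<lambda>q. \<Sum>i\<in>I. c i * g i $ q)"
  let ?h = "Matrix.vec p (\<lambda>q. \<Sum>i\<in>insert a I. c i * g i $ q)"
  have IH: "has_gradient p (\<lambda>y. \<Sum>i\<in>I. c i * f i y) x ?g"
    using insert by simp
  have ga: "has_gradient p (f a) x (g a)"
    using insert by simp
  show ?case
    unfolding has_gradient_def
  proof (intro conjI allI impI)
    fix e :: real assume e: "e > 0"
    obtain \<delta>1 where \<delta>1: "\<delta>1 > 0"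
      "\<And>y. y \<in> carrier_vec p \<Longrightarrow> vnorm (y - x) < \<delta>1 \<Longrightarrow>
         \<bar>(\<Sum>i\<in>I. c i * f i y) - (\<Sum>i\<in>I. c i * f i x) - ?g \<bullet> (y - x)\<bar> \<le> e / 2 * vnorm (y - x)"
      using IH e unfolding has_gradient_def by (meson half_gt_zero)
    have "e / (2 * (1 + \<bar>c a\<bar>)) > 0" using e by simp
    then obtain \<delta>2 where \<delta>2: "\<delta>2 > 0"
      "\<And>y. y \<in> carrier_vec p \<Longrightarrow> vnorm (y - x) < \<delta>2 \<Longrightarrow>
         \<bar>f a y - f a x - g a \<bullet> (y - x)\<bar> \<le> e / (2 * (1 + \<bar>c a\<bar>)) * vnorm (y - x)"
      using ga unfolding has_gradient_def by blast
    show "\<exists>\<delta>>0. \<forall>y\<in>carrier_vec p. vnorm (y - x) < \<delta> \<longrightarrow>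
        \<bar>(\<Sum>i\<in>insert a I. c i * f i y) - (\<Sum>i\<in>insert a I. c i * f i x) - ?h \<bullet> (y - x)\<bar>
          \<le> e * vnorm (y - x)"
    proof (intro exI[of _ "min \<delta>1 \<delta>2"] conjI ballI impI)
      fix y assume y: "y \<in> carrier_vec p" "vnorm (y - x) < min \<delta>1 \<delta>2"
      have yx: "y - x \<in> carrier_vec p" using x y by simp
      have nn: "0 \<le> vnorm (y - x)" using yx by (rule vnorm_nonneg)
      have h: "?h \<bullet> (y - x) = c a * (g a \<bullet> (y - x)) + ?g \<bullet> (y - x)"
        using insert.hyps yx
        by (simp add: scalar_prod_coord algebra_simps sum.distrib sum_distrib_left)
      have "\<bar>c a * (f a y - f a x - g a \<bullet> (y - x))\<bar>
          \<le> \<bar>c a\<bar> * (e / (2 * (1 + \<bar>c a\<bar>)) * vnorm (y - x))"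
        unfolding abs_mult using \<delta>2(2)[of y] y by (intro mult_left_mono) auto
      also have "\<dots> = e / 2 * vnorm (y - x) * (\<bar>c a\<bar> / (1 + \<bar>c a\<bar>))"
        by simp
      also have "\<dots> \<le> e / 2 * vnorm (y - x) * 1"
        using e nn by (intro mult_left_mono) auto
      finally have "\<bar>c a * (f a y - f a x - g a \<bullet> (y - x))\<bar> \<le> e / 2 * vnorm (y - x)"
        by simp
      moreover have "\<bar>(\<Sum>i\<in>I. c i * f i y) - (\<Sum>i\<in>I. c i * f i x) - ?g \<bullet> (y - x)\<bar>
          \<le> e / 2 * vnorm (y - x)"
        using \<delta>1(2)[of y] y by simp
      ultimately show "\<bar>(\<Sum>i\<in>insert a I. c i * f i y) - (\<Sum>i\<in>insert a I. c i * f i x) - ?h \<bullet> (y - x)\<bar>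
          \<le> e * vnorm (y - x)"
        unfolding h unfolding sum.insert[OF insert.hyps] right_diff_distrib by linarith
    qed (use \<delta>1 \<delta>2 in auto)
  qed auto
qed

lemma has_gradient_at_min:
  assumes g: "has_gradient p f x g" and x: "x \<in> carrier_vec p"
    and min: "\<And>y. y \<in> carrier_vec p \<Longrightarrow> f x \<le> f y"
  shows "g = 0\<^sub>v p"
proof (rule vec_eq_0_if_scalar_prods)
  fix u :: "real vec" assume u: "u \<in> carrier_vec p"
  have "x + 0 \<cdot>\<^sub>v u = x"
    using x u by (intro eq_vecI) auto
  then show "g \<bullet> u = 0"
    using DERIV_local_min[OF has_gradient_line[OF g x u], of 1] min x u by simp
qed (use g in \<open>simp add: has_gradient_def\<close>)

text \<open>On the segment from \<open>x\<close> to \<open>y\<close>, divide the strong convexity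
  inequality by \<open>t\<close> and let \<open>t\<close> tend to 0 from the right.\<close>

lemma strongly_convex_gradient:
  assumes sc: "strongly_convex p \<mu> F" and g: "has_gradient p F x g"
    and x: "x \<in> carrier_vec p" and y: "y \<in> carrier_vec p"
  shows "F x + g \<bullet> (y - x) + \<mu> / 2 * (vnorm (x - y))\<^sup>2 \<le> F y"
proof -
  let ?u = "y - x"
  let ?\<phi> = "\<lambda>t. F (x + t \<cdot>\<^sub>v ?u)"
  have x0: "x + 0 \<cdot>\<^sub>v ?u = x"
    using x y by (intro eq_vecI) auto
  have "(?\<phi> has_real_derivative g \<bullet> ?u) (at 0)"
    using x y by (intro has_gradient_line[OF g]) auto
  then have "((\<lambda>t. (?\<phi> t - F x) / t) \<longlongrightarrow> g \<bullet> ?u) (at 0)"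
    unfolding has_field_derivative_iff by (simp add: x0)
  then have 1: "((\<lambda>t. (?\<phi> t - F x) / t) \<longlongrightarrow> g \<bullet> ?u) (at_right 0)"
    by (rule tendsto_mono[rotated]) (simp add: at_le)
  have 2: "((\<lambda>t. F y - F x - \<mu> / 2 * (1 - t) * (vnorm (x - y))\<^sup>2)
      \<longlongrightarrow> F y - F x - \<mu> / 2 * (1 - 0) * (vnorm (x - y))\<^sup>2) (at_right 0)"
    by (intro tendsto_intros)
  have "\<forall>\<^sub>F t in at_right 0. (?\<phi> t - F x) / t \<le> F y - F x - \<mu> / 2 * (1 - t) * (vnorm (x - y))\<^sup>2"
    unfolding eventually_at_right_field
  proof (intro exI[of _ 1] conjI allI impI)
    fix t :: real assume t: "0 < t" "t < 1"
    have e: "x + t \<cdot>\<^sub>v ?u = t \<cdot>\<^sub>v y + (1 - t) \<cdot>\<^sub>v x"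
      using x y by (intro eq_vecI) (auto simp: algebra_simps)
    have "(vnorm (y - x))\<^sup>2 = (vnorm (x - y))\<^sup>2"
      using x y by (simp add: vnorm_square_minus sqn_def power2_commute)
    then have "?\<phi> t \<le> t * F y + (1 - t) * F x - \<mu> / 2 * t * (1 - t) * (vnorm (x - y))\<^sup>2"
      using sc[unfolded strongly_convex_def, rule_format, OF y x, of t] t e by simp
    then have "?\<phi> t - F x \<le> t * (F y - F x - \<mu> / 2 * (1 - t) * (vnorm (x - y))\<^sup>2)"
      by (simp add: algebra_simps)
    then show "(?\<phi> t - F x) / t \<le> F y - F x - \<mu> / 2 * (1 - t) * (vnorm (x - y))\<^sup>2"
      using t by (simp add: pos_divide_le_eq mult.commute)
  qed simp
  from tendsto_le[OF trivial_limit_at_right_real 2 1 this]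
  show ?thesis by simp
qed

section \<open>Gradients of the finite-sum objective\<close>

context finite_sum_problem
begin

text \<open>The gradient of f_i in coordinates (see \<open>grad_node\<close>), written as an average
  over the components so that it can be recognised as the mean of the SAGA estimate.\<close>

definition node_grad :: "nat \<Rightarrow> real vec \<Rightarrow> nat \<Rightarrow> real" where
  "node_grad i x q = avg {..<m i} (\<lambda>j. grad p (f i j) x $ q)"

lemma xs_carrier: "xs \<in> carrier_vec p"
  using minimizer by (simp add: is_arg_min_def)

lemma has_gradient_component:
  "i < n \<Longrightarrow> j < m i \<Longrightarrow> x \<in> carrier_vec p \<Longrightarrow> has_gradient p (f i j) x (grad p (f i j) x)"
  using smooth[of i j] grad_eq unfolding smooth_fun_def by blast

lemma grad_carrier:
  "i < n \<Longrightarrow> j < m i \<Longrightarrow> x \<in> carrier_vec p \<Longrightarrow> grad p (f i j) x \<in> carrier_vec p"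
  using has_gradient_component unfolding has_gradient_def by blast

lemma has_gradient_node:
  assumes "i < n" "x \<in> carrier_vec p"
  shows "has_gradient p (node_obj m f i) x (Matrix.vec p (node_grad i x))"
proof -
  have "has_gradient p (\<lambda>y. \<Sum>j<m i. 1 / real (m i) * f i j y) x
      (Matrix.vec p (\<lambda>q. \<Sum>j<m i. 1 / real (m i) * grad p (f i j) x $ q))"
    using assms by (intro has_gradient_lincomb has_gradient_component) auto
  also have "(\<lambda>y. \<Sum>j<m i. 1 / real (m i) * f i j y) = node_obj m f i"
    by (auto simp: node_obj_def sum_divide_distrib)
  also have "Matrix.vec p (\<lambda>q. \<Sum>j<m i. 1 / real (m i) * grad p (f i j) x $ q)
      = Matrix.vec p (node_grad i x)"
    by (intro eq_vecI) (auto simp: node_grad_def avg_def sum_divide_distrib)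
  finally show ?thesis .
qed

lemma grad_node:
  assumes "i < n" "x \<in> carrier_vec p"
  shows "grad p (node_obj m f i) x = Matrix.vec p (node_grad i x)"
  using assms by (intro grad_eq has_gradient_node)

lemma has_gradient_global:
  assumes "x \<in> carrier_vec p"
  shows "has_gradient p (global_obj n m f) x (Matrix.vec p (\<lambda>q. (\<Sum>i<n. node_grad i x q) / real n))"
proof -
  have "has_gradient p (\<lambda>y. \<Sum>i<n. 1 / real n * node_obj m f i y) x
      (Matrix.vec p (\<lambda>q. \<Sum>i<n. 1 / real n * Matrix.vec p (node_grad i x) $ q))"
    using assms by (intro has_gradient_lincomb has_gradient_node) auto
  also have "(\<lambda>y. \<Sum>i<n. 1 / real n * node_obj m f i y) = global_obj n m f"
    by (auto simp: global_obj_def sum_divide_distrib)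
  also have "Matrix.vec p (\<lambda>q. \<Sum>i<n. 1 / real n * Matrix.vec p (node_grad i x) $ q)
      = Matrix.vec p (\<lambda>q. (\<Sum>i<n. node_grad i x q) / real n)"
    by (intro eq_vecI) (auto simp: sum_divide_distrib)
  finally show ?thesis .
qed

lemma minimizer_le: "y \<in> carrier_vec p \<Longrightarrow> global_obj n m f xs \<le> global_obj n m f y"
  using minimizer unfolding is_arg_min_def by (auto simp: not_less)

lemma sum_node_grad_minimizer: "q < p \<Longrightarrow> (\<Sum>i<n. node_grad i xs q) = 0"
  using has_gradient_at_min[OF has_gradient_global[OF xs_carrier] xs_carrier minimizer_le] n_pos
  by (auto dest!: arg_cong[where f = "\<lambda>v. v $ q"])

text \<open>Adding the strong convexity inequalities at \<open>x\<close> and at \<open>xs\<close>,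
  where the gradient vanishes, gives \<open>\<mu>\<close> instead of the \<open>\<mu> / 2\<close> of
  a single one.\<close>

lemma strong_monotone:
  assumes x: "x \<in> carrier_vec p"
  shows "\<mu> * sqn p (\<lambda>q. x $ q - xs $ q)
    \<le> (\<Sum>q<p. (\<Sum>i<n. node_grad i x q) / real n * (x $ q - xs $ q))"
proof -
  let ?F = "global_obj n m f" and ?g = "Matrix.vec p (\<lambda>q. (\<Sum>i<n. node_grad i x q) / real n)"
  have "?F x + ?g \<bullet> (xs - x) + \<mu> / 2 * (vnorm (x - xs))\<^sup>2 \<le> ?F xs"
    using strongly_convex_gradient[OF strongly_convex has_gradient_global[OF x] x xs_carrier] .
  moreover have "?F xs + \<mu> / 2 * (vnorm (xs - x))\<^sup>2 \<le> ?F x"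
    using strongly_convex_gradient[OF strongly_convex has_gradient_global[OF xs_carrier] xs_carrier x]
      has_gradient_at_min[OF has_gradient_global[OF xs_carrier] xs_carrier minimizer_le] x xs_carrier
    by simp
  moreover have "(vnorm (xs - x))\<^sup>2 = (vnorm (x - xs))\<^sup>2"
    using x xs_carrier by (simp add: vnorm_square_minus sqn_def power2_commute)
  ultimately have "\<mu> * (vnorm (x - xs))\<^sup>2 \<le> - (?g \<bullet> (xs - x))"
    by simp
  also have "- (?g \<bullet> (xs - x)) = (\<Sum>q<p. (\<Sum>i<n. node_grad i x q) / real n * (x $ q - xs $ q))"
    using x xs_carrier by (subst scalar_prod_coord[of _ p]) (auto simp: right_diff_distrib sum_subtractf)
  finally show ?thesis
    using x xs_carrier by (simp add: vnorm_square_minus)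
qed

lemma grad_lipschitz:
  assumes "i < n" "j < m i" and x: "x \<in> carrier_vec p" and y: "y \<in> carrier_vec p"
  shows "sqn p (\<lambda>q. grad p (f i j) x $ q - grad p (f i j) y $ q)
    \<le> L\<^sup>2 * sqn p (\<lambda>q. x $ q - y $ q)"
proof -
  have c: "grad p (f i j) x \<in> carrier_vec p" "grad p (f i j) y \<in> carrier_vec p"
    using assms by (auto intro: grad_carrier)
  have "vnorm (grad p (f i j) x - grad p (f i j) y) \<le> L * vnorm (x - y)"
    using smooth[of i j] assms unfolding smooth_fun_def by blast
  then have "(vnorm (grad p (f i j) x - grad p (f i j) y))\<^sup>2 \<le> (L * vnorm (x - y))\<^sup>2"
    using c by (intro power_mono vnorm_nonneg[of _ p]) auto
  then show ?thesis
    using c x y by (simp add: vnorm_square_minus power_mult_distrib)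
qed

end

subsection \<open>Mixing with stochastic matrices\<close>

text \<open>The weights \<open>pr\<close> give the square of \<open>norm_r pr\<close>, the weights
  \<open>1 / pc\<close> that of \<open>norm_c pc\<close>.\<close>

definition wsq :: "nat \<Rightarrow> (nat \<Rightarrow> real) \<Rightarrow> (nat \<Rightarrow> real) \<Rightarrow> real" where
  "wsq n u x = (\<Sum>i<n. u i * (x i)\<^sup>2)"

definition mv :: "nat \<Rightarrow> real mat \<Rightarrow> (nat \<Rightarrow> real) \<Rightarrow> nat \<Rightarrow> real" where
  "mv n A x i = (\<Sum>r<n. A $$ (i, r) * x r)"

lemma mult_mat_vec_mv:
  "A \<in> carrier_mat n n \<Longrightarrow> A *\<^sub>v Matrix.vec n x = Matrix.vec n (mv n A x)"
  by (intro eq_vecI) (auto simp: mv_def scalar_prod_def lessThan_atLeast0)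

lemma mv_cong: "(\<And>r. r < n \<Longrightarrow> x r = y r) \<Longrightarrow> mv n A x i = mv n A y i"
  by (auto simp: mv_def intro: sum.cong)

lemma mv_diff: "mv n A (\<lambda>r. x r - y r) i = mv n A x i - mv n A y i"
  by (simp add: mv_def sum_subtractf algebra_simps)

lemma mv_cmult: "mv n A (\<lambda>r. c * x r) i = c * mv n A x i"
  by (simp add: mv_def sum_distrib_left algebra_simps)

lemma mv_mult:
  assumes "A \<in> carrier_mat n n" "B \<in> carrier_mat n n" "i < n"
  shows "mv n (A * B) x i = mv n A (mv n B x) i"
proof -
  have "mv n (A * B) x i = (\<Sum>r<n. \<Sum>s<n. A $$ (i, s) * B $$ (s, r) * x r)"
    using assms by (auto simp: mv_def scalar_prod_def lessThan_atLeast0 sum_distrib_right intro!: sum.cong)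
  also have "\<dots> = mv n A (mv n B x) i"
    unfolding mv_def by (subst sum.swap) (simp add: sum_distrib_left mult.assoc)
  finally show ?thesis .
qed

lemma mv_pow_Suc:
  assumes "A \<in> carrier_mat n n" "i < n"
  shows "mv n (A ^\<^sub>m Suc k) x i = mv n (A ^\<^sub>m k) (mv n A x) i"
  using assms by (simp add: mv_mult)

lemma mv_pow_0:
  assumes "A \<in> carrier_mat n n" "i < n"
  shows "mv n (A ^\<^sub>m 0) x i = x i"
proof -
  have "mv n (A ^\<^sub>m 0) x i = (\<Sum>r<n. if r = i then x r else 0)"
    unfolding mv_def using assms by (intro sum.cong) auto
  then show ?thesis using assms by simp
qed

text \<open>The congruence premise makes \<open>P\<close> insensitive to indices from
  \<open>n\<close> on, because the power laws for \<open>mv\<close> hold only below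
  \<open>n\<close>.\<close>

lemma mv_pow_invariant:
  assumes A: "A \<in> carrier_mat n n" and i: "i < n"
    and "\<And>x. P x \<Longrightarrow> P (mv n A x)"
    and "\<And>x y. P x \<Longrightarrow> (\<And>i. i < n \<Longrightarrow> x i = y i) \<Longrightarrow> P y" and "P x"
  shows "P (mv n (A ^\<^sub>m k) x)"
  using assms(5)
proof (induction k arbitrary: x)
  case 0
  then show ?case
    by (rule assms(4)) (simp only: mv_pow_0[OF A])
next
  case (Suc k)
  show ?case
    by (rule assms(4)[OF Suc.IH[OF assms(3)[OF Suc.prems]]]) (use A in \<open>simp only: mv_pow_Suc\<close>)
qed

lemma mv_pow_fixed:
  assumes "A \<in> carrier_mat n n" "\<And>i. i < n \<Longrightarrow> mv n A x i = x i" "i < n"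
  shows "mv n (A ^\<^sub>m k) x i = x i"
  using assms(3)
proof (induction k arbitrary: i)
  case 0 then show ?case using assms by (simp only: mv_pow_0)
next
  case (Suc k)
  have "mv n (A ^\<^sub>m Suc k) x i = mv n (A ^\<^sub>m k) (mv n A x) i"
    using assms Suc.prems by (simp only: mv_pow_Suc)
  also have "\<dots> = mv n (A ^\<^sub>m k) x i"
    using assms by (intro mv_cong) simp
  finally show ?case using Suc by simp
qed

lemma mv_left_fixed:
  assumes "\<And>r. r < n \<Longrightarrow> (\<Sum>i<n. v i * A $$ (i, r)) = v r"
  shows "(\<Sum>i<n. v i * mv n A x i) = (\<Sum>i<n. v i * x i)"
proof -
  have "(\<Sum>i<n. v i * mv n A x i) = (\<Sum>r<n. \<Sum>i<n. v i * A $$ (i, r) * x r)"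
    unfolding mv_def sum_distrib_left by (subst sum.swap) (simp add: mult.assoc)
  also have "\<dots> = (\<Sum>i<n. v i * x i)"
    using assms by (auto simp flip: sum_distrib_right)
  finally show ?thesis .
qed

lemma mv_pow_left_fixed:
  assumes "A \<in> carrier_mat n n" "\<And>r. r < n \<Longrightarrow> (\<Sum>i<n. v i * A $$ (i, r)) = v r"
  shows "(\<Sum>i<n. v i * mv n (A ^\<^sub>m k) x i) = (\<Sum>i<n. v i * x i)"
proof (induction k arbitrary: x)
  case 0 then show ?case using assms by (auto simp only: mv_pow_0 lessThan_iff intro!: sum.cong)
next
  case (Suc k)
  have "(\<Sum>i<n. v i * mv n (A ^\<^sub>m Suc k) x i) = (\<Sum>i<n. v i * mv n (A ^\<^sub>m k) (mv n A x) i)"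
    using assms by (intro sum.cong) (auto simp only: mv_pow_Suc lessThan_iff)
  then show ?case using Suc mv_left_fixed[OF assms(2)] by simp
qed

subsection \<open>Powers of a primitive stochastic matrix\<close>

text \<open>The row sum \<open>s\<close> stays general: it is 1 for the stochastic matrix itself and
  \<open>1 - \<delta>\<close> for the remainder of its positive power.\<close>

lemma row_stochastic_sup_bound:
  assumes nonneg: "\<And>r. r < n \<Longrightarrow> 0 \<le> A $$ (i, r)" and sum: "(\<Sum>r<n. A $$ (i, r)) = s"
    and x: "\<And>r. r < n \<Longrightarrow> \<bar>x r\<bar> \<le> b"
  shows "\<bar>mv n A x i\<bar> \<le> s * b"
proof -
  have "\<bar>mv n A x i\<bar> \<le> (\<Sum>r<n. \<bar>A $$ (i, r) * x r\<bar>)"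
    unfolding mv_def by (rule sum_abs)
  also have "\<dots> \<le> (\<Sum>r<n. A $$ (i, r) * b)"
    using nonneg x by (intro sum_mono) (auto simp: abs_mult intro: mult_left_mono)
  also have "\<dots> = s * b"
    using sum by (simp flip: sum_distrib_right)
  finally show ?thesis .
qed

text \<open>The power with positive entries dominates a positive multiple of the rank-one limit.
  On vectors orthogonal to the Perron vector it therefore acts as a nonnegative matrix with
  row sums below 1.\<close>

lemma primitive_power_tendsto:
  assumes A: "A \<in> carrier_mat n n" and prim: "primitive_mat A"
    and row: "\<And>i. i < n \<Longrightarrow> (\<Sum>r<n. A $$ (i, r)) = 1"
    and left: "\<And>r. r < n \<Longrightarrow> (\<Sum>i<n. v i * A $$ (i, r)) = v r"
    and v: "\<And>i. i < n \<Longrightarrow> v i > 0" "(\<Sum>i<n. v i) = 1"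
    and i: "i < n" and r: "r < n"
  shows "(\<lambda>k. (A ^\<^sub>m k) $$ (i, r)) \<longlonglongrightarrow> v r"
proof -
  obtain k where k: "k \<ge> 1" and pos: "\<And>i r. i < n \<Longrightarrow> r < n \<Longrightarrow> (A ^\<^sub>m k) $$ (i, r) > 0"
    using prim A unfolding primitive_mat_def by auto
  have nonneg: "A $$ (i, r) \<ge> 0" if "i < n" "r < n" for i r
    using prim A that unfolding primitive_mat_def by auto
  have ones: "mv n A (\<lambda>_. 1) i = 1" if "i < n" for i
    using row[OF that] by (simp add: mv_def)
  have ones_pow: "mv n (A ^\<^sub>m k) (\<lambda>_. 1) i = 1" if "i < n" for i k
    using mv_pow_fixed[OF A, of "\<lambda>_. 1"] ones that by simp
  \<comment> \<open>The candidate 1/2 keeps \<open>\<delta>\<close> below 1 also for n = 1, where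
    the only entry is 1.\<close>
  define \<delta> where "\<delta> = Min (insert (1/2) ((\<lambda>(i, r). (A ^\<^sub>m k) $$ (i, r)) ` ({..<n} \<times> {..<n})))"
  have \<delta>: "\<delta> > 0" "\<delta> < 1" "\<And>i r. i < n \<Longrightarrow> r < n \<Longrightarrow> \<delta> \<le> (A ^\<^sub>m k) $$ (i, r)"
  proof -
    show "\<delta> > 0" using pos by (auto simp: \<delta>_def)
    have "\<delta> \<le> 1/2" unfolding \<delta>_def by (intro Min_le) auto
    then show "\<delta> < 1" by simp
    show "\<delta> \<le> (A ^\<^sub>m k) $$ (i, r)" if "i < n" "r < n" for i r
      unfolding \<delta>_def using that by (intro Min_le) force+
  qed
  have v1: "v r \<le> 1" if "r < n" for r
    using member_le_sum[of r "{..<n}" v] v that by (simp add: less_imp_le)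
  have contract: "\<bar>mv n (A ^\<^sub>m k) x i\<bar> \<le> (1 - \<delta>) * b"
    if x: "(\<Sum>i<n. v i * x i) = 0" "\<And>r. r < n \<Longrightarrow> \<bar>x r\<bar> \<le> b" and "i < n" for x b i
  proof -
    let ?Q = "Matrix.mat n n (\<lambda>(i, r). (A ^\<^sub>m k) $$ (i, r) - \<delta> * v r)"
    have "mv n ?Q x i = mv n (A ^\<^sub>m k) x i - \<delta> * (\<Sum>r<n. v r * x r)"
      using \<open>i < n\<close> by (simp add: mv_def left_diff_distrib sum_subtractf sum_distrib_left mult.assoc)
    then have "mv n (A ^\<^sub>m k) x i = mv n ?Q x i" using x by simp
    moreover have "\<bar>mv n ?Q x i\<bar> \<le> (1 - \<delta>) * b"
    proof (rule row_stochastic_sup_bound)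
      fix r assume "r < n"
      have "\<delta> * v r \<le> \<delta>" using v1[OF \<open>r < n\<close>] \<delta> by simp
      also have "\<dots> \<le> (A ^\<^sub>m k) $$ (i, r)" using \<delta> \<open>i < n\<close> \<open>r < n\<close> by simp
      finally show "0 \<le> ?Q $$ (i, r)" using \<open>i < n\<close> \<open>r < n\<close> by simp
    next
      show "(\<Sum>r<n. ?Q $$ (i, r)) = 1 - \<delta>"
        using \<open>i < n\<close> ones_pow[OF \<open>i < n\<close>, of k] v
        by (simp add: mv_def sum_subtractf flip: sum_distrib_left)
    qed (use x in auto)
    ultimately show ?thesis by simp
  qed
  have step: "\<bar>mv n A x i\<bar> \<le> b" if "\<And>r. r < n \<Longrightarrow> \<bar>x r\<bar> \<le> b" "i < n" for x b i
    using row_stochastic_sup_bound[of n A i 1 x b] nonneg row that by simp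
  have steps: "\<bar>mv n (A ^\<^sub>m l) x i\<bar> \<le> b" if "\<And>r. r < n \<Longrightarrow> \<bar>x r\<bar> \<le> b" "i < n" for x b i l
    using mv_pow_invariant[OF A \<open>i < n\<close>, of "\<lambda>x. \<forall>r<n. \<bar>x r\<bar> \<le> b" x l] step that by auto
  have add: "mv n (A ^\<^sub>m (l + j)) x i = mv n (A ^\<^sub>m j) (mv n (A ^\<^sub>m l) x) i" if "i < n" for x i l j
    using that
  proof (induction l arbitrary: x)
    case 0
    then show ?case using A by (auto simp only: mv_pow_0 add_0 intro!: mv_cong)
  next
    case (Suc l)
    have "mv n (A ^\<^sub>m (Suc l + j)) x i = mv n (A ^\<^sub>m j) (mv n (A ^\<^sub>m l) (mv n A x)) i"
      using Suc A by (simp only: mv_pow_Suc add_Suc)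
    also have "\<dots> = mv n (A ^\<^sub>m j) (mv n (A ^\<^sub>m Suc l) x) i"
      using A by (intro mv_cong) (simp only: mv_pow_Suc)
    finally show ?case .
  qed
  have multi: "\<bar>mv n (A ^\<^sub>m (q * k)) x i\<bar> \<le> (1 - \<delta>) ^ q * b"
    if "(\<Sum>i<n. v i * x i) = 0" "\<And>r. r < n \<Longrightarrow> \<bar>x r\<bar> \<le> b" and "i < n" for q x b i
    using that(3)
  proof (induction q arbitrary: i)
    case 0
    then show ?case using that A mv_pow_0[OF A] by simp
  next
    case (Suc q)
    have "mv n (A ^\<^sub>m (Suc q * k)) x i = mv n (A ^\<^sub>m k) (mv n (A ^\<^sub>m (q * k)) x) i"
      using add[OF Suc.prems, of "q * k" k] by (simp add: add.commute)
    also have "\<bar>\<dots>\<bar> \<le> (1 - \<delta>) * ((1 - \<delta>) ^ q * b)"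
      using Suc that mv_pow_left_fixed[OF A left] by (intro contract) auto
    finally show ?case by (simp add: mult.assoc)
  qed
  \<comment> \<open>The unit vector at \<open>r\<close> minus \<open>v r\<close> times the all-ones
    vector: it is orthogonal to \<open>v\<close>, and since the all-ones vector is fixed, powers of
    \<open>A\<close> map it to the differences whose limit is sought.\<close>
  define x where "x s = (if s = r then 1 else 0) - v r" for s
  have x0: "(\<Sum>i<n. v i * x i) = 0"
    using r v by (simp add: x_def right_diff_distrib sum_subtractf if_distrib[of "\<lambda>a. _ * a"] sum.delta
      flip: sum_distrib_right cong: if_cong)
  have x1: "\<bar>x s\<bar> \<le> 1" if "s < n" for s
    using v1[OF r] v(1)[OF r] by (simp add: x_def abs_le_iff)
  \<comment> \<open>The \<open>l div k\<close> full blocks contract, and the remaining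
    \<open>l mod k\<close> steps do not expand.\<close>
  have bound: "\<bar>(A ^\<^sub>m l) $$ (i, r) - v r\<bar> \<le> (1 - \<delta>) ^ (l div k)" for l
  proof -
    have "mv n (A ^\<^sub>m l) x i = (A ^\<^sub>m l) $$ (i, r) - v r"
    proof -
      have "mv n (A ^\<^sub>m l) x i
          = mv n (A ^\<^sub>m l) (\<lambda>s. if s = r then 1 else 0) i - v r * mv n (A ^\<^sub>m l) (\<lambda>_. 1) i"
        using mv_diff[of n "A ^\<^sub>m l" "\<lambda>s. if s = r then 1 else 0" "\<lambda>_. v r" i]
          mv_cmult[of n "A ^\<^sub>m l" "v r" "\<lambda>_. 1" i]
        by (simp add: x_def[abs_def])
      also have "mv n (A ^\<^sub>m l) (\<lambda>s. if s = r then 1 else 0) i = (A ^\<^sub>m l) $$ (i, r)"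
        using r by (simp add: mv_def if_distrib[of "\<lambda>a. _ * a"] sum.delta cong: if_cong)
      finally show ?thesis using ones_pow[OF i] by simp
    qed
    moreover have "mv n (A ^\<^sub>m l) x i
        = mv n (A ^\<^sub>m (l mod k)) (mv n (A ^\<^sub>m (l div k * k)) x) i"
      using add[OF i, of "l div k * k" "l mod k" x] by simp
    moreover have "\<bar>\<dots>\<bar> \<le> (1 - \<delta>) ^ (l div k) * 1"
      using multi[OF x0 x1] by (intro steps[OF _ i]) blast
    ultimately show ?thesis by simp
  qed
  have "filterlim (\<lambda>l. l div k) at_top sequentially"
    unfolding filterlim_at_top
  proof (intro allI)
    fix Z
    show "\<forall>\<^sub>F l in sequentially. Z \<le> l div k"
      using eventually_ge_at_top[of "Z * k"]
      by eventually_elim (use k in \<open>simp add: less_eq_div_iff_mult_less_eq\<close>)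
  qed
  then have "(\<lambda>l. (1 - \<delta>) ^ (l div k)) \<longlonglongrightarrow> 0"
    using \<delta> by (intro filterlim_compose[OF LIMSEQ_power_zero]) auto
  then have "(\<lambda>l. (A ^\<^sub>m l) $$ (i, r) - v r) \<longlonglongrightarrow> 0"
    by (rule Lim_null_comparison[rotated]) (auto simp: bound)
  then show ?thesis
    by (simp add: LIM_zero_iff)
qed

subsection \<open>Contraction in the weighted norms\<close>

lemma wsq_nonneg: "(\<And>i. i < n \<Longrightarrow> 0 \<le> u i) \<Longrightarrow> 0 \<le> wsq n u x"
  unfolding wsq_def by (intro sum_nonneg) auto

lemma wsq_cong: "(\<And>i. i < n \<Longrightarrow> x i = y i) \<Longrightarrow> wsq n u x = wsq n u y"
  by (simp add: wsq_def)

lemma wsq_cmult: "wsq n u (\<lambda>i. c * x i) = c\<^sup>2 * wsq n u x"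
  by (simp add: wsq_def power_mult_distrib sum_distrib_left algebra_simps)

text \<open>By homogeneity the supremum over the unit sphere controls every vector. \<open>N\<close>
  is known only through its weighted square, so one proof serves both weighted norms.\<close>

lemma induced_norm_bound:
  assumes X: "X \<in> carrier_mat n n"
    and N: "\<And>x. N (Matrix.vec n x) = sqrt (wsq n u x)"
    and u: "\<And>i. i < n \<Longrightarrow> u i > 0"
  shows "wsq n u (mv n X x) \<le> (induced_norm N X)\<^sup>2 * wsq n u x"
proof -
  let ?S = "{N (X *\<^sub>v x) |x. x \<in> carrier_vec (dim_col X) \<and> N x = 1}"
  have nn: "0 \<le> wsq n u y" for y
    using u by (intro wsq_nonneg) (simp add: less_imp_le)
  have zero: "y i = 0" if "wsq n u y = 0" "i < n" for y i
  proof -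
    have "\<forall>i\<in>{..<n}. u i * (y i)\<^sup>2 = 0"
      using that(1) u unfolding wsq_def
      by (subst (asm) sum_nonneg_eq_0_iff) (auto simp: less_imp_le)
    then have "u i * (y i)\<^sup>2 = 0" using that(2) by simp
    then show ?thesis using u[OF \<open>i < n\<close>] by simp
  qed
  \<comment> \<open>A real supremum bounds its set only if the set is bounded above. The crude bound
    \<open>?K\<close> uses that each weighted square is at most 1 on the unit sphere.\<close>
  have bdd: "bdd_above ?S"
  proof (rule bdd_aboveI)
    let ?K = "sqrt (\<Sum>i<n. u i * (\<Sum>r<n. \<bar>X $$ (i, r)\<bar> * (1 / sqrt (u r)))\<^sup>2)"
    fix z assume "z \<in> ?S"
    then obtain w where w: "w \<in> carrier_vec n" "N w = 1" "z = N (X *\<^sub>v w)"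
      using X by auto
    define y where "y i = w $ i" for i
    have wy: "w = Matrix.vec n y"
      using w by (intro eq_vecI) (auto simp: y_def)
    have y1: "wsq n u y = 1"
      using w(2) by (simp add: wy N)
    have yb: "\<bar>y r\<bar> \<le> 1 / sqrt (u r)" if "r < n" for r
    proof -
      have "u r * (y r)\<^sup>2 \<le> wsq n u y"
        unfolding wsq_def using that u by (intro member_le_sum) (auto simp: less_imp_le)
      then have "(y r)\<^sup>2 \<le> 1 / u r"
        using u[OF that] y1 by (simp add: field_simps)
      then have "sqrt ((y r)\<^sup>2) \<le> sqrt (1 / u r)"
        by (rule real_sqrt_le_mono)
      then show ?thesis by (simp add: real_sqrt_divide)
    qed
    have "wsq n u (mv n X y) \<le> (\<Sum>i<n. u i * (\<Sum>r<n. \<bar>X $$ (i, r)\<bar> * (1 / sqrt (u r)))\<^sup>2)"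
      unfolding wsq_def
    proof (intro sum_mono mult_left_mono)
      fix i assume i: "i \<in> {..<n}"
      have "\<bar>mv n X y i\<bar> \<le> (\<Sum>r<n. \<bar>X $$ (i, r) * y r\<bar>)"
        unfolding mv_def by (rule sum_abs)
      also have "\<dots> \<le> (\<Sum>r<n. \<bar>X $$ (i, r)\<bar> * (1 / sqrt (u r)))"
        unfolding abs_mult using yb by (intro sum_mono mult_left_mono) auto
      finally show "(mv n X y i)\<^sup>2 \<le> (\<Sum>r<n. \<bar>X $$ (i, r)\<bar> * (1 / sqrt (u r)))\<^sup>2"
        by (metis abs_ge_zero power2_abs power_mono)
    qed (use u in \<open>auto simp: less_imp_le\<close>)
    then show "z \<le> ?K"
      using w(3) X by (simp add: wy mult_mat_vec_mv N)
  qed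
  show ?thesis
  proof (cases "wsq n u x = 0")
    \<comment> \<open>Such a vector cannot be normalised, but it vanishes below \<open>n\<close> and
      so does its image.\<close>
    case True
    then have "mv n X x i = 0" for i
      using zero[OF True] by (simp add: mv_def)
    then show ?thesis using True by (simp add: wsq_def)
  next
    case False
    define s where "s = sqrt (wsq n u x)"
    have s: "s > 0" "s\<^sup>2 = wsq n u x"
      using False nn[of x] by (auto simp: s_def)
    have "wsq n u (\<lambda>i. 1 / s * x i) = 1"
      unfolding wsq_cmult using s False by (simp add: power_divide)
    then have "N (X *\<^sub>v Matrix.vec n (\<lambda>i. 1 / s * x i)) \<in> ?S"
      using X by (auto intro!: exI[of _ "Matrix.vec n (\<lambda>i. 1 / s * x i)"] simp: N)
    then have Nle: "N (X *\<^sub>v Matrix.vec n (\<lambda>i. 1 / s * x i)) \<le> induced_norm N X"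
      unfolding induced_norm_def using bdd by (rule cSup_upper)
    have "sqrt (wsq n u (\<lambda>i. 1 / s * mv n X x i)) \<le> induced_norm N X"
    proof -
      have "mv n X (\<lambda>i. 1 / s * x i) = (\<lambda>i. 1 / s * mv n X x i)"
        by (intro ext mv_cmult)
      then show ?thesis using Nle X by (simp only: mult_mat_vec_mv N)
    qed
    then have "(sqrt (wsq n u (\<lambda>i. 1 / s * mv n X x i)))\<^sup>2 \<le> (induced_norm N X)\<^sup>2"
      using nn by (intro power_mono) auto
    then have "(1 / s)\<^sup>2 * wsq n u (mv n X x) \<le> (induced_norm N X)\<^sup>2"
      using real_sqrt_pow2[OF nn[of "\<lambda>i. 1 / s * mv n X x i"]] by (simp only: wsq_cmult)
    then show ?thesis
      using s False nn[of x] by (simp add: power_divide pos_divide_le_eq mult.commute less_le)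
  qed
qed

text \<open>The one-step bound is assumed only on the vectors annihilated by \<open>v\<close>, where
  a weight matrix and its difference from its limit act alike. This subspace is invariant, so the
  bound iterates.\<close>

lemma pow_contraction:
  assumes A: "A \<in> carrier_mat n n" and s: "0 \<le> s"
    and one: "\<And>x. (\<Sum>i<n. v i * x i) = 0 \<Longrightarrow> wsq n u (mv n A x) \<le> s\<^sup>2 * wsq n u x"
    and left: "\<And>r. r < n \<Longrightarrow> (\<Sum>i<n. v i * A $$ (i, r)) = v r"
    and x: "(\<Sum>i<n. v i * x i) = 0"
  shows "wsq n u (mv n (A ^\<^sub>m k) x) \<le> s ^ (2 * k) * wsq n u x"
  using x
proof (induction k arbitrary: x)
  case 0
  then show ?case using mv_pow_0[OF A] by (simp add: wsq_def)
next
  case (Suc k)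
  have "wsq n u (mv n (A ^\<^sub>m Suc k) x) = wsq n u (mv n (A ^\<^sub>m k) (mv n A x))"
    using A by (intro wsq_cong) (simp only: mv_pow_Suc)
  also have "\<dots> \<le> s ^ (2 * k) * wsq n u (mv n A x)"
    using Suc mv_left_fixed[OF left] by simp
  also have "\<dots> \<le> s ^ (2 * k) * (s\<^sup>2 * wsq n u x)"
    using one[OF Suc.prems] s by (intro mult_left_mono) auto
  also have "\<dots> = s ^ (2 * Suc k) * wsq n u x"
    by (simp add: power2_eq_square algebra_simps)
  finally show ?case .
qed

lemma transpose_pow:
  assumes A: "(A :: real mat) \<in> carrier_mat n n"
  shows "transpose_mat (A ^\<^sub>m k) = transpose_mat A ^\<^sub>m k"
proof (induction k)
  case 0 then show ?case using A by simp
next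
  case (Suc k)
  \<comment> \<open>Powers are built by multiplying on the right, while transposition reverses the
    order.\<close>
  have comm: "X * X ^\<^sub>m k = X ^\<^sub>m k * X" if X: "X \<in> carrier_mat n n" for X :: "real mat"
  proof (induction k)
    case 0 then show ?case using X by simp
  next
    case (Suc k)
    have "X * X ^\<^sub>m Suc k = (X * X ^\<^sub>m k) * X"
      using X by (simp add: assoc_mult_mat[of _ n n _ n _ n])
    then show ?case using Suc by simp
  qed
  have "transpose_mat (A ^\<^sub>m Suc k) = transpose_mat A * transpose_mat (A ^\<^sub>m k)"
    using A by (simp add: transpose_mult[of _ n n _ n])
  also have "\<dots> = transpose_mat A ^\<^sub>m Suc k"
    using Suc comm[of "transpose_mat A"] A by simp
  finally show ?case .
qed

text \<open>Lets the limit theorem for row stochastic matrices serve \<open>B\<close> through its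
  transpose.\<close>

lemma primitive_transpose:
  assumes A: "A \<in> carrier_mat n n" and prim: "primitive_mat A"
  shows "primitive_mat (transpose_mat A)"
proof -
  obtain k where k: "k \<ge> 1" "\<And>i r. i < n \<Longrightarrow> r < n \<Longrightarrow> (A ^\<^sub>m k) $$ (i, r) > 0"
    using prim A unfolding primitive_mat_def by auto
  have "(transpose_mat A ^\<^sub>m k) $$ (i, r) > 0" if "i < n" "r < n" for i r
    using k(2) that A by (simp flip: transpose_pow)
  then show ?thesis
    using prim A k(1) unfolding primitive_mat_def by auto
qed

section \<open>Perron limits of the weight matrices and their contraction factors\<close>

context directed_network
begin

lemma pr_carrier: "pr \<in> carrier_vec n" and pc_carrier: "pc \<in> carrier_vec n"
  using pr_eigen pc_eigen A_dim B_dim by (auto simp: eigenvector_def)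

lemma A_row_sum: "i < n \<Longrightarrow> (\<Sum>r<n. A $$ (i, r)) = 1"
  using arg_cong[OF A_row_stochastic, of "\<lambda>v. v $ i"] A_dim
  by (auto simp: scalar_prod_def lessThan_atLeast0)

lemma B_col_sum: "r < n \<Longrightarrow> (\<Sum>i<n. B $$ (i, r)) = 1"
  using arg_cong[OF B_col_stochastic, of "\<lambda>v. v $ r"] B_dim
  by (auto simp: scalar_prod_def lessThan_atLeast0)

lemma pr_left: "r < n \<Longrightarrow> (\<Sum>i<n. pr $ i * A $$ (i, r)) = pr $ r"
proof -
  assume r: "r < n"
  have "(transpose_mat A *\<^sub>v pr) $ r = (1 \<cdot>\<^sub>v pr) $ r"
    using pr_eigen by (simp add: eigenvector_def)
  then show ?thesis
    using r A_dim pr_carrier by (auto simp: scalar_prod_def lessThan_atLeast0 mult.commute)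
qed

lemma pc_right: "i < n \<Longrightarrow> mv n B (\<lambda>r. pc $ r) i = pc $ i"
proof -
  assume i: "i < n"
  have "(B *\<^sub>v pc) $ i = (1 \<cdot>\<^sub>v pc) $ i"
    using pc_eigen by (simp add: eigenvector_def)
  then show ?thesis
    using i B_dim pc_carrier by (auto simp: mv_def scalar_prod_def lessThan_atLeast0)
qed

text \<open>With the limit explicit, subtracting it does not change the action on vectors of zero
  \<open>pr\<close>-mean; for \<open>B\<close> the corresponding vectors are those of zero
  sum.\<close>

lemma mat_lim_A: "mat_lim A = Matrix.mat n n (\<lambda>(i, r). pr $ r)"
  using A_dim primitive_power_tendsto[OF A_dim A_prim A_row_sum pr_left pr_pos pr_sum]
  by (auto simp: mat_lim_def intro!: eq_matI limI)

lemma mat_lim_B: "mat_lim B = Matrix.mat n n (\<lambda>(i, r). pc $ i)"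
proof -
  have "(\<lambda>k. (B ^\<^sub>m k) $$ (i, r)) \<longlonglongrightarrow> pc $ i" if "i < n" "r < n" for i r
  proof -
    have Bt: "transpose_mat B \<in> carrier_mat n n" using B_dim by simp
    have "(\<lambda>k. (transpose_mat B ^\<^sub>m k) $$ (r, i)) \<longlonglongrightarrow> pc $ i"
      using that B_dim B_col_sum pc_right pc_pos pc_sum
      by (intro primitive_power_tendsto[OF Bt primitive_transpose[OF B_dim B_prim]])
         (auto simp: mv_def mult.commute)
    also have "(\<lambda>k. (transpose_mat B ^\<^sub>m k) $$ (r, i)) = (\<lambda>k. (B ^\<^sub>m k) $$ (i, r))"
      using that B_dim by (simp flip: transpose_pow)
    finally show ?thesis .
  qed
  then show ?thesis
    using B_dim by (auto simp: mat_lim_def intro!: eq_matI limI)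
qed

lemma norm_r_vec: "norm_r pr (Matrix.vec n x) = sqrt (wsq n (($) pr) x)"
proof -
  have *: "mat_diag n (\<lambda>i. sqrt (pr $ i)) *\<^sub>v Matrix.vec n x = Matrix.vec n (\<lambda>i. sqrt (pr $ i) * x i)"
    by (intro eq_vecI) (auto simp: mat_diag_def scalar_prod_def if_distrib[of "\<lambda>a. a * _"] sum.delta cong: if_cong)
  have "sqrt (pr $ i) * x i * (sqrt (pr $ i) * x i) = pr $ i * (x i)\<^sup>2" if "i < n" for i
    using pr_pos[OF that] by (simp add: power2_eq_square mult_ac flip: mult.assoc[of "sqrt _"])
  then show ?thesis
    using pr_carrier
    by (simp add: norm_r_def vnorm_def wsq_def scalar_prod_def lessThan_atLeast0 * )
qed

lemma norm_c_vec: "norm_c pc (Matrix.vec n x) = sqrt (wsq n (\<lambda>i. 1 / pc $ i) x)"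
proof -
  have *: "mat_diag n (\<lambda>i. inverse (sqrt (pc $ i))) *\<^sub>v Matrix.vec n x
      = Matrix.vec n (\<lambda>i. inverse (sqrt (pc $ i)) * x i)"
    by (intro eq_vecI) (auto simp: mat_diag_def scalar_prod_def if_distrib[of "\<lambda>a. a * _"] sum.delta cong: if_cong)
  have "inverse (sqrt (pc $ i)) * inverse (sqrt (pc $ i)) = 1 / pc $ i" if "i < n" for i
    using pc_pos[OF that] by (simp add: field_simps flip: real_sqrt_mult)
  then have "inverse (sqrt (pc $ i)) * x i * (inverse (sqrt (pc $ i)) * x i) = 1 / pc $ i * (x i)\<^sup>2"
    if "i < n" for i
    using that by (simp add: power2_eq_square mult_ac)
  then show ?thesis
    using pc_carrier
    by (simp add: norm_c_def vnorm_def wsq_def scalar_prod_def lessThan_atLeast0 * )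
qed

lemma A_pow_contraction:
  assumes "(\<Sum>i<n. pr $ i * x i) = 0"
  shows "wsq n (($) pr) (mv n (A ^\<^sub>m k) x) \<le> sigma_A A pr ^ (2 * k) * wsq n (($) pr) x"
proof (rule pow_contraction[OF A_dim _ _ pr_left])
  fix x assume x: "(\<Sum>i<n. pr $ i * x i) = 0"
  have X: "A - mat_lim A \<in> carrier_mat n n"
    unfolding mat_lim_A by (intro minus_carrier_mat) simp
  have "mv n (A - mat_lim A) x i = mv n A x i" if "i < n" for i
    using x that A_dim by (simp add: mv_def mat_lim_A left_diff_distrib sum_subtractf)
  then have "wsq n (($) pr) (mv n A x) = wsq n (($) pr) (mv n (A - mat_lim A) x)"
    by (intro wsq_cong) simp
  also have "\<dots> \<le> (sigma_A A pr)\<^sup>2 * wsq n (($) pr) x"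
    unfolding sigma_A_def by (rule induced_norm_bound[OF X norm_r_vec pr_pos])
  finally show "wsq n (($) pr) (mv n A x) \<le> (sigma_A A pr)\<^sup>2 * wsq n (($) pr) x" .
qed (use sigma_A assms in auto)

lemma B_pow_contraction:
  assumes "(\<Sum>i<n. x i) = 0"
  shows "wsq n (\<lambda>i. 1 / pc $ i) (mv n (B ^\<^sub>m k) x)
    \<le> sigma_B B pc ^ (2 * k) * wsq n (\<lambda>i. 1 / pc $ i) x"
proof (rule pow_contraction[OF B_dim, where v = "\<lambda>_. 1"])
  fix x :: "nat \<Rightarrow> real" assume x: "(\<Sum>i<n. 1 * x i) = 0"
  have X: "B - mat_lim B \<in> carrier_mat n n"
    unfolding mat_lim_B by (intro minus_carrier_mat) simp
  have "mv n (B - mat_lim B) x i = mv n B x i" if "i < n" for i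
    using x that B_dim by (simp add: mv_def mat_lim_B left_diff_distrib sum_subtractf flip: sum_distrib_left)
  then have "wsq n (\<lambda>i. 1 / pc $ i) (mv n B x) = wsq n (\<lambda>i. 1 / pc $ i) (mv n (B - mat_lim B) x)"
    by (intro wsq_cong) simp
  also have "\<dots> \<le> (sigma_B B pc)\<^sup>2 * wsq n (\<lambda>i. 1 / pc $ i) x"
    unfolding sigma_B_def by (rule induced_norm_bound[OF X norm_c_vec]) (use pc_pos in auto)
  finally show "wsq n (\<lambda>i. 1 / pc $ i) (mv n B x) \<le> (sigma_B B pc)\<^sup>2 * wsq n (\<lambda>i. 1 / pc $ i) x" .
qed (use sigma_B assms B_col_sum in auto)

end

subsection \<open>Quadratic estimates\<close>

lemma square_add_le: "((a::real) + b)\<^sup>2 \<le> 2 * a\<^sup>2 + 2 * b\<^sup>2"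
  using zero_le_power2[of "a - b"] by (simp add: power2_eq_square algebra_simps)

lemma square_diff_le: "((a::real) - b)\<^sup>2 \<le> 2 * a\<^sup>2 + 2 * b\<^sup>2"
  using square_add_le[of a "- b"] by simp

lemma young_square_diff:
  fixes a b t :: real
  assumes "t > 0"
  shows "(a - b)\<^sup>2 \<le> (1 + t) * a\<^sup>2 + (1 + 1 / t) * b\<^sup>2"
proof -
  have "0 \<le> (t * a + b)\<^sup>2 / t" using assms by simp
  also have "\<dots> = (1 + t) * a\<^sup>2 + (1 + 1 / t) * b\<^sup>2 - (a - b)\<^sup>2"
    using assms by (simp add: field_simps power2_eq_square)
  finally show ?thesis by simp
qed

lemma square_sum_le: "(\<Sum>i<n. x i)\<^sup>2 \<le> real n * (\<Sum>i<n. (x i :: real)\<^sup>2)"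
  using Cauchy_Schwarz_ineq_sum[of "\<lambda>_. 1 :: real" x "{..<n}"] by simp

lemma sqn_diff_le: "sqn p (\<lambda>q. x q - y q) \<le> 2 * sqn p (\<lambda>q. x q - z q) + 2 * sqn p (\<lambda>q. y q - z q)"
proof -
  have "(x q - y q)\<^sup>2 \<le> 2 * (x q - z q)\<^sup>2 + 2 * (y q - z q)\<^sup>2" for q
    using square_diff_le[of "x q - z q" "y q - z q"] by simp
  then show ?thesis
    unfolding sqn_def sum_distrib_left sum.distrib[symmetric] by (intro sum_mono) auto
qed

lemma sqn_triangle: "sqn p (\<lambda>q. x q - y q) \<le> 2 * sqn p (\<lambda>q. x q - z q) + 2 * sqn p (\<lambda>q. z q - y q)"
  using sqn_diff_le[of p x y z] by (simp add: sqn_def power2_commute)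

lemma wsq_add_le:
  assumes "\<And>i. i < n \<Longrightarrow> 0 \<le> u i"
  shows "wsq n u (\<lambda>i. x i + y i) \<le> 2 * wsq n u x + 2 * wsq n u y"
proof -
  have "u i * (x i + y i)\<^sup>2 \<le> 2 * (u i * (x i)\<^sup>2) + 2 * (u i * (y i)\<^sup>2)" if "i < n" for i
    using mult_left_mono[OF square_add_le[of "x i" "y i"] assms[OF that]] by (simp add: algebra_simps)
  then show ?thesis
    unfolding wsq_def sum_distrib_left sum.distrib[symmetric] by (intro sum_mono) auto
qed

lemma wsq_diff_le:
  assumes "\<And>i. i < n \<Longrightarrow> 0 \<le> u i"
  shows "wsq n u (\<lambda>i. x i - y i) \<le> 2 * wsq n u x + 2 * wsq n u y"
  using wsq_add_le[of n u x "\<lambda>i. - y i"] assms by (simp add: wsq_def)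

lemma sum_square_le_wsq:
  assumes "\<And>i. i < n \<Longrightarrow> u i > 0" "\<And>i. i < n \<Longrightarrow> 1 / u i \<le> K"
  shows "(\<Sum>i<n. (x i)\<^sup>2) \<le> K * wsq n u x"
  unfolding wsq_def sum_distrib_left
proof (intro sum_mono)
  fix i assume i: "i \<in> {..<n}"
  have "1 \<le> K * u i" using assms[of i] i by (simp add: field_simps)
  then show "(x i)\<^sup>2 \<le> K * (u i * (x i)\<^sup>2)"
    using mult_right_mono[of 1 "K * u i" "(x i)\<^sup>2"] by (simp add: mult.assoc)
qed

subsection \<open>Entries of a positive probability vector\<close>

context
  fixes v :: "real vec" and n :: nat
  assumes v: "v \<in> carrier_vec n" and v_pos: "\<And>i. i < n \<Longrightarrow> v $ i > 0" and v_sum: "(\<Sum>i<n. v $ i) = 1"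
begin

lemma Max_Min_entries:
  shows "Min (set\<^sub>v v) > 0" "\<And>i. i < n \<Longrightarrow> Min (set\<^sub>v v) \<le> v $ i" "\<And>i. i < n \<Longrightarrow> v $ i \<le> Max (set\<^sub>v v)"
    "1 \<le> real n * Max (set\<^sub>v v)" "real n * Min (set\<^sub>v v) \<le> 1"
proof -
  have s: "set\<^sub>v v = ($) v ` {..<n}" using v by (auto simp: vec_set_def)
  have n: "n \<noteq> 0" using v_sum by (cases n) auto
  show "Min (set\<^sub>v v) > 0" unfolding s using v_pos n by (subst Min_gr_iff) auto
  show le: "Min (set\<^sub>v v) \<le> v $ i" "v $ i \<le> Max (set\<^sub>v v)" if "i < n" for i
    unfolding s using that by (auto intro!: Min_le Max_ge)
  show "1 \<le> real n * Max (set\<^sub>v v)"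
    using sum_bounded_above[of "{..<n}" "($) v" "Max (set\<^sub>v v)"] le v_sum by simp
  show "real n * Min (set\<^sub>v v) \<le> 1"
    using sum_bounded_below[of "{..<n}" "Min (set\<^sub>v v)" "($) v"] le v_sum by simp
qed

lemma entry_ratio_ge_1: "1 \<le> entry_ratio v"
proof -
  have "0 < n" using v_sum by (cases n) auto
  then have "Min (set\<^sub>v v) \<le> Max (set\<^sub>v v)"
    using Max_Min_entries(2,3)[of 0] by linarith
  then show ?thesis using Max_Min_entries(1) by (simp add: entry_ratio_def)
qed

text \<open>The largest entry of a probability vector is at least 1/n. This is the price for passing
  from the \<open>pr\<close>-weighted norm, or between the nodes of the \<open>pc\<close>-weighted
  one, to plain sums of squares.\<close>

lemma inverse_entry_le: "i < n \<Longrightarrow> 1 / v $ i \<le> real n * entry_ratio v"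
proof -
  assume i: "i < n"
  have "1 / v $ i \<le> 1 / Min (set\<^sub>v v)"
    using Max_Min_entries(1) Max_Min_entries(2)[OF i] by (intro divide_left_mono) auto
  also have "\<dots> \<le> real n * Max (set\<^sub>v v) / Min (set\<^sub>v v)"
    using Max_Min_entries(1,4) by (intro divide_right_mono) auto
  finally show ?thesis by (simp add: entry_ratio_def)
qed

text \<open>The sum of squares is at most the largest entry, because the entries sum to 1, and
  \<open>n\<close> is at most the inverse of the smallest entry.\<close>

lemma sum_square_entries_le: "real n * (\<Sum>i<n. (v $ i)\<^sup>2) \<le> entry_ratio v"
proof -
  have "(\<Sum>i<n. (v $ i)\<^sup>2) \<le> (\<Sum>i<n. Max (set\<^sub>v v) * v $ i)"
    unfolding power2_eq_square using Max_Min_entries(3) v_pos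
    by (intro sum_mono mult_right_mono) (auto simp: less_imp_le)
  also have "\<dots> = Max (set\<^sub>v v)" using v_sum by (simp flip: sum_distrib_left)
  finally have "real n * (\<Sum>i<n. (v $ i)\<^sup>2) \<le> real n * Max (set\<^sub>v v)"
    by (intro mult_left_mono) auto
  also have "\<dots> \<le> entry_ratio v"
  proof -
    have "0 \<le> Max (set\<^sub>v v)"
      using Max_Min_entries(4) by (smt (verit) mult_nonneg_nonpos of_nat_0_le_iff)
    then have "(real n * Min (set\<^sub>v v)) * Max (set\<^sub>v v) \<le> 1 * Max (set\<^sub>v v)"
      using Max_Min_entries(5) by (intro mult_right_mono) auto
    then show ?thesis
      using Max_Min_entries(1) by (simp add: entry_ratio_def pos_le_divide_eq mult_ac)
  qed
  finally show ?thesis .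
qed

end

section \<open>Consensus and gradient tracking in one coordinate\<close>

context directed_network
begin

lemma pr_pc: "pr \<bullet> pc = (\<Sum>i<n. pr $ i * pc $ i)"
  using pc_carrier by (rule scalar_prod_coord)

lemma pr_le_1: "i < n \<Longrightarrow> pr $ i \<le> 1" and pc_le_1: "i < n \<Longrightarrow> pc $ i \<le> 1"
  using member_le_sum[of i "{..<n}" "($) pr"] member_le_sum[of i "{..<n}" "($) pc"]
    pr_pos pc_pos pr_sum pc_sum by (auto simp: less_imp_le)

lemma n_positive: "0 < n"
  using pr_sum by (cases n) auto

lemma pr_pc_pos: "0 < pr \<bullet> pc"
  unfolding pr_pc using pr_pos pc_pos n_positive by (intro sum_pos) auto

lemma pr_pc_le_1: "pr \<bullet> pc \<le> 1"
proof -
  have "pr \<bullet> pc \<le> (\<Sum>i<n. pr $ i * 1)"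
    unfolding pr_pc using pr_pos pc_le_1 by (intro sum_mono mult_left_mono) (auto simp: less_imp_le)
  then show ?thesis using pr_sum by simp
qed

lemma ratios_ge_1: "1 \<le> entry_ratio pr" "1 \<le> entry_ratio pc"
  using entry_ratio_ge_1[OF pr_carrier pr_pos pr_sum] entry_ratio_ge_1[OF pc_carrier pc_pos pc_sum] by auto

text \<open>Cauchy-Schwarz separates the two Perron vectors, and \<open>n\<close> times the sum of
  squares of each is at most its entry ratio.\<close>

lemma psi_ge_1: "1 \<le> psi n pr pc"
proof -
  have "(real n * (pr \<bullet> pc))\<^sup>2 \<le> (real n)\<^sup>2 * ((\<Sum>i<n. (pr $ i)\<^sup>2) * (\<Sum>i<n. (pc $ i)\<^sup>2))"
    unfolding pr_pc power_mult_distrib by (intro mult_left_mono Cauchy_Schwarz_ineq_sum) auto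
  also have "\<dots> = (real n * (\<Sum>i<n. (pr $ i)\<^sup>2)) * (real n * (\<Sum>i<n. (pc $ i)\<^sup>2))"
    by (simp add: power2_eq_square)
  also have "\<dots> \<le> entry_ratio pr * entry_ratio pc"
    using sum_square_entries_le[OF pr_carrier pr_pos pr_sum] sum_square_entries_le[OF pc_carrier pc_pos pc_sum]
      ratios_ge_1 by (intro mult_mono) (auto intro!: mult_nonneg_nonneg sum_nonneg)
  finally have "real n * (pr \<bullet> pc) \<le> sqrt (entry_ratio pr * entry_ratio pc)"
    by (rule real_le_rsqrt)
  then show ?thesis
    using pr_pc_pos n_positive by (simp add: psi_def)
qed

lemma weighted_mean_deviation_le:
  "wsq n (($) pr) (\<lambda>i. x i - (\<Sum>r<n. pr $ r * x r)) \<le> wsq n (($) pr) x"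
proof -
  let ?a = "\<Sum>r<n. pr $ r * x r"
  have "wsq n (($) pr) (\<lambda>i. x i - ?a)
      = (\<Sum>i<n. pr $ i * (x i)\<^sup>2) - 2 * ?a * (\<Sum>i<n. pr $ i * x i) + ?a\<^sup>2 * (\<Sum>i<n. pr $ i)"
    unfolding wsq_def sum_distrib_left[of "2 * ?a"] sum_distrib_left[of "?a\<^sup>2"]
      sum_subtractf[symmetric] sum.distrib[symmetric]
    by (intro sum.cong refl) (simp add: power2_eq_square algebra_simps)
  also have "\<dots> = wsq n (($) pr) x - ?a\<^sup>2"
    using pr_sum by (simp add: wsq_def power2_eq_square)
  finally show ?thesis by simp
qed

text \<open>In the inner product weighted by \<open>1 / pc\<close>, the vector \<open>pc\<close> has
  norm 1 and is orthogonal to the vectors of zero sum, so this is an orthogonal projection.\<close>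

lemma weighted_sum_deviation_le:
  "wsq n (\<lambda>i. 1 / pc $ i) (\<lambda>i. h i - pc $ i * (\<Sum>r<n. h r)) \<le> wsq n (\<lambda>i. 1 / pc $ i) h"
proof -
  let ?a = "\<Sum>r<n. h r"
  have "wsq n (\<lambda>i. 1 / pc $ i) (\<lambda>i. h i - pc $ i * ?a)
      = (\<Sum>i<n. 1 / pc $ i * (h i)\<^sup>2) - 2 * ?a * (\<Sum>i<n. h i) + ?a\<^sup>2 * (\<Sum>i<n. pc $ i)"
    unfolding wsq_def sum_distrib_left[of "2 * ?a"] sum_distrib_left[of "?a\<^sup>2"]
      sum_subtractf[symmetric] sum.distrib[symmetric]
  proof (intro sum.cong refl)
    fix i assume "i \<in> {..<n}"
    then have "pc $ i > 0" using pc_pos by simp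
    then show "1 / pc $ i * (h i - pc $ i * ?a)\<^sup>2 = 1 / pc $ i * (h i)\<^sup>2 - 2 * ?a * h i + ?a\<^sup>2 * pc $ i"
      by (simp add: power2_eq_square field_simps)
  qed
  also have "\<dots> = wsq n (\<lambda>i. 1 / pc $ i) h - ?a\<^sup>2"
    using pc_sum by (simp add: wsq_def power2_eq_square)
  finally show ?thesis by simp
qed

lemma sum_mv_B_pow: "(\<Sum>i<n. mv n (B ^\<^sub>m d) x i) = (\<Sum>i<n. x i)"
  using mv_pow_left_fixed[OF B_dim, of "\<lambda>_. 1"] B_col_sum by simp

lemma sum_mv_A_pow: "(\<Sum>i<n. pr $ i * mv n (A ^\<^sub>m c) x i) = (\<Sum>i<n. pr $ i * x i)"
  using mv_pow_left_fixed[OF A_dim, of "($) pr"] pr_left by simp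

text \<open>\<open>B ^\<^sub>m d\<close> fixes \<open>pc\<close> and preserves sums. The new error
  is therefore its action on the old error plus the zero-sum part of \<open>g' - g\<close>. The
  reference \<open>z\<close> is free; through it the change of the estimate is split into two
  deviations.\<close>

lemma tracking_step:
  assumes sums: "(\<Sum>i<n. w i) = (\<Sum>i<n. g i)"
  shows "wsq n (\<lambda>i. 1 / pc $ i) (\<lambda>i. mv n (B ^\<^sub>m d) (\<lambda>r. w r + g' r - g r) i - pc $ i * (\<Sum>r<n. g' r))
    \<le> sigma_B B pc ^ (2 * d) * (2 * wsq n (\<lambda>i. 1 / pc $ i) (\<lambda>i. w i - pc $ i * (\<Sum>r<n. g r))
        + 4 * (real n * entry_ratio pc) * ((\<Sum>i<n. (g' i - z i)\<^sup>2) + (\<Sum>i<n. (g i - z i)\<^sup>2)))"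
proof -
  let ?u = "\<lambda>i. 1 / pc $ i" and ?s = "\<Sum>r<n. g r" and ?s' = "\<Sum>r<n. g' r"
  define h where "h i = g' i - g i" for i
  define y where "y i = (w i - pc $ i * ?s) + (h i - pc $ i * (\<Sum>r<n. h r))" for i
  have hs: "(\<Sum>r<n. h r) = ?s' - ?s" by (simp add: h_def sum_subtractf)
  have y: "y i = w i + g' i - g i - ?s' * pc $ i" for i
    unfolding y_def hs by (simp add: h_def algebra_simps)
  have u: "0 \<le> ?u i" if "i < n" for i using pc_pos[OF that] by simp
  have "mv n (B ^\<^sub>m d) y i = mv n (B ^\<^sub>m d) (\<lambda>r. w r + g' r - g r) i - pc $ i * ?s'" if "i < n" for i
    unfolding y[abs_def] mv_diff mv_cmult using mv_pow_fixed[OF B_dim pc_right that] by simp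
  then have "wsq n ?u (\<lambda>i. mv n (B ^\<^sub>m d) (\<lambda>r. w r + g' r - g r) i - pc $ i * ?s')
      = wsq n ?u (mv n (B ^\<^sub>m d) y)"
    by (intro wsq_cong) simp
  also have "\<dots> \<le> sigma_B B pc ^ (2 * d) * wsq n ?u y"
  proof (rule B_pow_contraction)
    show "(\<Sum>i<n. y i) = 0"
      using sums pc_sum by (simp add: y_def sum.distrib sum_subtractf flip: sum_distrib_right)
  qed
  also have "wsq n ?u y \<le> 2 * wsq n ?u (\<lambda>i. w i - pc $ i * ?s) + 2 * wsq n ?u (\<lambda>i. h i - pc $ i * (\<Sum>r<n. h r))"
    unfolding y_def[abs_def] using u by (rule wsq_add_le)
  also have "wsq n ?u (\<lambda>i. h i - pc $ i * (\<Sum>r<n. h r)) \<le> wsq n ?u h"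
    by (rule weighted_sum_deviation_le)
  also have "wsq n ?u h \<le> real n * entry_ratio pc * (2 * (\<Sum>i<n. (g' i - z i)\<^sup>2) + 2 * (\<Sum>i<n. (g i - z i)\<^sup>2))"
    unfolding wsq_def sum_distrib_left sum.distrib[symmetric]
  proof (intro sum_mono)
    fix i assume i: "i \<in> {..<n}"
    show "?u i * (h i)\<^sup>2 \<le> (real n * entry_ratio pc) * (2 * (g' i - z i)\<^sup>2 + 2 * (g i - z i)\<^sup>2)"
      using inverse_entry_le[OF pc_carrier pc_pos pc_sum, of i] i ratios_ge_1
        square_diff_le[of "g' i - z i" "g i - z i"]
      by (intro mult_mono) (auto simp: h_def)
  qed
  finally show ?thesis
    using sigma_B by (simp add: mult_left_mono algebra_simps)
qed

text \<open>Putting the root of \<open>pc\<close> into Cauchy-Schwarz produces the factor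
  \<open>pr \<bullet> pc\<close>, which later cancels the same factor in the rate; this is how the
  tracking error gets the Lyapunov weight \<open>3 * \<alpha> / \<mu>\<close>.\<close>

lemma tracking_error_mean:
  "(\<Sum>i<n. pr $ i * e i)\<^sup>2 \<le> (pr \<bullet> pc) * wsq n (\<lambda>i. 1 / pc $ i) e"
proof -
  have "(\<Sum>i<n. pr $ i * e i) = (\<Sum>i<n. (pr $ i * sqrt (pc $ i)) * (e i / sqrt (pc $ i)))"
    using pc_pos by (intro sum.cong) (auto simp: less_imp_neq[symmetric])
  then have "(\<Sum>i<n. pr $ i * e i)\<^sup>2
      \<le> (\<Sum>i<n. (pr $ i * sqrt (pc $ i))\<^sup>2) * (\<Sum>i<n. (e i / sqrt (pc $ i))\<^sup>2)"
    by (simp only: Cauchy_Schwarz_ineq_sum)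
  also have "(\<Sum>i<n. (e i / sqrt (pc $ i))\<^sup>2) = wsq n (\<lambda>i. 1 / pc $ i) e"
    unfolding wsq_def using pc_pos by (intro sum.cong) (auto simp: power_divide less_imp_le)
  also have "(\<Sum>i<n. (pr $ i * sqrt (pc $ i))\<^sup>2) \<le> pr \<bullet> pc"
    unfolding pr_pc
  proof (intro sum_mono)
    fix i assume i: "i \<in> {..<n}"
    have "(pr $ i * sqrt (pc $ i))\<^sup>2 = pr $ i * (pr $ i * pc $ i)"
      using pc_pos[of i] i by (simp add: power_mult_distrib) (simp add: power2_eq_square)
    also have "\<dots> \<le> 1 * (pr $ i * pc $ i)"
      using pr_le_1 pr_pos pc_pos i by (intro mult_right_mono) (auto simp: less_imp_le)
    finally show "(pr $ i * sqrt (pc $ i))\<^sup>2 \<le> pr $ i * pc $ i" by simp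
  qed
  finally show ?thesis
    using pc_pos by (simp add: mult_right_mono wsq_nonneg less_imp_le)
qed

text \<open>The vector \<open>w\<close> is its tracking error plus \<open>pc\<close> times the sum
  of \<open>g\<close>. As \<open>z\<close> sums to zero, that sum equals the sum of
  \<open>g - z\<close>; with \<open>z\<close> the node gradients at the minimizer it is small near
  the optimum.\<close>

lemma consensus_step:
  fixes x w g z :: "nat \<Rightarrow> real" and \<alpha> :: real
  assumes z: "(\<Sum>i<n. z i) = 0"
  defines "y \<equiv> \<lambda>i. x i - \<alpha> * w i"
  shows "wsq n (($) pr) (\<lambda>i. mv n (A ^\<^sub>m c) y i - (\<Sum>r<n. pr $ r * y r))
    \<le> sigma_A A pr ^ (2 * c) * (2 * wsq n (($) pr) (\<lambda>i. x i - (\<Sum>r<n. pr $ r * x r))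
        + 4 * \<alpha>\<^sup>2 * (wsq n (\<lambda>i. 1 / pc $ i) (\<lambda>i. w i - pc $ i * (\<Sum>r<n. g r))
                     + (pr \<bullet> pc) * real n * (\<Sum>i<n. (g i - z i)\<^sup>2)))"
proof -
  let ?u = "($) pr" and ?m = "\<lambda>x. \<Sum>r<n. pr $ r * x r" and ?s = "\<Sum>r<n. g r"
  let ?W = "wsq n (\<lambda>i. 1 / pc $ i) (\<lambda>i. w i - pc $ i * ?s)"
  have u: "0 \<le> pr $ i" if "i < n" for i using pr_pos[OF that] by simp
  define y0 where "y0 i = (x i - ?m x) - \<alpha> * (w i - ?m w)" for i
  have my: "?m y = ?m x - \<alpha> * ?m w"
  proof -
    have "?m y = (\<Sum>r<n. pr $ r * x r - \<alpha> * (pr $ r * w r))"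
      by (intro sum.cong) (auto simp: y_def algebra_simps)
    then show ?thesis by (simp add: sum_subtractf sum_distrib_left)
  qed
  have y0: "y0 i = y i - ?m y * 1" for i
    unfolding y0_def my by (simp add: y_def algebra_simps)
  have "mv n A (\<lambda>_. 1) i = 1" if "i < n" for i
    using A_row_sum[OF that] by (simp add: mv_def)
  then have "mv n (A ^\<^sub>m c) y0 i = mv n (A ^\<^sub>m c) y i - ?m y" if "i < n" for i
    unfolding y0[abs_def] mv_diff mv_cmult using mv_pow_fixed[OF A_dim, of "\<lambda>_. 1"] that by simp
  then have "wsq n ?u (\<lambda>i. mv n (A ^\<^sub>m c) y i - ?m y) = wsq n ?u (mv n (A ^\<^sub>m c) y0)"
    by (intro wsq_cong) simp
  also have "\<dots> \<le> sigma_A A pr ^ (2 * c) * wsq n ?u y0"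
  proof (rule A_pow_contraction)
    show "(\<Sum>i<n. pr $ i * y0 i) = 0"
      using pr_sum by (simp add: y0 right_diff_distrib sum_subtractf flip: sum_distrib_right)
  qed
  finally have contract: "wsq n ?u (\<lambda>i. mv n (A ^\<^sub>m c) y i - ?m y) \<le> sigma_A A pr ^ (2 * c) * wsq n ?u y0" .
  have "wsq n ?u y0 \<le> 2 * wsq n ?u (\<lambda>i. x i - ?m x) + 2 * wsq n ?u (\<lambda>i. \<alpha> * (w i - ?m w))"
    unfolding y0_def[abs_def] using u by (rule wsq_diff_le)
  also have "wsq n ?u (\<lambda>i. \<alpha> * (w i - ?m w)) = \<alpha>\<^sup>2 * wsq n ?u (\<lambda>i. w i - ?m w)"
    by (rule wsq_cmult)
  finally have y0_le: "wsq n ?u y0 \<le> 2 * wsq n ?u (\<lambda>i. x i - ?m x) + 2 * (\<alpha>\<^sup>2 * wsq n ?u (\<lambda>i. w i - ?m w))" .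
  have "wsq n ?u (\<lambda>i. w i - ?m w) \<le> 2 * (?W + (pr \<bullet> pc) * real n * (\<Sum>i<n. (g i - z i)\<^sup>2))"
  proof -
    have "wsq n ?u (\<lambda>i. w i - ?m w) \<le> wsq n ?u w"
      by (rule weighted_mean_deviation_le)
    also have "\<dots> = wsq n ?u (\<lambda>i. (w i - pc $ i * ?s) + pc $ i * ?s)" by simp
    also have "\<dots> \<le> 2 * wsq n ?u (\<lambda>i. w i - pc $ i * ?s) + 2 * wsq n ?u (\<lambda>i. pc $ i * ?s)"
      using u by (rule wsq_add_le)
    \<comment> \<open>Entrywise \<open>pr \<le> 1 \<le> 1 / pc\<close>, so the tracking norm
      dominates the consensus norm.\<close>
    also have "wsq n ?u (\<lambda>i. w i - pc $ i * ?s) \<le> ?W"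
      unfolding wsq_def
    proof (intro sum_mono mult_right_mono)
      fix i assume i: "i \<in> {..<n}"
      have "pr $ i \<le> 1" using pr_le_1 i by simp
      also have "1 \<le> 1 / pc $ i" using pc_le_1 pc_pos i by simp
      finally show "pr $ i \<le> 1 / pc $ i" .
    qed auto
    also have "wsq n ?u (\<lambda>i. pc $ i * ?s) \<le> (pr \<bullet> pc) * ?s\<^sup>2"
      unfolding wsq_def pr_pc sum_distrib_right
    proof (intro sum_mono)
      fix i assume i: "i \<in> {..<n}"
      have "pr $ i * (pc $ i * ?s)\<^sup>2 = pc $ i * (pr $ i * pc $ i * ?s\<^sup>2)"
        by (simp add: power2_eq_square mult_ac)
      also have "\<dots> \<le> 1 * (pr $ i * pc $ i * ?s\<^sup>2)"
        using pc_le_1 pr_pos pc_pos i by (intro mult_right_mono) (auto simp: less_imp_le)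
      finally show "pr $ i * (pc $ i * ?s)\<^sup>2 \<le> pr $ i * pc $ i * ?s\<^sup>2" by simp
    qed
    also have "?s = (\<Sum>i<n. g i - z i)" using z by (simp add: sum_subtractf)
    also have "(pr \<bullet> pc) * (\<Sum>i<n. g i - z i)\<^sup>2 \<le> (pr \<bullet> pc) * (real n * (\<Sum>i<n. (g i - z i)\<^sup>2))"
      using pr_pc_pos by (intro mult_left_mono square_sum_le) auto
    finally show ?thesis by (simp add: sum_subtractf z algebra_simps)
  qed
  from mult_left_mono[OF this, of "2 * \<alpha>\<^sup>2"] y0_le
  have "wsq n ?u y0 \<le> 2 * wsq n ?u (\<lambda>i. x i - ?m x)
      + 4 * \<alpha>\<^sup>2 * (?W + (pr \<bullet> pc) * real n * (\<Sum>i<n. (g i - z i)\<^sup>2))"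
    by (simp add: algebra_simps)
  then have "sigma_A A pr ^ (2 * c) * wsq n ?u y0 \<le> sigma_A A pr ^ (2 * c)
      * (2 * wsq n ?u (\<lambda>i. x i - ?m x) + 4 * \<alpha>\<^sup>2 * (?W + (pr \<bullet> pc) * real n * (\<Sum>i<n. (g i - z i)\<^sup>2)))"
    using sigma_A by (intro mult_left_mono) auto
  with contract show ?thesis
    by (rule order_trans)
qed

end

section \<open>One noisy gradient step of the averaged iterate\<close>

text \<open>Here \<open>\<delta>\<close> is the error of the mean, \<open>F\<close> the global
  gradient there, \<open>b\<close> the bias from disagreement, \<open>\<nu>\<close> centred sampling
  noise and \<open>e\<close> the tracking error. Since \<open>e\<close> may be correlated with the
  sample, Young's inequality separates it before the average is taken; the noise then has no cross
  term and costs only its variance.\<close>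

lemma optimality_step:
  fixes \<nu> e :: "'s \<Rightarrow> nat \<Rightarrow> real"
  assumes S: "finite S" "S \<noteq> {}"
    and mean: "\<And>q. q < p \<Longrightarrow> avg S (\<lambda>s. \<nu> s q) = 0"
    and mono: "\<mu> * sqn p \<delta> \<le> (\<Sum>q<p. F q * \<delta> q)"
    and lip: "sqn p F \<le> L\<^sup>2 * sqn p \<delta>"
    and th: "\<theta> = \<eta> * \<mu>" "0 < \<theta>" "\<theta> \<le> 1 / 288" "0 < \<eta>" "\<eta>\<^sup>2 * L\<^sup>2 \<le> \<theta> / 288"
  shows "avg S (\<lambda>s. sqn p (\<lambda>q. \<delta> q - \<eta> * (F q + b q + \<nu> s q) - \<alpha> * e s q))
    \<le> (1 - 9/10 * \<theta>) * sqn p \<delta> + 4 / \<theta> * \<eta>\<^sup>2 * sqn p b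
      + 2 * \<eta>\<^sup>2 * avg S (\<lambda>s. sqn p (\<nu> s)) + 3 / \<theta> * \<alpha>\<^sup>2 * avg S (\<lambda>s. sqn p (e s))"
proof -
  \<comment> \<open>Young's inequality is used twice and multiplies the error by (1 + t)^2, about 1
    + \<theta>. This spends half of the decrease 2 \<theta> of gradient descent and leaves 9/10
    \<theta> after the small terms.\<close>
  define t where "t = \<theta> / 2"
  have t: "t > 0" "1 + 1 / t \<le> 3 / \<theta>" "1 + t \<le> 2" "(1 + t) * (1 + 1 / t) \<le> 4 / \<theta>"
  proof -
    show t0: "t > 0" "1 + t \<le> 2" using th by (auto simp: t_def)
    show t1: "1 + 1 / t \<le> 3 / \<theta>" using th by (simp add: t_def field_simps)
    have "(1 + t) * (1 + 1 / t) \<le> 4 / 3 * (3 / \<theta>)"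
      using t0 t1 th by (intro mult_mono) (auto simp: t_def)
    then show "(1 + t) * (1 + 1 / t) \<le> 4 / \<theta>" by simp
  qed
  define Q where "Q q = \<delta> q - \<eta> * F q" for q
  define P where "P q = Q q - \<eta> * b q" for q
  have Q: "sqn p Q \<le> (1 - 2 * \<theta> + \<theta> / 288) * sqn p \<delta>"
  proof -
    have "sqn p Q = sqn p \<delta> - 2 * \<eta> * (\<Sum>q<p. F q * \<delta> q) + \<eta>\<^sup>2 * sqn p F"
      unfolding sqn_def sum_distrib_left sum_subtractf[symmetric] sum.distrib[symmetric]
      by (intro sum.cong) (auto simp: Q_def power2_eq_square algebra_simps)
    also have "\<dots> \<le> sqn p \<delta> - 2 * \<eta> * (\<mu> * sqn p \<delta>) + \<eta>\<^sup>2 * (L\<^sup>2 * sqn p \<delta>)"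
      using mono lip th by (intro add_mono diff_mono mult_left_mono) auto
    also have "\<dots> = sqn p \<delta> - 2 * \<theta> * sqn p \<delta> + (\<eta>\<^sup>2 * L\<^sup>2) * sqn p \<delta>"
      by (simp add: th)
    also have "\<dots> \<le> sqn p \<delta> - 2 * \<theta> * sqn p \<delta> + (\<theta> / 288) * sqn p \<delta>"
      using th by (intro add_mono mult_right_mono) auto
    finally show ?thesis by (simp add: algebra_simps)
  qed
  have P: "sqn p P \<le> (1 + t) * sqn p Q + (1 + 1 / t) * \<eta>\<^sup>2 * sqn p b"
    unfolding sqn_def sum_distrib_left sum.distrib[symmetric]
  proof (intro sum_mono)
    fix q
    show "(P q)\<^sup>2 \<le> (1 + t) * (Q q)\<^sup>2 + (1 + 1 / t) * \<eta>\<^sup>2 * (b q)\<^sup>2"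
      using young_square_diff[OF t(1), of "Q q" "\<eta> * b q"] by (simp add: P_def power_mult_distrib)
  qed
  have noise: "avg S (\<lambda>s. sqn p (\<lambda>q. P q - \<eta> * \<nu> s q)) = sqn p P + \<eta>\<^sup>2 * avg S (\<lambda>s. sqn p (\<nu> s))"
  proof -
    have "avg S (\<lambda>s. sqn p (\<lambda>q. P q - \<eta> * \<nu> s q))
        = avg S (\<lambda>s. (sqn p P - (\<Sum>q<p. 2 * \<eta> * P q * \<nu> s q)) + \<eta>\<^sup>2 * sqn p (\<nu> s))"
      unfolding sqn_def sum_distrib_left sum_subtractf[symmetric] sum.distrib[symmetric]
      by (intro avg_cong sum.cong) (auto simp: power2_eq_square algebra_simps)
    also have "\<dots> = sqn p P - (\<Sum>q<p. 2 * \<eta> * P q * avg S (\<lambda>s. \<nu> s q)) + \<eta>\<^sup>2 * avg S (\<lambda>s. sqn p (\<nu> s))"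
      using S by (simp add: avg_add avg_diff avg_cmult avg_sum avg_const)
    finally show ?thesis using mean by simp
  qed
  have "avg S (\<lambda>s. sqn p (\<lambda>q. \<delta> q - \<eta> * (F q + b q + \<nu> s q) - \<alpha> * e s q))
      \<le> avg S (\<lambda>s. (1 + t) * sqn p (\<lambda>q. P q - \<eta> * \<nu> s q) + (1 + 1 / t) * \<alpha>\<^sup>2 * sqn p (e s))"
  proof (intro avg_mono)
    fix s
    show "sqn p (\<lambda>q. \<delta> q - \<eta> * (F q + b q + \<nu> s q) - \<alpha> * e s q)
      \<le> (1 + t) * sqn p (\<lambda>q. P q - \<eta> * \<nu> s q) + (1 + 1 / t) * \<alpha>\<^sup>2 * sqn p (e s)"
      unfolding sqn_def sum_distrib_left sum.distrib[symmetric]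
    proof (intro sum_mono)
      fix q
      have "\<delta> q - \<eta> * (F q + b q + \<nu> s q) - \<alpha> * e s q = (P q - \<eta> * \<nu> s q) - \<alpha> * e s q"
        by (simp add: P_def Q_def algebra_simps)
      then show "(\<delta> q - \<eta> * (F q + b q + \<nu> s q) - \<alpha> * e s q)\<^sup>2
          \<le> (1 + t) * (P q - \<eta> * \<nu> s q)\<^sup>2 + (1 + 1 / t) * \<alpha>\<^sup>2 * (e s q)\<^sup>2"
        using young_square_diff[OF t(1), of "P q - \<eta> * \<nu> s q" "\<alpha> * e s q"]
        by (simp add: power_mult_distrib)
    qed
  qed
  also have "\<dots> = (1 + t) * sqn p P + (1 + t) * \<eta>\<^sup>2 * avg S (\<lambda>s. sqn p (\<nu> s))
      + (1 + 1 / t) * \<alpha>\<^sup>2 * avg S (\<lambda>s. sqn p (e s))"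
    by (simp add: avg_add avg_cmult noise distrib_left)
  also have "(1 + t) * sqn p P \<le> (1 + t) * ((1 + t) * sqn p Q + (1 + 1 / t) * \<eta>\<^sup>2 * sqn p b)"
    using P t by (intro mult_left_mono) auto
  also have "\<dots> = (1 + t)\<^sup>2 * sqn p Q + ((1 + t) * (1 + 1 / t)) * (\<eta>\<^sup>2 * sqn p b)"
    by (simp add: power2_eq_square algebra_simps)
  also have "\<dots> \<le> (1 - 9/10 * \<theta>) * sqn p \<delta> + 4 / \<theta> * (\<eta>\<^sup>2 * sqn p b)"
  proof (intro add_mono)
    show "((1 + t) * (1 + 1 / t)) * (\<eta>\<^sup>2 * sqn p b) \<le> 4 / \<theta> * (\<eta>\<^sup>2 * sqn p b)"
      using t by (intro mult_right_mono) auto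
    have "(1 + t)\<^sup>2 * sqn p Q \<le> (1 + t)\<^sup>2 * ((1 - 2 * \<theta> + \<theta> / 288) * sqn p \<delta>)"
      using Q by (intro mult_left_mono) auto
    also have "\<dots> = ((1 + t)\<^sup>2 * (1 - 2 * \<theta> + \<theta> / 288)) * sqn p \<delta>" by simp
    also have "(1 + t)\<^sup>2 * (1 - 2 * \<theta> + \<theta> / 288) \<le> 1 - 9/10 * \<theta>"
    proof -
      have "(1 + t)\<^sup>2 * (1 - 2 * \<theta> + \<theta> / 288)
        = 1 - 287/288 * \<theta> - 503/288 * \<theta>\<^sup>2 - 575/1152 * \<theta> ^ 3"
        by (simp add: t_def power2_eq_square power3_eq_cube field_simps)
      also have "\<dots> \<le> 1 - 9/10 * \<theta>"
        using th(2) zero_le_power[of \<theta> 2] zero_le_power[of \<theta> 3] by linarith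
      finally show ?thesis .
    qed
    finally show "(1 + t)\<^sup>2 * sqn p Q \<le> (1 - 9/10 * \<theta>) * sqn p \<delta>"
      by (simp add: mult_right_mono)
  qed
  also have "(1 + t) * \<eta>\<^sup>2 * avg S (\<lambda>s. sqn p (\<nu> s)) \<le> 2 * \<eta>\<^sup>2 * avg S (\<lambda>s. sqn p (\<nu> s))"
    using t by (intro mult_right_mono avg_nonneg) auto
  also have "(1 + 1 / t) * \<alpha>\<^sup>2 * avg S (\<lambda>s. sqn p (e s)) \<le> 3 / \<theta> * \<alpha>\<^sup>2 * avg S (\<lambda>s. sqn p (e s))"
    using t by (intro mult_right_mono avg_nonneg) auto
  finally show ?thesis by simp
qed

section \<open>Mean and variance of the SAGA estimate\<close>

context finite_sum_problem
begin

definition saga_estimate ::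
  "(nat \<Rightarrow> real vec) \<Rightarrow> (nat \<Rightarrow> nat \<Rightarrow> real vec) \<Rightarrow> (nat \<Rightarrow> nat) \<Rightarrow> nat \<Rightarrow> nat \<Rightarrow> real" where
  "saga_estimate x v s i q = grad p (f i (s i)) (x i) $ q - grad p (f i (s i)) (v i (s i)) $ q
     + avg {..<m i} (\<lambda>j. grad p (f i j) (v i j) $ q)"

lemma samples_nonempty: "i < n \<Longrightarrow> {..<m i} \<noteq> {}"
  using m_pos[of i] by (auto simp: lessThan_empty_iff)

lemma avg_node:
  "i < n \<Longrightarrow> avg (round_draws n m) (\<lambda>s. h (s i)) = avg {..<m i} h"
  using samples_nonempty by (intro avg_PiE_component) auto

lemma avg_saga_estimate:
  assumes "i < n"
  shows "avg (round_draws n m) (\<lambda>s. saga_estimate x v s i q) = node_grad i (x i) q"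
proof -
  have "avg (round_draws n m) (\<lambda>s. saga_estimate x v s i q)
      = avg {..<m i} (\<lambda>j. grad p (f i j) (x i) $ q - grad p (f i j) (v i j) $ q
          + avg {..<m i} (\<lambda>j. grad p (f i j) (v i j) $ q))"
    unfolding saga_estimate_def using assms by (rule avg_node)
  also have "\<dots> = node_grad i (x i) q"
    using samples_nonempty[OF assms] by (simp add: avg_add avg_diff avg_const node_grad_def)
  finally show ?thesis .
qed

lemma node_grad_lipschitz:
  assumes i: "i < n" and x: "x \<in> carrier_vec p" and y: "y \<in> carrier_vec p"
  shows "sqn p (\<lambda>q. node_grad i x q - node_grad i y q) \<le> L\<^sup>2 * sqn p (\<lambda>q. x $ q - y $ q)"
proof -
  have "sqn p (\<lambda>q. node_grad i x q - node_grad i y q)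
      \<le> (\<Sum>q<p. avg {..<m i} (\<lambda>j. (grad p (f i j) x $ q - grad p (f i j) y $ q)\<^sup>2))"
    unfolding sqn_def node_grad_def avg_diff[symmetric]
    using samples_nonempty[OF i] by (intro sum_mono avg_square_le) auto
  also have "\<dots> = avg {..<m i} (\<lambda>j. sqn p (\<lambda>q. grad p (f i j) x $ q - grad p (f i j) y $ q))"
    by (simp add: avg_sum sqn_def)
  also have "\<dots> \<le> avg {..<m i} (\<lambda>j. L\<^sup>2 * sqn p (\<lambda>q. x $ q - y $ q))"
    using assms by (intro avg_mono grad_lipschitz) auto
  finally show ?thesis
    using samples_nonempty[OF i] by (simp add: avg_const)
qed

text \<open>Bias and variance: the estimate is centred at the node gradient at \<open>x i\<close>,
  and its variance is at most the second moment of \<open>h\<close>, the difference of current and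
  stored gradients. The reference \<open>y\<close> will be \<open>xs\<close> for the size of the
  estimate and \<open>x i\<close> for its pure variance.\<close>

lemma avg_saga_error:
  assumes i: "i < n" and x: "x i \<in> carrier_vec p" and y: "y \<in> carrier_vec p"
    and v: "\<And>j. j < m i \<Longrightarrow> v i j \<in> carrier_vec p"
  shows "avg (round_draws n m) (\<lambda>s. sqn p (\<lambda>q. saga_estimate x v s i q - node_grad i y q))
    \<le> L\<^sup>2 * (avg {..<m i} (\<lambda>j. sqn p (\<lambda>q. x i $ q - v i j $ q)) + sqn p (\<lambda>q. x i $ q - y $ q))"
proof -
  let ?J = "{..<m i}"
  define H U where "H j q = grad p (f i j) (x i) $ q" and "U j q = grad p (f i j) (v i j) $ q" for j q
  define h where "h j q = H j q - U j q" for j q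
  note J = finite_lessThan samples_nonempty[OF i]
  have centre: "avg ?J (\<lambda>j. h j q) = node_grad i (x i) q - avg ?J (\<lambda>j. U j q)" for q
    by (simp add: h_def avg_diff node_grad_def H_def)
  have "avg (round_draws n m) (\<lambda>s. sqn p (\<lambda>q. saga_estimate x v s i q - node_grad i y q))
      = avg ?J (\<lambda>j. sqn p (\<lambda>q. h j q + avg ?J (\<lambda>j. U j q) - node_grad i y q))"
    unfolding saga_estimate_def h_def H_def U_def using i by (rule avg_node)
  also have "\<dots> = (\<Sum>q<p. avg ?J (\<lambda>j. (h j q + avg ?J (\<lambda>j. U j q) - node_grad i y q)\<^sup>2))"
    by (simp add: sqn_def avg_sum)
  also have "\<dots> \<le> (\<Sum>q<p. avg ?J (\<lambda>j. (h j q)\<^sup>2) + (node_grad i (x i) q - node_grad i y q)\<^sup>2)"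
  proof (intro sum_mono)
    fix q
    let ?b = "node_grad i (x i) q - node_grad i y q"
    have "avg ?J (\<lambda>j. (h j q + avg ?J (\<lambda>j. U j q) - node_grad i y q)\<^sup>2)
        = avg ?J (\<lambda>j. ((h j q - avg ?J (\<lambda>j. h j q))\<^sup>2 + 2 * ?b * (h j q - avg ?J (\<lambda>j. h j q))) + ?b\<^sup>2)"
      unfolding centre by (intro avg_cong) (simp add: power2_eq_square algebra_simps)
    also have "\<dots> = avg ?J (\<lambda>j. (h j q - avg ?J (\<lambda>j. h j q))\<^sup>2) + ?b\<^sup>2"
      using J by (simp add: avg_add avg_cmult avg_diff avg_const)
    also have "\<dots> \<le> avg ?J (\<lambda>j. (h j q)\<^sup>2) + ?b\<^sup>2"
      using avg_variance_le[OF J] by simp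
    finally show "avg ?J (\<lambda>j. (h j q + avg ?J (\<lambda>j. U j q) - node_grad i y q)\<^sup>2)
        \<le> avg ?J (\<lambda>j. (h j q)\<^sup>2) + ?b\<^sup>2" .
  qed
  also have "\<dots> = avg ?J (\<lambda>j. sqn p (h j)) + sqn p (\<lambda>q. node_grad i (x i) q - node_grad i y q)"
    by (simp add: sqn_def avg_sum sum.distrib)
  also have "avg ?J (\<lambda>j. sqn p (h j)) \<le> avg ?J (\<lambda>j. L\<^sup>2 * sqn p (\<lambda>q. x i $ q - v i j $ q))"
    unfolding h_def H_def U_def using i x v by (intro avg_mono grad_lipschitz) auto
  also have "sqn p (\<lambda>q. node_grad i (x i) q - node_grad i y q) \<le> L\<^sup>2 * sqn p (\<lambda>q. x i $ q - y $ q)"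
    using i x y by (rule node_grad_lipschitz)
  finally show ?thesis
    by (simp add: avg_cmult distrib_left)
qed

text \<open>At \<open>xs\<close> plus the first unit vector, strong monotonicity makes the first
  coordinate of the global gradient at least \<open>\<mu>\<close>, while the Lipschitz bound makes
  its square at most L^2.\<close>

lemma mu_le_L: "\<mu> \<le> L"
proof -
  let ?e = "unit_vec p 0 :: real vec"
  let ?x = "xs + ?e"
  have c: "?x \<in> carrier_vec p" using xs_carrier by simp
  have d: "sqn p (\<lambda>q. ?x $ q - xs $ q) = 1"
  proof -
    have "sqn p (\<lambda>q. ?x $ q - xs $ q) = (\<Sum>q<p. if q = 0 then 1 else 0)"
      unfolding sqn_def using xs_carrier by (intro sum.cong) (auto simp: unit_vec_def)
    then show ?thesis using p_pos by simp
  qed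
  define F where "F q = (\<Sum>i<n. node_grad i ?x q) / real n" for q
  have "\<mu> * 1 \<le> (\<Sum>q<p. F q * (?x $ q - xs $ q))"
    using strong_monotone[OF c] unfolding d F_def .
  also have "\<dots> = (\<Sum>q<p. if q = 0 then F q else 0)"
    using xs_carrier by (intro sum.cong) (auto simp: unit_vec_def)
  also have "\<dots> = F 0" using p_pos by simp
  finally have F0: "\<mu> \<le> F 0" by simp
  have "F q = (\<Sum>i<n. node_grad i ?x q - node_grad i xs q) / real n" if "q < p" for q
    using sum_node_grad_minimizer[OF that] by (simp add: F_def sum_subtractf)
  then have "(F 0)\<^sup>2 \<le> 1 / (real n)\<^sup>2 * (real n * (\<Sum>i<n. (node_grad i ?x 0 - node_grad i xs 0)\<^sup>2))"
    using p_pos by (simp add: power_divide divide_right_mono square_sum_le)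
  also have "\<dots> \<le> 1 / (real n)\<^sup>2 * (real n * (\<Sum>i<n. L\<^sup>2))"
  proof (intro mult_left_mono sum_mono)
    fix i assume "i \<in> {..<n}"
    then have "sqn p (\<lambda>q. node_grad i ?x q - node_grad i xs q) \<le> L\<^sup>2 * 1"
      using node_grad_lipschitz[OF _ c xs_carrier, of i] d by simp
    moreover have "(node_grad i ?x 0 - node_grad i xs 0)\<^sup>2 \<le> sqn p (\<lambda>q. node_grad i ?x q - node_grad i xs q)"
      unfolding sqn_def using p_pos by (intro member_le_sum) auto
    ultimately show "(node_grad i ?x 0 - node_grad i xs 0)\<^sup>2 \<le> L\<^sup>2" by simp
  qed auto
  also have "\<dots> = L\<^sup>2" using n_pos by (simp add: power2_eq_square)
  finally have "\<mu>\<^sup>2 \<le> L\<^sup>2"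
    using F0 mu_pos power_mono[of \<mu> "F 0" 2] by linarith
  \<comment> \<open>Comparing squares leaves the sign of \<open>L\<close> open; it is read off from
    the Lipschitz inequality at two points of distance 1.\<close>
  moreover have "0 \<le> L"
  proof -
    have i: "0 < n" "0 < m 0" using n_pos m_pos[of 0] by auto
    have "vnorm (grad p (f 0 0) ?x - grad p (f 0 0) xs) \<le> L * vnorm (?x - xs)"
      using smooth[OF i] c xs_carrier unfolding smooth_fun_def by blast
    moreover have "0 \<le> vnorm (grad p (f 0 0) ?x - grad p (f 0 0) xs)"
      using grad_carrier[OF i] c xs_carrier by (intro vnorm_nonneg[of _ p]) auto
    moreover have "vnorm (?x - xs) = 1"
    proof -
      have "(vnorm (?x - xs))\<^sup>2 = 1"
        using c xs_carrier d by (simp only: vnorm_square_minus)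
      then show ?thesis
        using vnorm_nonneg[of "?x - xs" p] c xs_carrier by (simp add: power2_eq_1_iff)
    qed
    ultimately show ?thesis by simp
  qed
  ultimately show ?thesis
    using power2_le_imp_le by blast
qed

end

subsection \<open>The Lyapunov weights\<close>

text \<open>The weight \<open>3 \<alpha> / \<mu>\<close> equals \<open>3 n \<alpha>\<^sup>2 \<rho> / \<theta>\<close>, the factor with which \<open>W'\<close> enters \<open>n D'\<close>.  The weight
  \<open>\<theta> mm / 4\<close> is the largest of this order for which the table error costs the optimality error less than
  its own decrease \<open>9/10 \<theta>\<close>, and \<open>\<theta> mm / (160 M L\<^sup>2)\<close> is small against both.\<close>

lemma lyapunov_contraction:
  fixes n mm M L \<mu> \<rho> \<alpha> hr hc \<beta> \<tau> D X T W G D' X' T' W' G' Y :: real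
  defines "\<theta> \<equiv> \<alpha> * n * \<rho> * \<mu>" and "\<eta> \<equiv> \<alpha> * n * \<rho>"
  assumes pos: "n \<ge> 1" "1 \<le> mm" "mm \<le> M" "0 < \<mu>" "\<mu> \<le> L" "0 < \<rho>" "\<rho> \<le> 1" "0 < \<alpha>"
      "1 \<le> hr" "1 \<le> hc" "0 \<le> \<beta>" "0 \<le> \<tau>"
    and state: "0 \<le> D" "0 \<le> X" "0 \<le> T" "0 \<le> W" "0 \<le> G" "0 \<le> W'" "0 \<le> G'" "0 \<le> Y"
    and step1: "\<alpha> * L \<le> 1 / 35"
    and step2: "288 * M * \<eta> * L\<^sup>2 \<le> mm * \<mu>"
    and beta: "\<beta> \<le> \<rho>\<^sup>2 * mm * \<mu>\<^sup>2 / (1265\<^sup>2 * L\<^sup>2 * n * M * hc)"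
    and sigma: "\<tau> \<le> mm\<^sup>2 * \<rho> * \<mu>\<^sup>2 / (90512\<^sup>2 * n\<^sup>2 * M\<^sup>2 * L\<^sup>2 * hr * hc)"
    and Y: "Y \<le> 2 * n * D + 2 * (n * hr) * X"
    and D': "D' \<le> (1 - 9/10 * \<theta>) * D + 4 / \<theta> * \<eta>\<^sup>2 * L\<^sup>2 * hr * X
        + 2 * \<eta>\<^sup>2 * (L\<^sup>2 / n) * (2 * Y + 2 * T) + 3 / \<theta> * \<alpha>\<^sup>2 * \<rho> * W'"
    and W': "W' \<le> \<beta> * (2 * W + 4 * (n * hc) * (G' + G))"
    and G': "G' \<le> L\<^sup>2 * (3 * Y + 2 * T)"
    and T': "T' \<le> (1 - 1 / M) * T + Y / mm"
    and X': "X' \<le> \<tau> * (2 * X + 4 * \<alpha>\<^sup>2 * (W' + \<rho> * n * G'))"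
  shows "n * D' + \<theta> * mm / 4 * T' + 2 * (n * hr) * X' + 3 * \<alpha> / \<mu> * W' + \<theta> * mm / (160 * M * L\<^sup>2) * G'
    \<le> (1 - min (\<theta> / 4) (1 / (2 * M)))
      * (n * D + \<theta> * mm / 4 * T + 2 * (n * hr) * X + 3 * \<alpha> / \<mu> * W + \<theta> * mm / (160 * M * L\<^sup>2) * G)"
proof -
  define r where "r = mm / M"
  define \<omega> where "\<omega> = 3 * \<alpha> / \<mu>"
  define cG where "cG = \<theta> * mm / (160 * M * L\<^sup>2)"
  define Dn where "Dn = n * D"
  define Xn where "Xn = n * hr * X"
  have L: "0 < L" "0 < M" "0 < n" "0 < hr" "0 < hc" "0 < mm" using pos by auto
  have th: "0 < \<theta>" "0 < \<eta>" "\<theta> = \<eta> * \<mu>" using pos L by (auto simp: \<theta>_def \<eta>_def)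
  have r: "0 < r" "r \<le> 1" using pos L by (auto simp: r_def)
  have om: "0 < \<omega>" using pos by (simp add: \<omega>_def)
  have cG: "0 < cG" "cG = \<theta> * r / (160 * L\<^sup>2)" using th L by (auto simp: cG_def r_def)
  have nn: "0 \<le> Dn" "0 \<le> Xn" using L state by (auto simp: Dn_def Xn_def)
  have etaL: "\<eta> * L\<^sup>2 \<le> r * \<mu> / 288"
    using step2 L by (simp add: r_def field_simps)
  have F1: "\<eta>\<^sup>2 * L\<^sup>2 \<le> \<theta> * r / 288"
  proof -
    have "\<eta>\<^sup>2 * L\<^sup>2 = \<eta> * (\<eta> * L\<^sup>2)" by (simp add: power2_eq_square)
    also have "\<dots> \<le> \<eta> * (r * \<mu> / 288)" using etaL th by (intro mult_left_mono) auto
    finally show ?thesis by (simp add: th mult_ac)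
  qed
  \<comment> \<open>As \<open>\<mu> \<le> L\<close>, the bound on \<eta> L^2 also limits the rate
    itself.\<close>
  have F3: "\<theta> \<le> r / 288"
  proof -
    have "\<theta> * \<mu> = \<eta> * \<mu>\<^sup>2" by (simp add: th power2_eq_square)
    also have "\<dots> \<le> \<eta> * L\<^sup>2" using pos th by (intro mult_left_mono power_mono) auto
    also have "\<dots> \<le> r / 288 * \<mu>" using etaL by simp
    finally show ?thesis using pos by simp
  qed
  have F3': "\<theta> \<le> 1 / 288" using F3 r by simp
  have aL: "\<alpha> * \<mu> \<le> 1 / 35"
    using step1 mult_left_mono[of \<mu> L \<alpha>] pos by linarith
  have F4: "\<beta> * (n * hc) \<le> \<rho>\<^sup>2 * r * \<mu>\<^sup>2 / (1265\<^sup>2 * L\<^sup>2)"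
  proof -
    have "\<beta> * (n * hc) \<le> \<rho>\<^sup>2 * mm * \<mu>\<^sup>2 / (1265\<^sup>2 * L\<^sup>2 * n * M * hc) * (n * hc)"
      using beta L by (intro mult_right_mono) auto
    also have "\<dots> = \<rho>\<^sup>2 * r * \<mu>\<^sup>2 / (1265\<^sup>2 * L\<^sup>2)"
      using L by (simp add: r_def mult_ac)
    finally show ?thesis .
  qed
  have q: "\<mu>\<^sup>2 / L\<^sup>2 \<le> 1" using pos L by (simp add: power_mono)
  have rho2: "\<rho>\<^sup>2 \<le> 1" using pos by (simp add: power_le_one)
  have F4': "\<beta> \<le> 1 / 12"
  proof -
    have "\<beta> * 1 \<le> \<beta> * (n * hc)"
      using pos mult_mono[of 1 n 1 hc] by (intro mult_left_mono) auto
    also have "\<dots> \<le> \<rho>\<^sup>2 * r * \<mu>\<^sup>2 / (1265\<^sup>2 * L\<^sup>2)" by (rule F4)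
    also have "\<dots> = \<rho>\<^sup>2 * r * (\<mu>\<^sup>2 / L\<^sup>2) / 1265\<^sup>2" by simp
    also have "\<dots> \<le> 1 * 1 * 1 / 1265\<^sup>2"
      using rho2 r q by (intro divide_right_mono mult_mono) auto
    finally show ?thesis by simp
  qed
  have F5: "\<tau> * (n * hr) \<le> r\<^sup>2 * \<rho> * \<mu>\<^sup>2 / (90512\<^sup>2 * n * L\<^sup>2)"
  proof -
    have "\<tau> * (n * hr) \<le> mm\<^sup>2 * \<rho> * \<mu>\<^sup>2 / (90512\<^sup>2 * n\<^sup>2 * M\<^sup>2 * L\<^sup>2 * hr * hc) * (n * hr)"
      using sigma L by (intro mult_right_mono) auto
    also have "\<dots> = r\<^sup>2 * \<rho> * \<mu>\<^sup>2 / (90512\<^sup>2 * n * L\<^sup>2) * (1 / hc)"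
      using L by (simp add: r_def power2_eq_square mult_ac)
    also have "\<dots> \<le> r\<^sup>2 * \<rho> * \<mu>\<^sup>2 / (90512\<^sup>2 * n * L\<^sup>2) * 1"
      using pos L by (intro mult_left_mono) auto
    finally show ?thesis by simp
  qed
  have F5a: "\<tau> * (n * hr) \<le> 1 / 90512\<^sup>2 * \<rho>"
  proof -
    have "r\<^sup>2 * \<rho> * \<mu>\<^sup>2 / (90512\<^sup>2 * n * L\<^sup>2) = (r\<^sup>2 * \<rho>) * (\<mu>\<^sup>2 / L\<^sup>2) * (1 / n) / 90512\<^sup>2" by simp
    also have "\<dots> \<le> (1 * \<rho>) * 1 * 1 / 90512\<^sup>2"
      using r q pos L by (intro divide_right_mono mult_mono) (auto simp: power_le_one)
    finally have "\<tau> * (n * hr) \<le> (1 * \<rho>) * 1 * 1 / 90512\<^sup>2"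
      using F5 by (rule order_trans[rotated])
    then show ?thesis by simp
  qed
  have F5b: "\<tau> \<le> 1 / 8"
  proof -
    have "\<tau> * 1 \<le> \<tau> * (n * hr)"
      using pos mult_mono[of 1 n 1 hr] by (intro mult_left_mono) auto
    then show ?thesis using F5a pos by simp
  qed
  \<comment> \<open>The coefficient 12 is 3 times 4: \<open>W'\<close> will be paid for three times,
    and the estimates drive it with \<open>4 * (n * hc)\<close>. After cancellation the claim is
    that \<open>36 * 640 / 1265\<^sup>2 * \<rho>\<close> is at most \<open>n\<close>.\<close>
  have K1: "12 * \<omega> * (\<beta> * (n * hc)) \<le> cG / 4"
  proof -
    have "12 * \<omega> * (\<beta> * (n * hc)) \<le> 12 * \<omega> * (\<rho>\<^sup>2 * r * \<mu>\<^sup>2 / (1265\<^sup>2 * L\<^sup>2))"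
      using F4 om by (intro mult_left_mono) auto
    also have "\<dots> = (\<alpha> * \<rho> * \<mu> * r / (640 * L\<^sup>2)) * (36 * 640 / 1265\<^sup>2 * \<rho>)"
      using pos L by (simp add: \<omega>_def power2_eq_square)
    also have "\<dots> \<le> (\<alpha> * \<rho> * \<mu> * r / (640 * L\<^sup>2)) * n"
      using pos r by (intro mult_left_mono) auto
    also have "\<dots> = cG / 4" by (simp add: cG \<theta>_def)
    finally show ?thesis .
  qed
  \<comment> \<open>By \<open>K2\<close> and \<open>K3\<close>, the smallness of
    \<open>\<tau>\<close> lets the tracking and estimate errors enter the disagreement at a cost of
    at most \<open>\<omega>\<close> and \<open>cG / 4\<close>.\<close>
  have K2: "8 * \<alpha>\<^sup>2 * (\<tau> * (n * hr)) \<le> \<omega>"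
  proof -
    have "8 * \<alpha>\<^sup>2 * (\<tau> * (n * hr)) \<le> 8 * \<alpha>\<^sup>2 * (1 / 90512\<^sup>2 * 1)"
      using F5a pos by (intro mult_left_mono) auto
    also have "\<dots> \<le> \<omega>"
    proof -
      have "\<alpha>\<^sup>2 * \<mu> \<le> \<alpha> * (1 / 35)"
        using mult_left_mono[OF aL, of \<alpha>] pos by (simp add: power2_eq_square mult.assoc)
      then have "8 * \<alpha>\<^sup>2 * (1 / 90512\<^sup>2 * 1) * \<mu> \<le> 3 * \<alpha>"
        using pos by simp
      then show ?thesis using pos by (simp add: \<omega>_def pos_le_divide_eq)
    qed
    finally show ?thesis .
  qed
  have K3: "8 * \<alpha>\<^sup>2 * (\<tau> * (n * hr)) * (\<rho> * n) \<le> cG / 4"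
  proof -
    have "8 * \<alpha>\<^sup>2 * (\<tau> * (n * hr)) * (\<rho> * n)
        \<le> 8 * \<alpha>\<^sup>2 * (r\<^sup>2 * \<rho> * \<mu>\<^sup>2 / (90512\<^sup>2 * n * L\<^sup>2)) * (\<rho> * n)"
      using F5 pos by (intro mult_left_mono mult_right_mono) auto
    also have "\<dots> = (\<alpha> * \<rho> * \<mu> * r / (640 * L\<^sup>2)) * (8 * 640 / 90512\<^sup>2 * ((\<alpha> * \<mu>) * (\<rho> * r)))"
      using L by (simp add: power2_eq_square)
    also have "\<dots> \<le> (\<alpha> * \<rho> * \<mu> * r / (640 * L\<^sup>2)) * n"
    proof (intro mult_left_mono)
      have "(\<alpha> * \<mu>) * (\<rho> * r) \<le> 1 / 35 * 1"
        using aL pos r by (intro mult_mono mult_le_one) auto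
      then show "8 * 640 / 90512\<^sup>2 * ((\<alpha> * \<mu>) * (\<rho> * r)) \<le> n" using pos by simp
    qed (use pos r in auto)
    also have "\<dots> = cG / 4" by (simp add: cG \<theta>_def)
    finally show ?thesis .
  qed
  have h1: "n * D' \<le> Dn - 9/10 * (\<theta> * Dn) + Xn / 72 + \<theta> * r / 72 * (Y + T) + \<omega> * W'"
  proof -
    have "n * D' \<le> n * ((1 - 9/10 * \<theta>) * D + 4 / \<theta> * \<eta>\<^sup>2 * L\<^sup>2 * hr * X
        + 2 * \<eta>\<^sup>2 * (L\<^sup>2 / n) * (2 * Y + 2 * T) + 3 / \<theta> * \<alpha>\<^sup>2 * \<rho> * W')"
      using D' L by (intro mult_left_mono) auto
    also have "\<dots> = Dn - 9/10 * (\<theta> * Dn) + 4 * (\<eta>\<^sup>2 * L\<^sup>2) / \<theta> * Xn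
        + 4 * (\<eta>\<^sup>2 * L\<^sup>2) * (Y + T) + 3 * n * \<alpha>\<^sup>2 * \<rho> / \<theta> * W'"
      using L th by (simp add: Dn_def Xn_def field_simps)
    also have "3 * n * \<alpha>\<^sup>2 * \<rho> / \<theta> = \<omega>"
      using pos L by (simp add: \<omega>_def \<theta>_def power2_eq_square)
    also have "4 * (\<eta>\<^sup>2 * L\<^sup>2) / \<theta> * Xn \<le> 4 * (\<theta> * r / 288) / \<theta> * Xn"
      using F1 th nn by (intro mult_right_mono divide_right_mono mult_left_mono) auto
    also have "4 * (\<theta> * r / 288) / \<theta> * Xn = r * (Xn / 72)" using th(1) by simp
    also have "\<dots> \<le> 1 * (Xn / 72)" using r nn by (intro mult_right_mono) auto
    also have "4 * (\<eta>\<^sup>2 * L\<^sup>2) * (Y + T) \<le> 4 * (\<theta> * r / 288) * (Y + T)"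
      using F1 state by (intro mult_right_mono) auto
    finally show ?thesis by simp
  qed
  have h2: "\<theta> * mm / 4 * T' \<le> \<theta> * mm / 4 * T - \<theta> * r * T / 4 + \<theta> * Y / 4"
  proof -
    have "\<theta> * mm / 4 * T' \<le> \<theta> * mm / 4 * ((1 - 1 / M) * T + Y / mm)"
      using T' th L by (intro mult_left_mono) auto
    also have "\<dots> = \<theta> * mm / 4 * T - \<theta> * r * T / 4 + \<theta> * Y / 4"
      using L by (simp add: r_def field_simps)
    finally show ?thesis .
  qed
  have h3: "2 * (n * hr) * X' \<le> Xn / 2 + \<omega> * W' + cG / 4 * G'"
  proof -
    have "2 * (n * hr) * X' \<le> 2 * (n * hr) * (\<tau> * (2 * X + 4 * \<alpha>\<^sup>2 * (W' + \<rho> * n * G')))"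
      using X' L by (intro mult_left_mono) auto
    also have "\<dots> = 4 * \<tau> * Xn + 8 * \<alpha>\<^sup>2 * (\<tau> * (n * hr)) * W'
        + 8 * \<alpha>\<^sup>2 * (\<tau> * (n * hr)) * (\<rho> * n) * G'"
      by (simp add: Xn_def algebra_simps)
    also have "\<dots> \<le> 4 * (1 / 8) * Xn + \<omega> * W' + cG / 4 * G'"
      using F5b K2 K3 nn state by (intro add_mono mult_right_mono mult_left_mono) auto
    finally show ?thesis by simp
  qed
  \<comment> \<open>\<open>W'\<close> occurs three times with weight \<open>\<omega>\<close>: in
    \<open>h1\<close>, in \<open>h3\<close> and in the new Lyapunov value itself.\<close>
  have h4: "3 * (\<omega> * W') \<le> \<omega> * W / 2 + cG / 4 * (G' + G)"
  proof -
    have "3 * (\<omega> * W') \<le> 3 * (\<omega> * (\<beta> * (2 * W + 4 * (n * hc) * (G' + G))))"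
      using W' om by (intro mult_left_mono) auto
    also have "\<dots> = \<beta> * (6 * (\<omega> * W)) + 12 * \<omega> * (\<beta> * (n * hc)) * (G' + G)"
      by (simp add: algebra_simps)
    also have "\<dots> \<le> 1 / 12 * (6 * (\<omega> * W)) + cG / 4 * (G' + G)"
      using F4' K1 state om by (intro add_mono mult_right_mono) auto
    finally show ?thesis by (simp add: mult.commute)
  qed
  have h5: "cG * G' \<le> \<theta> * r / 160 * (3 * Y + 2 * T)"
  proof -
    have "cG * G' \<le> cG * (L\<^sup>2 * (3 * Y + 2 * T))"
      using G' cG by (intro mult_left_mono) auto
    also have "\<dots> = \<theta> * r / 160 * (3 * Y + 2 * T)"
      using L by (simp add: cG)
    finally show ?thesis .
  qed
  have y1: "\<theta> * Y \<le> 2 * (\<theta> * Dn) + 2 * (\<theta> * Xn)"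
    using mult_left_mono[OF Y, of \<theta>] th by (simp add: Dn_def Xn_def algebra_simps)
  have y2: "\<theta> * r * Y \<le> \<theta> * Y"
    using mult_right_mono[of "\<theta> * r" \<theta> Y] mult_left_mono[of r 1 \<theta>] th(1) r state by simp
  have y3: "\<theta> * Xn \<le> 1 / 288 * Xn"
    using F3' nn by (intro mult_right_mono) auto
  \<comment> \<open>Here \<open>\<kappa>\<close> is the contraction gap, not the condition
    number.\<close>
  define \<kappa> where "\<kappa> = min (\<theta> / 4) (1 / (2 * M))"
  have lam: "\<kappa> \<le> \<theta> / 4" "\<kappa> \<le> 1 / (2 * M)" "\<kappa> \<le> 1 / 2"
    using F3' by (auto simp: \<kappa>_def)
  have l1: "\<kappa> * Dn \<le> \<theta> / 4 * Dn" using lam nn by (intro mult_right_mono) auto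
  have l2: "\<kappa> * (\<theta> * mm / 4 * T) \<le> \<theta> * r * T / 8"
  proof -
    have "\<kappa> * (\<theta> * mm / 4 * T) \<le> 1 / (2 * M) * (\<theta> * mm / 4 * T)"
      using lam th L state by (intro mult_right_mono) auto
    also have "\<dots> = \<theta> * r * T / 8" by (simp add: r_def)
    finally show ?thesis .
  qed
  have l3: "\<kappa> * Xn \<le> 1 / 2 * Xn" using lam nn by (intro mult_right_mono) auto
  have l4: "\<kappa> * (\<omega> * W) \<le> 1 / 2 * (\<omega> * W)" using lam state om by (intro mult_right_mono) auto
  have l5: "\<kappa> * (cG * G) \<le> 1 / 2 * (cG * G)" using lam state cG(1) by (intro mult_right_mono) auto
  have t1: "0 \<le> \<theta> * r * T" "0 \<le> \<theta> * Dn" "0 \<le> \<omega> * W" "0 \<le> cG * G"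
    using th(1) r state om cG(1) nn by auto
  have split: "\<theta> * r / 72 * (Y + T) = \<theta> * r * Y / 72 + \<theta> * r * T / 72"
    "\<theta> * r / 160 * (3 * Y + 2 * T) = 3 * (\<theta> * r * Y) / 160 + \<theta> * r * T / 80"
    "cG / 4 * (G' + G) = cG * G' / 4 + cG * G / 4" "cG / 4 * G' = cG * G' / 4"
    by (simp_all add: algebra_simps)
  have gen: "(a - k * a) + (b - k * b) + (2 * x - 2 * (k * x)) + (e - k * e) + (g - k * g)
      = (1 - k) * (a + b + 2 * x + e + g)" for a b x e g k :: real
    by (simp add: algebra_simps)
  \<comment> \<open>The terms in \<open>\<theta> * Y\<close> sum to less than 3/10 of it, hence by
    \<open>y1\<close> to less than 6/10 of \<open>\<theta> * Dn\<close>; out of 9/10 more than a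
    quarter remains. For \<open>\<theta> * r * T\<close>, the decrease 1/4 faces 1/72 + 3/160 and
    leaves more than 1/8.\<close>
  have "n * D' + \<theta> * mm / 4 * T' + 2 * (n * hr) * X' + \<omega> * W' + cG * G'
    \<le> (Dn - \<theta> / 4 * Dn) + (\<theta> * mm / 4 * T - \<theta> * r * T / 8) + (2 * Xn - Xn)
      + 1 / 2 * (\<omega> * W) + 1 / 2 * (cG * G)"
    using h1 h2 h3 h4 h5 y1 y2 y3 t1 nn unfolding split by linarith
  also have "\<dots> \<le> (Dn - \<kappa> * Dn) + (\<theta> * mm / 4 * T - \<kappa> * (\<theta> * mm / 4 * T)) + (2 * Xn - 2 * (\<kappa> * Xn))
      + (\<omega> * W - \<kappa> * (\<omega> * W)) + (cG * G - \<kappa> * (cG * G))"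
    using l1 l2 l3 l4 l5 by linarith
  also have "\<dots> = (1 - \<kappa>) * (n * D + \<theta> * mm / 4 * T + 2 * (n * hr) * X + \<omega> * W + cG * G)"
    by (simp only: gen) (simp add: Dn_def Xn_def mult.assoc)
  finally show ?thesis
    unfolding \<kappa>_def \<omega>_def cG_def .
qed

subsection \<open>One iteration of the algorithm\<close>

locale saga_network = finite_sum_problem n p m f L \<mu> xs + directed_network n G A B pr pc
  for n p m f L \<mu> xs G A B pr pc
begin

abbreviation "rounds_c \<equiv> rounds_A n m L \<mu> A B pr pc"
abbreviation "rounds_d \<equiv> rounds_B n m L \<mu> B pr pc"
abbreviation "m_max \<equiv> real (max_size n m)"
abbreviation "m_min \<equiv> real (min_size n m)"
abbreviation "\<rho> \<equiv> pr \<bullet> pc"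
abbreviation "h\<^sub>r \<equiv> entry_ratio pr"
abbreviation "h\<^sub>c \<equiv> entry_ratio pc"

definition next_x :: "real \<Rightarrow> (nat \<Rightarrow> real vec) \<Rightarrow> (nat \<Rightarrow> real vec) \<Rightarrow> nat \<Rightarrow> real vec" where
  "next_x \<alpha> x w = (\<lambda>i. finsum_vec TYPE(real) p
     (\<lambda>r. (A ^\<^sub>m rounds_c) $$ (i,r) \<cdot>\<^sub>v (x r - \<alpha> \<cdot>\<^sub>v w r)) {..<n})"

definition next_g :: "(nat \<Rightarrow> real vec) \<Rightarrow> (nat \<Rightarrow> nat \<Rightarrow> real vec) \<Rightarrow> (nat \<Rightarrow> nat) \<Rightarrow> nat \<Rightarrow> real vec" where
  "next_g y v s = (\<lambda>i. grad p (f i (s i)) (y i) - grad p (f i (s i)) (v i (s i))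
     + (1 / real (m i)) \<cdot>\<^sub>v finsum_vec TYPE(real) p (\<lambda>j. grad p (f i j) (v i j)) {..<m i})"

definition next_w :: "(nat \<Rightarrow> real vec) \<Rightarrow> (nat \<Rightarrow> real vec) \<Rightarrow> (nat \<Rightarrow> real vec) \<Rightarrow> nat \<Rightarrow> real vec" where
  "next_w w g g' = (\<lambda>i. finsum_vec TYPE(real) p
     (\<lambda>r. (B ^\<^sub>m rounds_d) $$ (i,r) \<cdot>\<^sub>v (w r + g' r - g r)) {..<n})"

definition next_v :: "(nat \<Rightarrow> real vec) \<Rightarrow> (nat \<Rightarrow> nat \<Rightarrow> real vec) \<Rightarrow> (nat \<Rightarrow> nat) \<Rightarrow> nat \<Rightarrow> nat \<Rightarrow> real vec" where
  "next_v y v s = (\<lambda>i j. if j = s i then y i else v i j)"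

text \<open>The equality of sums is the gradient tracking invariant: it holds at the start because
  \<open>w\<close> and \<open>g\<close> coincide, and it persists because powers of \<open>B\<close>
  preserve sums.\<close>

definition valid_state ::
  "(nat \<Rightarrow> real vec) \<Rightarrow> (nat \<Rightarrow> real vec) \<Rightarrow> (nat \<Rightarrow> real vec) \<Rightarrow> (nat \<Rightarrow> nat \<Rightarrow> real vec) \<Rightarrow> bool" where
  "valid_state x w g v \<longleftrightarrow>
     (\<forall>i<n. x i \<in> carrier_vec p \<and> w i \<in> carrier_vec p \<and> g i \<in> carrier_vec p
        \<and> (\<forall>j<m i. v i j \<in> carrier_vec p))
     \<and> (\<forall>q<p. (\<Sum>i<n. w i $ q) = (\<Sum>i<n. g i $ q))"

text \<open>With the left Perron vector as weights, mixing by powers of \<open>A\<close> leaves the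
  mean unchanged.\<close>

definition mean :: "(nat \<Rightarrow> real vec) \<Rightarrow> nat \<Rightarrow> real" where
  "mean y q = (\<Sum>r<n. pr $ r * y r $ q)"

definition opt_err :: "(nat \<Rightarrow> real vec) \<Rightarrow> real" where
  "opt_err y = sqn p (\<lambda>q. mean y q - xs $ q)"

definition cons_err :: "(nat \<Rightarrow> real vec) \<Rightarrow> real" where
  "cons_err y = (\<Sum>q<p. wsq n (($) pr) (\<lambda>i. y i $ q - mean y q))"

definition table_err :: "(nat \<Rightarrow> nat \<Rightarrow> real vec) \<Rightarrow> real" where
  "table_err v = (\<Sum>i<n. avg {..<m i} (\<lambda>j. sqn p (\<lambda>q. v i j $ q - xs $ q)))"

definition track_err :: "(nat \<Rightarrow> real vec) \<Rightarrow> (nat \<Rightarrow> real vec) \<Rightarrow> real" where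
  "track_err w g = (\<Sum>q<p. wsq n (\<lambda>i. 1 / pc $ i) (\<lambda>i. w i $ q - pc $ i * (\<Sum>r<n. g r $ q)))"

definition grad_err :: "(nat \<Rightarrow> real vec) \<Rightarrow> real" where
  "grad_err g = (\<Sum>i<n. sqn p (\<lambda>q. g i $ q - node_grad i xs q))"

definition node_err :: "(nat \<Rightarrow> real vec) \<Rightarrow> real" where
  "node_err y = (\<Sum>i<n. sqn p (\<lambda>q. y i $ q - xs $ q))"

definition rate :: "real \<Rightarrow> real" where
  "rate \<alpha> = \<alpha> * real n * \<rho> * \<mu>"

definition lyapunov ::
  "real \<Rightarrow> (nat \<Rightarrow> real vec) \<Rightarrow> (nat \<Rightarrow> real vec) \<Rightarrow> (nat \<Rightarrow> real vec) \<Rightarrow> (nat \<Rightarrow> nat \<Rightarrow> real vec) \<Rightarrow> real" where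
  "lyapunov \<alpha> y w g v = real n * opt_err y + rate \<alpha> * m_min / 4 * table_err v
     + 2 * (real n * h\<^sub>r) * cons_err y + 3 * \<alpha> / \<mu> * track_err w g
     + rate \<alpha> * m_min / (160 * m_max * L\<^sup>2) * grad_err g"

lemma sizes:
  shows "i < n \<Longrightarrow> m_min \<le> real (m i)" "i < n \<Longrightarrow> real (m i) \<le> m_max"
    "1 \<le> m_min" "m_min \<le> m_max"
proof -
  have ne: "m ` {..<n} \<noteq> {}" using n_pos by (auto simp: lessThan_empty_iff)
  show a: "m_min \<le> real (m i)" "real (m i) \<le> m_max" if "i < n" for i
    using that by (auto simp: min_size_def max_size_def)
  show "1 \<le> m_min"
    using ne m_pos by (auto simp: min_size_def Suc_le_eq)
  show "m_min \<le> m_max"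
    using a[of 0] n_pos by simp
qed

lemma L_pos: "0 < L"
  using mu_le_L mu_pos by simp

lemma next_x_carrier:
  "(\<And>i. i < n \<Longrightarrow> x i \<in> carrier_vec p) \<Longrightarrow> (\<And>i. i < n \<Longrightarrow> w i \<in> carrier_vec p) \<Longrightarrow> next_x \<alpha> x w i \<in> carrier_vec p"
  unfolding next_x_def by (intro finsum_vec_closed) auto

lemma next_x_coord:
  assumes "\<And>i. i < n \<Longrightarrow> x i \<in> carrier_vec p" "\<And>i. i < n \<Longrightarrow> w i \<in> carrier_vec p" "q < p"
  shows "next_x \<alpha> x w i $ q = mv n (A ^\<^sub>m rounds_c) (\<lambda>r. x r $ q - \<alpha> * w r $ q) i"
proof -
  have "(A ^\<^sub>m rounds_c) $$ (i,r) \<cdot>\<^sub>v (x r - \<alpha> \<cdot>\<^sub>v w r) \<in> carrier_vec p" if "r < n" for r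
    using assms(1,2)[OF that] by auto
  moreover have "((A ^\<^sub>m rounds_c) $$ (i,r) \<cdot>\<^sub>v (x r - \<alpha> \<cdot>\<^sub>v w r)) $ q
      = (A ^\<^sub>m rounds_c) $$ (i,r) * (x r $ q - \<alpha> * w r $ q)" if "r < n" for r
    using assms(1,2)[OF that] assms(3) by auto
  ultimately show ?thesis
    unfolding next_x_def mv_def using assms(3) by (subst index_finsum_vec) (auto intro!: sum.cong)
qed

lemma next_w_carrier:
  assumes "\<And>i. i < n \<Longrightarrow> w i \<in> carrier_vec p \<and> g i \<in> carrier_vec p \<and> g' i \<in> carrier_vec p"
  shows "next_w w g g' i \<in> carrier_vec p"
  unfolding next_w_def using assms by (intro finsum_vec_closed) auto

lemma next_w_coord:
  assumes "\<And>i. i < n \<Longrightarrow> w i \<in> carrier_vec p \<and> g i \<in> carrier_vec p \<and> g' i \<in> carrier_vec p" "q < p"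
  shows "next_w w g g' i $ q = mv n (B ^\<^sub>m rounds_d) (\<lambda>r. w r $ q + g' r $ q - g r $ q) i"
proof -
  have "(B ^\<^sub>m rounds_d) $$ (i,r) \<cdot>\<^sub>v (w r + g' r - g r) \<in> carrier_vec p" if "r < n" for r
    using assms(1)[OF that] by auto
  moreover have "((B ^\<^sub>m rounds_d) $$ (i,r) \<cdot>\<^sub>v (w r + g' r - g r)) $ q
      = (B ^\<^sub>m rounds_d) $$ (i,r) * (w r $ q + g' r $ q - g r $ q)" if "r < n" for r
    using assms(1)[OF that] assms(2) by auto
  ultimately show ?thesis
    unfolding next_w_def mv_def using assms(2) by (subst index_finsum_vec) (auto intro!: sum.cong)
qed

text \<open>Not the extensional product: the row of draws that a run reads off from an arbitrary
  \<open>\<omega>\<close> carries arbitrary values at nodes from \<open>n\<close> on.\<close>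

abbreviation "samples \<equiv> Pi {..<n} (\<lambda>i. {..<m i})"

lemma sample: "s \<in> samples \<Longrightarrow> i < n \<Longrightarrow> s i < m i"
  by auto

lemma round_draws_samples: "s \<in> round_draws n m \<Longrightarrow> s \<in> samples"
  by (simp add: PiE_def)

lemma sqn_average_le: "sqn p (\<lambda>q. (\<Sum>i<n. u i q) / real n) \<le> 1 / real n * (\<Sum>i<n. sqn p (u i))"
proof -
  have "sqn p (\<lambda>q. (\<Sum>i<n. u i q) / real n) \<le> (\<Sum>q<p. 1 / real n * (\<Sum>i<n. (u i q)\<^sup>2))"
    unfolding sqn_def
  proof (intro sum_mono)
    fix q
    have "((\<Sum>i<n. u i q) / real n)\<^sup>2 \<le> (real n * (\<Sum>i<n. (u i q)\<^sup>2)) / (real n)\<^sup>2"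
      unfolding power_divide by (intro divide_right_mono square_sum_le) auto
    then show "((\<Sum>i<n. u i q) / real n)\<^sup>2 \<le> 1 / real n * (\<Sum>i<n. (u i q)\<^sup>2)"
      using n_pos by (simp add: power2_eq_square)
  qed
  also have "\<dots> = 1 / real n * (\<Sum>i<n. sqn p (u i))"
    unfolding sqn_def by (subst sum.swap[of _ "{..<p}" "{..<n}"]) (simp add: sum_divide_distrib)
  finally show ?thesis .
qed

section \<open>Conditional error bounds for one round from a valid state\<close>

context
  fixes y w g :: "nat \<Rightarrow> real vec" and v :: "nat \<Rightarrow> nat \<Rightarrow> real vec"
  assumes valid: "valid_state y w g v"
begin

lemma carriers: "i < n \<Longrightarrow> y i \<in> carrier_vec p" "i < n \<Longrightarrow> w i \<in> carrier_vec p"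
    "i < n \<Longrightarrow> g i \<in> carrier_vec p" "i < n \<Longrightarrow> j < m i \<Longrightarrow> v i j \<in> carrier_vec p"
  and sums: "q < p \<Longrightarrow> (\<Sum>i<n. w i $ q) = (\<Sum>i<n. g i $ q)"
  using valid unfolding valid_state_def by blast+

lemma next_g_carrier:
  assumes s: "s \<in> samples" and i: "i < n"
  shows "next_g y v s i \<in> carrier_vec p"
proof -
  have c: "grad p (f i j) (v i j) \<in> carrier_vec p" "grad p (f i j) (y i) \<in> carrier_vec p" if "j < m i" for j
    using that i by (auto intro!: grad_carrier carriers)
  have "finsum_vec TYPE(real) p (\<lambda>j. grad p (f i j) (v i j)) {..<m i} \<in> carrier_vec p"
    using c by (intro finsum_vec_closed) auto
  then show ?thesis
    using c[OF sample[OF s i]] by (simp add: next_g_def)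
qed

lemma next_g_coord:
  assumes s: "s \<in> samples" and i: "i < n" and q: "q < p"
  shows "next_g y v s i $ q = saga_estimate y v s i q"
proof -
  have c: "grad p (f i j) (v i j) \<in> carrier_vec p" "grad p (f i j) (y i) \<in> carrier_vec p" if "j < m i" for j
    using that i by (auto intro!: grad_carrier carriers)
  have fc: "finsum_vec TYPE(real) p (\<lambda>j. grad p (f i j) (v i j)) {..<m i} \<in> carrier_vec p"
    using c by (intro finsum_vec_closed) auto
  have fq: "finsum_vec TYPE(real) p (\<lambda>j. grad p (f i j) (v i j)) {..<m i} $ q
      = (\<Sum>j<m i. grad p (f i j) (v i j) $ q)"
    using c q by (subst index_finsum_vec) auto
  have "s i < m i" using s i by auto
  from c[OF this] show ?thesis
    using fc q fq by (auto simp: next_g_def saga_estimate_def avg_def)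
qed

text \<open>The shifted order of an iteration: \<open>y\<close> is already the new iterate, the draw
  determines the estimate at \<open>y\<close>, the estimate determines \<open>w\<close>, and
  \<open>w\<close> determines the iterate after \<open>y\<close>.\<close>

abbreviation "gn \<equiv> next_g y v"
abbreviation "wn s \<equiv> next_w w g (gn s)"
abbreviation "yn \<alpha> s \<equiv> next_x \<alpha> y (wn s)"
abbreviation "vn \<equiv> next_v y v"

lemma wn_carrier: "s \<in> samples \<Longrightarrow> wn s i \<in> carrier_vec p"
  using carriers next_g_carrier by (intro next_w_carrier) auto

lemma wn_coord:
  "s \<in> samples \<Longrightarrow> q < p \<Longrightarrow>
    wn s i $ q = mv n (B ^\<^sub>m rounds_d) (\<lambda>r. w r $ q + gn s r $ q - g r $ q) i"
  using carriers next_g_carrier by (intro next_w_coord) auto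

lemma sum_wn:
  assumes "s \<in> samples" "q < p"
  shows "(\<Sum>i<n. wn s i $ q) = (\<Sum>i<n. gn s i $ q)"
  using sums[OF assms(2)] wn_coord[OF assms] sum_mv_B_pow
  by (simp add: sum.distrib sum_subtractf)

lemma yn_coord:
  "s \<in> samples \<Longrightarrow> q < p \<Longrightarrow>
    yn \<alpha> s i $ q = mv n (A ^\<^sub>m rounds_c) (\<lambda>r. y r $ q - \<alpha> * wn s r $ q) i"
  using carriers wn_carrier by (intro next_x_coord) auto

lemma mean_yn:
  assumes "s \<in> samples" "q < p"
  shows "mean (yn \<alpha> s) q = (\<Sum>r<n. pr $ r * (y r $ q - \<alpha> * wn s r $ q))"
  using yn_coord[OF assms] by (simp add: mean_def sum_mv_A_pow)

lemma valid_next: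
  assumes s: "s \<in> samples"
  shows "valid_state (yn \<alpha> s) (wn s) (gn s) (vn s)"
  unfolding valid_state_def
proof (intro conjI allI impI)
  fix i assume i: "i < n"
  show "yn \<alpha> s i \<in> carrier_vec p" using carriers wn_carrier[OF s] by (intro next_x_carrier) auto
  show "wn s i \<in> carrier_vec p" using wn_carrier[OF s] .
  show "gn s i \<in> carrier_vec p" using next_g_carrier[OF s i] .
  show "vn s i j \<in> carrier_vec p" if "j < m i" for j
    using carriers i that by (auto simp: next_v_def)
qed (rule sum_wn[OF s])

lemma track_next:
  assumes s: "s \<in> samples"
  shows "track_err (wn s) (gn s) \<le> sigma_B B pc ^ (2 * rounds_d)
    * (2 * track_err w g + 4 * (real n * h\<^sub>c) * (grad_err (gn s) + grad_err g))"
proof -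
  let ?u = "\<lambda>i. 1 / pc $ i" and ?b = "sigma_B B pc ^ (2 * rounds_d)"
  have "track_err (wn s) (gn s) \<le> (\<Sum>q<p. ?b * (2 * wsq n ?u (\<lambda>i. w i $ q - pc $ i * (\<Sum>r<n. g r $ q))
      + 4 * (real n * h\<^sub>c) * ((\<Sum>i<n. (gn s i $ q - node_grad i xs q)\<^sup>2)
                             + (\<Sum>i<n. (g i $ q - node_grad i xs q)\<^sup>2))))"
    unfolding track_err_def
  proof (intro sum_mono)
    fix q assume q: "q \<in> {..<p}"
    then have "q < p" by simp
    show "wsq n ?u (\<lambda>i. wn s i $ q - pc $ i * (\<Sum>r<n. gn s r $ q))
      \<le> ?b * (2 * wsq n ?u (\<lambda>i. w i $ q - pc $ i * (\<Sum>r<n. g r $ q))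
      + 4 * (real n * h\<^sub>c) * ((\<Sum>i<n. (gn s i $ q - node_grad i xs q)\<^sup>2)
                             + (\<Sum>i<n. (g i $ q - node_grad i xs q)\<^sup>2)))"
      unfolding wn_coord[OF s \<open>q < p\<close>] by (rule tracking_step[OF sums[OF \<open>q < p\<close>]])
  qed
  also have "\<dots> = ?b * (2 * track_err w g + 4 * (real n * h\<^sub>c) * (grad_err (gn s) + grad_err g))"
    unfolding track_err_def grad_err_def sqn_def
    by (subst (1 2) sum.swap[of _ "{..<p}" "{..<n}"])
       (simp add: sum.distrib flip: sum_distrib_left)
  finally show ?thesis .
qed

lemma cons_next:
  assumes s: "s \<in> samples"
  shows "cons_err (yn \<alpha> s) \<le> sigma_A A pr ^ (2 * rounds_c)
    * (2 * cons_err y + 4 * \<alpha>\<^sup>2 * (track_err (wn s) (gn s) + \<rho> * real n * grad_err (gn s)))"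
proof -
  let ?u = "\<lambda>i. 1 / pc $ i" and ?b = "sigma_A A pr ^ (2 * rounds_c)"
  have "cons_err (yn \<alpha> s) \<le> (\<Sum>q<p. ?b * (2 * wsq n (($) pr) (\<lambda>i. y i $ q - mean y q)
      + 4 * \<alpha>\<^sup>2 * (wsq n ?u (\<lambda>i. wn s i $ q - pc $ i * (\<Sum>r<n. gn s r $ q))
         + \<rho> * real n * (\<Sum>i<n. (gn s i $ q - node_grad i xs q)\<^sup>2))))"
    unfolding cons_err_def
  proof (intro sum_mono)
    fix q assume "q \<in> {..<p}"
    then have q: "q < p" by simp
    show "wsq n (($) pr) (\<lambda>i. yn \<alpha> s i $ q - mean (yn \<alpha> s) q)
      \<le> ?b * (2 * wsq n (($) pr) (\<lambda>i. y i $ q - mean y q)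
      + 4 * \<alpha>\<^sup>2 * (wsq n ?u (\<lambda>i. wn s i $ q - pc $ i * (\<Sum>r<n. gn s r $ q))
         + \<rho> * real n * (\<Sum>i<n. (gn s i $ q - node_grad i xs q)\<^sup>2)))"
      unfolding mean_yn[OF s q] yn_coord[OF s q] unfolding mean_def
      by (rule consensus_step[OF sum_node_grad_minimizer[OF q]])
  qed
  also have "\<dots> = ?b * (2 * cons_err y + 4 * \<alpha>\<^sup>2 * (track_err (wn s) (gn s) + \<rho> * real n * grad_err (gn s)))"
    unfolding track_err_def cons_err_def grad_err_def sqn_def
    by (subst (1) sum.swap[of _ "{..<p}" "{..<n}"])
       (simp add: sum.distrib flip: sum_distrib_left)
  finally show ?thesis .
qed

lemma node_err_le: "node_err y \<le> 2 * real n * opt_err y + 2 * (real n * h\<^sub>r) * cons_err y"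
proof -
  have "node_err y \<le> (\<Sum>i<n. 2 * sqn p (\<lambda>q. y i $ q - mean y q) + 2 * opt_err y)"
    unfolding node_err_def opt_err_def by (intro sum_mono sqn_triangle)
  also have "\<dots> = 2 * (\<Sum>q<p. \<Sum>i<n. (y i $ q - mean y q)\<^sup>2) + 2 * real n * opt_err y"
    by (subst sum.swap) (simp add: sqn_def sum.distrib flip: sum_distrib_left)
  also have "(\<Sum>q<p. \<Sum>i<n. (y i $ q - mean y q)\<^sup>2)
      \<le> (\<Sum>q<p. real n * h\<^sub>r * wsq n (($) pr) (\<lambda>i. y i $ q - mean y q))"
    using pr_pos inverse_entry_le[OF pr_carrier pr_pos pr_sum]
    by (intro sum_mono sum_square_le_wsq) auto
  finally show ?thesis
    by (simp add: cons_err_def mult.assoc flip: sum_distrib_left)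
qed

lemma table_spread_le:
  "(\<Sum>i<n. avg {..<m i} (\<lambda>j. sqn p (\<lambda>q. y i $ q - v i j $ q))) \<le> 2 * node_err y + 2 * table_err v"
proof -
  have "(\<Sum>i<n. avg {..<m i} (\<lambda>j. sqn p (\<lambda>q. y i $ q - v i j $ q)))
    \<le> (\<Sum>i<n. avg {..<m i} (\<lambda>j. 2 * sqn p (\<lambda>q. y i $ q - xs $ q) + 2 * sqn p (\<lambda>q. v i j $ q - xs $ q)))"
    by (intro sum_mono avg_mono sqn_diff_le)
  also have "\<dots> = 2 * node_err y + 2 * table_err v"
    using samples_nonempty
    by (simp add: avg_add avg_cmult avg_const node_err_def table_err_def sum.distrib sum_distrib_left)
  finally show ?thesis .
qed

text \<open>Of the coefficient 3, a part 2 comes from the spread of the table around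
  \<open>y\<close> and a part 1 from the distance of \<open>y\<close> to \<open>xs\<close>.\<close>

lemma grad_next:
  "avg (round_draws n m) (\<lambda>s. grad_err (gn s)) \<le> L\<^sup>2 * (3 * node_err y + 2 * table_err v)"
proof -
  have "avg (round_draws n m) (\<lambda>s. grad_err (gn s))
      = avg (round_draws n m) (\<lambda>s. \<Sum>i<n. sqn p (\<lambda>q. saga_estimate y v s i q - node_grad i xs q))"
    unfolding grad_err_def sqn_def by (intro avg_cong sum.cong) (auto simp: next_g_coord[OF round_draws_samples])
  also have "\<dots> = (\<Sum>i<n. avg (round_draws n m) (\<lambda>s. sqn p (\<lambda>q. saga_estimate y v s i q - node_grad i xs q)))"
    by (rule avg_sum)
  also have "\<dots> \<le> (\<Sum>i<n. L\<^sup>2 * (avg {..<m i} (\<lambda>j. sqn p (\<lambda>q. y i $ q - v i j $ q))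
      + sqn p (\<lambda>q. y i $ q - xs $ q)))"
    using carriers xs_carrier by (intro sum_mono avg_saga_error) auto
  also have "\<dots> = L\<^sup>2 * ((\<Sum>i<n. avg {..<m i} (\<lambda>j. sqn p (\<lambda>q. y i $ q - v i j $ q))) + node_err y)"
    by (simp add: node_err_def sum.distrib flip: sum_distrib_left)
  also have "\<dots> \<le> L\<^sup>2 * (3 * node_err y + 2 * table_err v)"
    using table_spread_le by (intro mult_left_mono) auto
  finally show ?thesis .
qed

text \<open>A draw overwrites each entry of node \<open>i\<close> with probability
  \<open>1 / m i\<close>: the old entries decay at least at the slowest such rate, and the new ones
  enter with at most the largest.\<close>

lemma table_next:
  "avg (round_draws n m) (\<lambda>s. table_err (vn s)) \<le> (1 - 1 / m_max) * table_err v + node_err y / m_min"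
proof -
  define b where "b i j = sqn p (\<lambda>q. v i j $ q - xs $ q)" for i j
  define a where "a i = sqn p (\<lambda>q. y i $ q - xs $ q)" for i
  have step: "avg (round_draws n m) (\<lambda>s. avg {..<m i} (\<lambda>j. sqn p (\<lambda>q. vn s i j $ q - xs $ q)))
      \<le> (1 - 1 / m_max) * avg {..<m i} (b i) + a i / m_min" if i: "i < n" for i
  proof -
    have mi: "m i > 0" "real (m i) > 0" using m_pos[OF i] by auto
    have "avg (round_draws n m) (\<lambda>s. avg {..<m i} (\<lambda>j. sqn p (\<lambda>q. vn s i j $ q - xs $ q)))
        = avg {..<m i} (\<lambda>j0. avg {..<m i} (\<lambda>j. if j = j0 then a i else b i j))"
      unfolding avg_node[OF i, symmetric, of "\<lambda>j0. avg {..<m i} (\<lambda>j. if j = j0 then a i else b i j)"]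
      by (intro avg_cong) (auto simp: next_v_def a_def b_def)
    also have "\<dots> = avg {..<m i} (\<lambda>j0. (avg {..<m i} (b i) + a i / real (m i)) - 1 / real (m i) * b i j0)"
    proof (intro avg_cong)
      fix j0 assume j0: "j0 \<in> {..<m i}"
      have "(\<Sum>j<m i. if j = j0 then a i else b i j) = (\<Sum>j<m i. b i j + (if j = j0 then a i - b i j0 else 0))"
        by (intro sum.cong) auto
      also have "\<dots> = (\<Sum>j<m i. b i j) + (a i - b i j0)"
        using j0 by (simp add: sum.distrib)
      finally show "avg {..<m i} (\<lambda>j. if j = j0 then a i else b i j)
          = (avg {..<m i} (b i) + a i / real (m i)) - 1 / real (m i) * b i j0"
        by (simp add: avg_def add_divide_distrib diff_divide_distrib)
    qed
    also have "\<dots> = avg {..<m i} (b i) + a i / real (m i) - 1 / real (m i) * avg {..<m i} (b i)"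
      using samples_nonempty[OF i] by (simp add: avg_diff avg_const avg_cmult del: times_divide_eq_left)
    also have "\<dots> \<le> avg {..<m i} (b i) + a i / m_min - 1 / m_max * avg {..<m i} (b i)"
    proof (intro diff_mono add_mono mult_right_mono divide_left_mono)
      show "0 \<le> avg {..<m i} (b i)" by (intro avg_nonneg) (simp add: b_def)
    qed (use sizes i mi in \<open>auto simp: a_def\<close>)
    finally show ?thesis by (simp add: algebra_simps)
  qed
  have "avg (round_draws n m) (\<lambda>s. table_err (vn s))
      = (\<Sum>i<n. avg (round_draws n m) (\<lambda>s. avg {..<m i} (\<lambda>j. sqn p (\<lambda>q. vn s i j $ q - xs $ q))))"
    unfolding table_err_def by (rule avg_sum)
  also have "\<dots> \<le> (\<Sum>i<n. (1 - 1 / m_max) * avg {..<m i} (b i) + a i / m_min)"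
    using step by (intro sum_mono) auto
  also have "\<dots> = (1 - 1 / m_max) * table_err v + node_err y / m_min"
    by (simp add: table_err_def node_err_def a_def b_def[abs_def] sum.distrib sum_divide_distrib flip: sum_distrib_left)
  finally show ?thesis .
qed

text \<open>The sum of the estimates, divided by \<open>n\<close>, splits into the global gradient
  at the mean, the bias from evaluating gradients at \<open>y i\<close> instead, and centred noise.
  The recursion of the mean thereby becomes that of \<open>optimality_step\<close> with step-size
  \<open>\<alpha> * real n * \<rho>\<close>.\<close>

lemma opt_next:
  assumes th: "0 < \<alpha>" "rate \<alpha> \<le> 1 / 288" "(\<alpha> * real n * \<rho>)\<^sup>2 * L\<^sup>2 \<le> rate \<alpha> / 288"
  shows "avg (round_draws n m) (\<lambda>s. opt_err (yn \<alpha> s)) \<le> (1 - 9/10 * rate \<alpha>) * opt_err y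
    + 4 / rate \<alpha> * (\<alpha> * real n * \<rho>)\<^sup>2 * L\<^sup>2 * h\<^sub>r * cons_err y
    + 2 * (\<alpha> * real n * \<rho>)\<^sup>2 * (L\<^sup>2 / real n) * (2 * node_err y + 2 * table_err v)
    + 3 / rate \<alpha> * \<alpha>\<^sup>2 * \<rho> * avg (round_draws n m) (\<lambda>s. track_err (wn s) (gn s))"
proof -
  let ?S = "round_draws n m"
  define \<eta> where "\<eta> = \<alpha> * real n * \<rho>"
  define xh where "xh = Matrix.vec p (mean y)"
  define \<delta> where "\<delta> q = xh $ q - xs $ q" for q
  define F where "F q = (\<Sum>i<n. node_grad i xh q) / real n" for q
  define b where "b q = (\<Sum>i<n. node_grad i (y i) q - node_grad i xh q) / real n" for q
  define \<nu> where "\<nu> s q = (\<Sum>i<n. saga_estimate y v s i q - node_grad i (y i) q) / real n" for s q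
  define e where "e s q = (\<Sum>i<n. pr $ i * (wn s i $ q - pc $ i * (\<Sum>r<n. gn s r $ q)))" for s q
  have S: "finite ?S" "?S \<noteq> {}"
    using m_pos by (simp_all add: finite_round_draws round_draws_nonempty)
  have xh: "xh \<in> carrier_vec p" by (simp add: xh_def)
  have eta: "\<eta> > 0" "rate \<alpha> = \<eta> * \<mu>" "0 < rate \<alpha>"
    using th(1) n_positive pr_pc_pos mu_pos by (auto simp: \<eta>_def rate_def)
  have next_eq: "opt_err (yn \<alpha> s) = sqn p (\<lambda>q. \<delta> q - \<eta> * (F q + b q + \<nu> s q) - \<alpha> * e s q)"
    if s: "s \<in> samples" for s
    unfolding opt_err_def sqn_def
  proof (intro sum.cong refl)
    fix q assume "q \<in> {..<p}"
    then have q: "q < p" by simp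
    let ?g = "\<Sum>r<n. gn s r $ q"
    have "F q + b q + \<nu> s q = (\<Sum>i<n. saga_estimate y v s i q) / real n"
      by (simp add: F_def b_def \<nu>_def sum_subtractf add_divide_distrib[symmetric])
    also have "\<dots> = ?g / real n"
      using next_g_coord[OF s _ q] by simp
    finally have Fb: "\<eta> * (F q + b q + \<nu> s q) = \<alpha> * (\<rho> * ?g)"
      using n_positive by (simp add: \<eta>_def)
    have "(\<Sum>i<n. pr $ i * wn s i $ q) = e s q + (\<Sum>i<n. pr $ i * pc $ i) * ?g"
      unfolding e_def sum_distrib_right sum.distrib[symmetric]
      by (intro sum.cong) (auto simp: algebra_simps)
    then have "mean (yn \<alpha> s) q = mean y q - \<alpha> * (e s q + \<rho> * ?g)"
      unfolding mean_yn[OF s q] unfolding mean_def pr_pc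
      by (simp add: right_diff_distrib sum_subtractf mult.left_commute[of _ \<alpha>] flip: sum_distrib_left)
    then have "mean (yn \<alpha> s) q - xs $ q = \<delta> q - \<eta> * (F q + b q + \<nu> s q) - \<alpha> * e s q"
      unfolding Fb \<delta>_def xh_def using q by (simp add: distrib_left)
    then show "(mean (yn \<alpha> s) q - xs $ q)\<^sup>2 = (\<delta> q - \<eta> * (F q + b q + \<nu> s q) - \<alpha> * e s q)\<^sup>2"
      by simp
  qed
  have mean: "avg ?S (\<lambda>s. \<nu> s q) = 0" for q
  proof -
    have "avg ?S (\<lambda>s. \<nu> s q) = 1 / real n * (\<Sum>i<n. avg ?S (\<lambda>s. saga_estimate y v s i q - node_grad i (y i) q))"
      unfolding \<nu>_def avg_sum[symmetric] avg_cmult[symmetric] by simp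
    also have "\<dots> = 0"
      using S by (simp add: avg_diff avg_const avg_saga_estimate)
    finally show ?thesis .
  qed
  have d: "sqn p \<delta> = opt_err y"
    unfolding sqn_def opt_err_def by (intro sum.cong) (auto simp: \<delta>_def xh_def)
  have mono: "\<mu> * sqn p \<delta> \<le> (\<Sum>q<p. F q * \<delta> q)"
    using strong_monotone[OF xh] unfolding \<delta>_def F_def .
  have lip: "sqn p F \<le> L\<^sup>2 * sqn p \<delta>"
  proof -
    have "sqn p F = sqn p (\<lambda>q. (\<Sum>i<n. node_grad i xh q - node_grad i xs q) / real n)"
      unfolding sqn_def using sum_node_grad_minimizer by (intro sum.cong) (auto simp: F_def sum_subtractf)
    also have "\<dots> \<le> 1 / real n * (\<Sum>i<n. sqn p (\<lambda>q. node_grad i xh q - node_grad i xs q))"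
      by (rule sqn_average_le)
    also have "\<dots> \<le> 1 / real n * (\<Sum>i<n. L\<^sup>2 * sqn p \<delta>)"
      unfolding \<delta>_def using xh xs_carrier by (intro mult_left_mono sum_mono node_grad_lipschitz) auto
    also have "\<dots> = L\<^sup>2 * sqn p \<delta>" using n_pos by simp
    finally show ?thesis .
  qed
  have bias: "sqn p b \<le> L\<^sup>2 * h\<^sub>r * cons_err y"
  proof -
    have "sqn p b \<le> 1 / real n * (\<Sum>i<n. sqn p (\<lambda>q. node_grad i (y i) q - node_grad i xh q))"
      unfolding b_def by (rule sqn_average_le)
    also have "\<dots> \<le> 1 / real n * (\<Sum>i<n. L\<^sup>2 * sqn p (\<lambda>q. y i $ q - xh $ q))"
      using xh carriers by (intro mult_left_mono sum_mono node_grad_lipschitz) auto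
    also have "\<dots> = 1 / real n * L\<^sup>2 * (\<Sum>q<p. \<Sum>i<n. (y i $ q - mean y q)\<^sup>2)"
      by (subst sum.swap) (simp add: sqn_def xh_def flip: sum_distrib_left)
    also have "\<dots> \<le> 1 / real n * L\<^sup>2 * (\<Sum>q<p. real n * h\<^sub>r * wsq n (($) pr) (\<lambda>i. y i $ q - mean y q))"
      using pr_pos inverse_entry_le[OF pr_carrier pr_pos pr_sum]
      by (intro mult_left_mono sum_mono sum_square_le_wsq) auto
    also have "\<dots> = L\<^sup>2 * h\<^sub>r * cons_err y"
      using n_pos by (simp add: cons_err_def flip: sum_distrib_left)
    finally show ?thesis .
  qed
  have noise: "avg ?S (\<lambda>s. sqn p (\<nu> s)) \<le> L\<^sup>2 / real n * (2 * node_err y + 2 * table_err v)"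
  proof -
    have "avg ?S (\<lambda>s. sqn p (\<nu> s))
        \<le> avg ?S (\<lambda>s. 1 / real n * (\<Sum>i<n. sqn p (\<lambda>q. saga_estimate y v s i q - node_grad i (y i) q)))"
      unfolding \<nu>_def by (intro avg_mono sqn_average_le)
    also have "\<dots> = 1 / real n * (\<Sum>i<n. avg ?S (\<lambda>s. sqn p (\<lambda>q. saga_estimate y v s i q - node_grad i (y i) q)))"
      by (simp add: avg_cmult avg_sum del: times_divide_eq_left)
    \<comment> \<open>With \<open>y i\<close> itself as reference point the bias term is 0 and the
      pure variance remains.\<close>
    also have "\<dots> \<le> 1 / real n * (\<Sum>i<n. L\<^sup>2 * (avg {..<m i} (\<lambda>j. sqn p (\<lambda>q. y i $ q - v i j $ q))
        + sqn p (\<lambda>q. y i $ q - y i $ q)))"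
      using carriers by (intro mult_left_mono sum_mono avg_saga_error) auto
    also have "\<dots> = L\<^sup>2 / real n * (\<Sum>i<n. avg {..<m i} (\<lambda>j. sqn p (\<lambda>q. y i $ q - v i j $ q)))"
      by (simp add: sqn_def[of p "\<lambda>_. 0"] flip: sum_distrib_left)
    also have "\<dots> \<le> L\<^sup>2 / real n * (2 * node_err y + 2 * table_err v)"
      using table_spread_le by (intro mult_left_mono) auto
    finally show ?thesis .
  qed
  have track: "avg ?S (\<lambda>s. sqn p (e s)) \<le> \<rho> * avg ?S (\<lambda>s. track_err (wn s) (gn s))"
    unfolding avg_cmult[symmetric]
  proof (intro avg_mono)
    fix s
    show "sqn p (e s) \<le> \<rho> * track_err (wn s) (gn s)"
      unfolding sqn_def e_def track_err_def sum_distrib_left by (intro sum_mono tracking_error_mean)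
  qed
  have "avg ?S (\<lambda>s. opt_err (yn \<alpha> s))
      = avg ?S (\<lambda>s. sqn p (\<lambda>q. \<delta> q - \<eta> * (F q + b q + \<nu> s q) - \<alpha> * e s q))"
    by (intro avg_cong next_eq round_draws_samples)
  also have "\<dots> \<le> (1 - 9/10 * rate \<alpha>) * sqn p \<delta> + 4 / rate \<alpha> * \<eta>\<^sup>2 * sqn p b
      + 2 * \<eta>\<^sup>2 * avg ?S (\<lambda>s. sqn p (\<nu> s)) + 3 / rate \<alpha> * \<alpha>\<^sup>2 * avg ?S (\<lambda>s. sqn p (e s))"
    using S mean mono lip eta th(2,3) by (intro optimality_step) (auto simp: \<eta>_def)
  also have "\<dots> \<le> (1 - 9/10 * rate \<alpha>) * opt_err y + 4 / rate \<alpha> * \<eta>\<^sup>2 * (L\<^sup>2 * h\<^sub>r * cons_err y)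
      + 2 * \<eta>\<^sup>2 * (L\<^sup>2 / real n * (2 * node_err y + 2 * table_err v))
      + 3 / rate \<alpha> * \<alpha>\<^sup>2 * (\<rho> * avg ?S (\<lambda>s. track_err (wn s) (gn s)))"
    unfolding d using bias noise track eta by (intro add_mono mult_left_mono order_refl) auto
  finally show ?thesis
    unfolding \<eta>_def by (simp only: mult.assoc)
qed

end
end

subsection \<open>Communication rounds and step-size\<close>

lemma power_ceiling_le:
  fixes s a :: real
  assumes s: "0 < s" "s < 1" and a: "1 < a"
  defines "k \<equiv> nat \<lceil>ln a / ln (1 / s)\<rceil>"
  shows "1 \<le> k" "s ^ k \<le> 1 / a"
proof -
  have l: "0 < ln (1 / s)" "0 < ln a" using s a by auto
  have "0 < ln a / ln (1 / s)" using l by simp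
  then show "1 \<le> k" unfolding k_def by (simp add: Suc_le_eq)
  have "ln a / ln (1 / s) \<le> real k"
    unfolding k_def by (rule real_nat_ceiling_ge)
  then have "ln a \<le> real k * ln (1 / s)"
    using l by (simp add: pos_divide_le_eq)
  also have "\<dots> = ln ((1 / s) ^ k)"
    using s by (simp add: ln_realpow)
  finally have "a \<le> (1 / s) ^ k"
    using s a by (subst (asm) ln_le_cancel_iff) auto
  then have "s ^ k * a \<le> s ^ k * (1 / s) ^ k"
    using s by (intro mult_left_mono) auto
  also have "\<dots> = 1" using s by (simp flip: power_mult_distrib)
  finally show "s ^ k \<le> 1 / a"
    using a by (simp add: pos_le_divide_eq)
qed

context saga_network
begin

lemma kappa_ge_1: "1 \<le> L / \<mu>"
  using mu_le_L mu_pos by simp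

text \<open>The argument of the logarithm exceeds 1, so at least one round is made; this keeps the
  factor \<open>1 - sigma_B B pc ^ (2 * rounds_d)\<close> in the formula for \<open>rounds_c\<close>
  positive. The bound is the squared reciprocal of that argument.\<close>

lemma mixing_B:
  "1 \<le> rounds_d"
  "sigma_B B pc ^ (2 * rounds_d) \<le> \<rho>\<^sup>2 * m_min * \<mu>\<^sup>2 / (1265\<^sup>2 * L\<^sup>2 * real n * m_max * h\<^sub>c)"
proof -
  define a where "a = 1265 * (L / \<mu>) / \<rho> * sqrt (real n * m_max * h\<^sub>c / m_min)"
  have pos: "0 < m_min" "0 < m_max" "0 < h\<^sub>c" "0 < real n" "0 < \<rho>" "0 < L" "0 < \<mu>"
    using sizes(3,4) ratios_ge_1 n_positive pr_pc_pos L_pos mu_pos by auto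
  have "1 \<le> real n * m_max * h\<^sub>c / m_min"
  proof -
    have "1 * m_min * 1 \<le> real n * m_max * h\<^sub>c"
      using n_pos sizes(4) ratios_ge_1 pos by (intro mult_mono) auto
    then show ?thesis using pos by simp
  qed
  then have "1 \<le> sqrt (real n * m_max * h\<^sub>c / m_min)" by simp
  moreover have "1265 \<le> 1265 * (L / \<mu>) / \<rho>"
  proof -
    have "1265 * \<rho> \<le> 1265 * (L / \<mu>)" using kappa_ge_1 pr_pc_le_1 by linarith
    then show ?thesis using pos by (subst pos_le_divide_eq) auto
  qed
  ultimately have "1265 * 1 \<le> a"
    unfolding a_def by (intro mult_mono) auto
  then have a: "1 < a" by simp
  have r: "rounds_d = nat \<lceil>ln a / ln (1 / sigma_B B pc)\<rceil>"
    by (simp add: rounds_B_def d_bar_def a_def)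
  show "1 \<le> rounds_d"
    unfolding r using sigma_B a by (intro power_ceiling_le) auto
  have "sigma_B B pc ^ rounds_d \<le> 1 / a"
    unfolding r using sigma_B a by (intro power_ceiling_le) auto
  then have "(sigma_B B pc ^ rounds_d)\<^sup>2 \<le> (1 / a)\<^sup>2"
    using sigma_B by (intro power_mono) auto
  also have "(1 / a)\<^sup>2 = \<rho>\<^sup>2 * m_min * \<mu>\<^sup>2 / (1265\<^sup>2 * L\<^sup>2 * real n * m_max * h\<^sub>c)"
    using pos by (simp add: a_def power_divide power_mult_distrib mult_ac)
  finally show "sigma_B B pc ^ (2 * rounds_d) \<le> \<rho>\<^sup>2 * m_min * \<mu>\<^sup>2 / (1265\<^sup>2 * L\<^sup>2 * real n * m_max * h\<^sub>c)"
    by (simp add: power_mult mult.commute[of 2])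
qed

lemma mixing_A:
  "sigma_A A pr ^ (2 * rounds_c)
    \<le> m_min\<^sup>2 * \<rho> * \<mu>\<^sup>2 / (90512\<^sup>2 * (real n)\<^sup>2 * m_max\<^sup>2 * L\<^sup>2 * h\<^sub>r * h\<^sub>c)"
proof -
  define b where "b = 1 - sigma_B B pc ^ (2 * rounds_d)"
  define a where "a = 90512 * real n * m_max * (L / \<mu>) / (m_min * b) * sqrt (h\<^sub>r * h\<^sub>c / \<rho>)"
  \<comment> \<open>\<open>a\<close> equals \<open>a0 / b\<close> with \<open>0 < b \<le> 1\<close>,
    so \<open>a0 \<le> a\<close> and the decay bound can be stated without
    \<open>sigma_B\<close>.\<close>
  define a0 where "a0 = 90512 * real n * m_max * (L / \<mu>) / m_min * sqrt (h\<^sub>r * h\<^sub>c / \<rho>)"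
  have pos: "0 < m_min" "0 < m_max" "0 < h\<^sub>r" "0 < h\<^sub>c" "0 < real n" "0 < \<rho>" "0 < L" "0 < \<mu>"
    using sizes(3,4) ratios_ge_1 n_positive pr_pc_pos L_pos mu_pos by auto
  have b: "0 < b" "b \<le> 1"
    using sigma_B mixing_B(1) by (auto simp: b_def power_less_one_iff)
  have "1 \<le> h\<^sub>r * h\<^sub>c / \<rho>"
  proof -
    have "\<rho> \<le> 1 * 1" using pr_pc_le_1 by simp
    also have "\<dots> \<le> h\<^sub>r * h\<^sub>c" using ratios_ge_1 by (intro mult_mono) auto
    finally show ?thesis using pos by simp
  qed
  then have "1 \<le> sqrt (h\<^sub>r * h\<^sub>c / \<rho>)" by simp
  moreover have "90512 \<le> 90512 * real n * m_max * (L / \<mu>) / m_min"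
  proof -
    have "90512 * 1 * m_min * 1 \<le> 90512 * real n * m_max * (L / \<mu>)"
      using kappa_ge_1 n_pos sizes(4) pos by (intro mult_mono) auto
    then show ?thesis using pos by (subst pos_le_divide_eq) auto
  qed
  ultimately have "90512 * 1 \<le> a0"
    unfolding a0_def by (intro mult_mono) auto
  then have a0: "1 < a0" by simp
  have "a = a0 / b" by (simp add: a_def a0_def)
  moreover have "a0 * b \<le> a0 * 1"
    using a0 b by (intro mult_left_mono) auto
  ultimately have a: "a0 \<le> a"
    using b by (simp add: pos_le_divide_eq)
  have r: "rounds_c = nat \<lceil>ln a / ln (1 / sigma_A A pr)\<rceil>"
    by (simp add: rounds_A_def c_bar_def a_def b_def)
  have "sigma_A A pr ^ rounds_c \<le> 1 / a"
    unfolding r using sigma_A a a0 by (intro power_ceiling_le) auto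
  also have "\<dots> \<le> 1 / a0" using a a0 by (intro divide_left_mono) auto
  finally have "(sigma_A A pr ^ rounds_c)\<^sup>2 \<le> (1 / a0)\<^sup>2"
    using sigma_A by (intro power_mono) auto
  also have "(1 / a0)\<^sup>2 = m_min\<^sup>2 * \<rho> * \<mu>\<^sup>2 / (90512\<^sup>2 * (real n)\<^sup>2 * m_max\<^sup>2 * L\<^sup>2 * h\<^sub>r * h\<^sub>c)"
    using pos by (simp add: a0_def power_divide power_mult_distrib mult_ac)
  finally show ?thesis
    by (simp add: power_mult mult.commute[of 2])
qed

abbreviation "\<alpha>\<^sub>m\<^sub>a\<^sub>x \<equiv> alpha_bar n m L \<mu> pr pc"

lemma alpha_bar_pos: "0 < \<alpha>\<^sub>m\<^sub>a\<^sub>x"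
proof -
  have "0 < m_min" "0 < m_max" "0 < h\<^sub>r" "0 < h\<^sub>c" "0 < real n" "0 < \<rho>" "0 < L" "0 < \<mu>"
    using sizes(3,4) ratios_ge_1 n_positive pr_pc_pos L_pos mu_pos by auto
  then show ?thesis by (simp add: alpha_bar_def)
qed

text \<open>The first bound comes from the first entry of the minimum and entry ratios at least 1,
  the others from the second entry together with m \<le> M and \<open>\<mu> \<le> L\<close>.\<close>

lemma step_size_bounds:
  assumes \<alpha>: "0 < \<alpha>" "\<alpha> \<le> \<alpha>\<^sub>m\<^sub>a\<^sub>x"
  shows "\<alpha> * L \<le> 1 / 35" "288 * m_max * (\<alpha> * real n * \<rho>) * L\<^sup>2 \<le> m_min * \<mu>"
    "rate \<alpha> \<le> 1 / 288" "(\<alpha> * real n * \<rho>)\<^sup>2 * L\<^sup>2 \<le> rate \<alpha> / 288"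
proof -
  have pos: "0 < m_min" "0 < m_max" "0 < h\<^sub>r" "0 < h\<^sub>c" "0 < real n" "0 < \<rho>" "0 < L" "0 < \<mu>"
    using sizes(3,4) ratios_ge_1 n_positive pr_pc_pos L_pos mu_pos by auto
  have a1: "\<alpha> \<le> 1 / (35 * L * sqrt (h\<^sub>r * h\<^sub>c))"
    and a2: "\<alpha> \<le> m_min / (288 * m_max * real n * (L / \<mu>) * L * \<rho>)"
    using \<alpha>(2) by (auto simp: alpha_bar_def)
  have "1 * 1 \<le> h\<^sub>r * h\<^sub>c" using ratios_ge_1 by (intro mult_mono) auto
  then have s: "1 \<le> sqrt (h\<^sub>r * h\<^sub>c)" by simp
  have "35 * L * sqrt (h\<^sub>r * h\<^sub>c) * \<alpha> \<le> 1"
    using a1 pos by (simp add: pos_le_divide_eq mult.commute)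
  moreover have "35 * L * \<alpha> * 1 \<le> 35 * L * \<alpha> * sqrt (h\<^sub>r * h\<^sub>c)"
    using s pos \<alpha> by (intro mult_left_mono) auto
  ultimately show "\<alpha> * L \<le> 1 / 35" by (simp add: mult_ac)
  have "\<alpha> * (288 * m_max * real n * (L / \<mu>) * L * \<rho>) \<le> m_min"
    using a2 pos by (subst (asm) pos_le_divide_eq) auto
  then have "\<alpha> * (288 * m_max * real n * (L / \<mu>) * L * \<rho>) * \<mu> \<le> m_min * \<mu>"
    using pos by (intro mult_right_mono) auto
  moreover have "\<alpha> * (288 * m_max * real n * (L / \<mu>) * L * \<rho>) * \<mu> = 288 * m_max * (\<alpha> * real n * \<rho>) * L\<^sup>2"
    using pos by (simp add: power2_eq_square)
  ultimately show step2: "288 * m_max * (\<alpha> * real n * \<rho>) * L\<^sup>2 \<le> m_min * \<mu>" by simp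
  define \<eta> where "\<eta> = \<alpha> * real n * \<rho>"
  have eta: "0 < \<eta>" "rate \<alpha> = \<eta> * \<mu>" using pos \<alpha> by (auto simp: \<eta>_def rate_def)
  have "m_max * (288 * \<eta> * L\<^sup>2) \<le> m_max * \<mu>"
  proof -
    have "m_max * (288 * \<eta> * L\<^sup>2) = 288 * m_max * (\<alpha> * real n * \<rho>) * L\<^sup>2"
      by (simp add: \<eta>_def)
    also note step2
    also have "m_min * \<mu> \<le> m_max * \<mu>"
      using sizes(4) pos by (intro mult_right_mono) auto
    finally show ?thesis .
  qed
  then have e: "\<eta> * L\<^sup>2 \<le> \<mu> / 288"
    using pos by (subst (asm) mult_le_cancel_left_pos) auto
  then have "\<eta> * (\<eta> * L\<^sup>2) \<le> \<eta> * (\<mu> / 288)"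
    using eta by (intro mult_left_mono) auto
  then show "(\<alpha> * real n * \<rho>)\<^sup>2 * L\<^sup>2 \<le> rate \<alpha> / 288"
    unfolding eta(2) \<eta>_def[symmetric] by (simp add: power2_eq_square)
  have "\<eta> * \<mu>\<^sup>2 \<le> \<eta> * L\<^sup>2"
    using eta pos mu_le_L by (intro mult_left_mono power_mono) auto
  also have "\<dots> \<le> 1 / 288 * \<mu>" using e by simp
  finally have "rate \<alpha> * \<mu> \<le> 1 / 288 * \<mu>"
    by (simp add: eta(2) power2_eq_square)
  then show "rate \<alpha> \<le> 1 / 288" using pos by (simp only: mult_le_cancel_right_pos)
qed

definition gap :: "real \<Rightarrow> real" where
  "gap \<alpha> = min (rate \<alpha> / 4) (1 / (2 * m_max))"

lemma err_nonneg:
  "0 \<le> opt_err y" "0 \<le> cons_err y" "0 \<le> table_err v" "0 \<le> track_err w g" "0 \<le> grad_err g" "0 \<le> node_err y"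
  using pr_pos pc_pos
  by (auto simp: opt_err_def cons_err_def table_err_def track_err_def grad_err_def node_err_def
    less_imp_le intro!: sum_nonneg wsq_nonneg avg_nonneg)

text \<open>The tracking and disagreement bounds hold for every single draw and are linear in the
  new errors, so they pass to the averages; the other three bounds hold only on average.
  \<open>lyapunov_contraction\<close> then combines the averages as plain numbers.\<close>

lemma lyapunov_step:
  assumes valid: "valid_state y w g v" and \<alpha>: "0 < \<alpha>" "\<alpha> \<le> \<alpha>\<^sub>m\<^sub>a\<^sub>x"
  shows "avg (round_draws n m) (\<lambda>s. lyapunov \<alpha> (next_x \<alpha> y (next_w w g (next_g y v s)))
      (next_w w g (next_g y v s)) (next_g y v s) (next_v y v s))
    \<le> (1 - gap \<alpha>) * lyapunov \<alpha> y w g v"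
proof -
  let ?S = "round_draws n m"
  let ?g = "next_g y v" and ?w = "\<lambda>s. next_w w g (next_g y v s)"
  let ?y = "\<lambda>s. next_x \<alpha> y (next_w w g (next_g y v s))" and ?v = "next_v y v"
  let ?b = "sigma_B B pc ^ (2 * rounds_d)" and ?a = "sigma_A A pr ^ (2 * rounds_c)"
  have S: "finite ?S" "?S \<noteq> {}"
    using m_pos by (simp_all add: finite_round_draws round_draws_nonempty)
  define W' where "W' = avg ?S (\<lambda>s. track_err (?w s) (?g s))"
  define G' where "G' = avg ?S (\<lambda>s. grad_err (?g s))"
  define D' where "D' = avg ?S (\<lambda>s. opt_err (?y s))"
  define X' where "X' = avg ?S (\<lambda>s. cons_err (?y s))"
  define T' where "T' = avg ?S (\<lambda>s. table_err (?v s))"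
  have W': "W' \<le> ?b * (2 * track_err w g + 4 * (real n * h\<^sub>c) * (G' + grad_err g))"
  proof -
    have "W' \<le> avg ?S (\<lambda>s. ?b * (2 * track_err w g + 4 * (real n * h\<^sub>c) * (grad_err (?g s) + grad_err g)))"
      unfolding W'_def by (intro avg_mono track_next[OF valid] round_draws_samples)
    also have "\<dots> = ?b * (2 * track_err w g + 4 * (real n * h\<^sub>c) * (G' + grad_err g))"
      unfolding avg_cmult avg_add avg_const[OF S] G'_def ..
    finally show ?thesis .
  qed
  have X': "X' \<le> ?a * (2 * cons_err y + 4 * \<alpha>\<^sup>2 * (W' + \<rho> * real n * G'))"
  proof -
    have "X' \<le> avg ?S (\<lambda>s. ?a * (2 * cons_err y
        + 4 * \<alpha>\<^sup>2 * (track_err (?w s) (?g s) + \<rho> * real n * grad_err (?g s))))"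
      unfolding X'_def by (intro avg_mono cons_next[OF valid] round_draws_samples)
    also have "\<dots> = ?a * (2 * cons_err y + 4 * \<alpha>\<^sup>2 * (W' + \<rho> * real n * G'))"
      unfolding avg_cmult avg_add avg_const[OF S] G'_def W'_def ..
    finally show ?thesis .
  qed
  have nn: "0 \<le> W'" "0 \<le> G'"
    unfolding W'_def G'_def by (auto intro!: avg_nonneg err_nonneg)
  have "avg ?S (\<lambda>s. lyapunov \<alpha> (?y s) (?w s) (?g s) (?v s))
      = real n * D' + rate \<alpha> * m_min / 4 * T' + 2 * (real n * h\<^sub>r) * X' + 3 * \<alpha> / \<mu> * W'
        + rate \<alpha> * m_min / (160 * m_max * L\<^sup>2) * G'"
    unfolding lyapunov_def avg_add avg_cmult D'_def T'_def X'_def W'_def G'_def ..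
  also have "\<dots> \<le> (1 - gap \<alpha>) * lyapunov \<alpha> y w g v"
    unfolding lyapunov_def gap_def rate_def
  proof (rule lyapunov_contraction[where \<beta> = ?b and \<tau> = ?a and \<rho> = \<rho> and hc = "h\<^sub>c" and Y = "node_err y"])
    show "W' \<le> ?b * (2 * track_err w g + 4 * (real n * h\<^sub>c) * (G' + grad_err g))" by (rule W')
    show "X' \<le> ?a * (2 * cons_err y + 4 * \<alpha>\<^sup>2 * (W' + \<rho> * real n * G'))" by (rule X')
    show "G' \<le> L\<^sup>2 * (3 * node_err y + 2 * table_err v)"
      unfolding G'_def by (rule grad_next[OF valid])
    show "T' \<le> (1 - 1 / m_max) * table_err v + node_err y / m_min"
      unfolding T'_def by (rule table_next[OF valid])
    show "D' \<le> (1 - 9/10 * (\<alpha> * real n * \<rho> * \<mu>)) * opt_err y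
        + 4 / (\<alpha> * real n * \<rho> * \<mu>) * (\<alpha> * real n * \<rho>)\<^sup>2 * L\<^sup>2 * h\<^sub>r * cons_err y
        + 2 * (\<alpha> * real n * \<rho>)\<^sup>2 * (L\<^sup>2 / real n) * (2 * node_err y + 2 * table_err v)
        + 3 / (\<alpha> * real n * \<rho> * \<mu>) * \<alpha>\<^sup>2 * \<rho> * W'"
      using opt_next[OF valid \<alpha>(1) step_size_bounds(3,4)[OF \<alpha>]]
      unfolding D'_def W'_def rate_def .
    show "node_err y \<le> 2 * real n * opt_err y + 2 * (real n * h\<^sub>r) * cons_err y"
      by (rule node_err_le[OF valid])
  qed (use \<alpha> nn err_nonneg sizes(3,4) ratios_ge_1 n_pos pr_pc_pos pr_pc_le_1 mu_pos mu_le_L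
      mixing_A mixing_B(2) step_size_bounds[OF \<alpha>] sigma_A sigma_B in auto)
  finally show ?thesis .
qed

end

subsection \<open>Runs of the algorithm\<close>

context saga_network
begin

abbreviation "run \<equiv> ab_saga n p m f A B rounds_c rounds_d"

lemma run_Suc:
  assumes "run \<alpha> x0 \<omega> k = (x, w, g, v)" and "\<And>i. s i = \<omega> (Suc k, i)"
  defines "y \<equiv> next_x \<alpha> x w"
  shows "run \<alpha> x0 \<omega> (Suc k) = (y, next_w w g (next_g y v s), next_g y v s, next_v y v s)"
proof -
  have "s = (\<lambda>i. \<omega> (Suc k, i))" using assms(2) by auto
  then show ?thesis
    using assms(1) by (simp add: Let_def y_def next_x_def next_w_def next_g_def next_v_def)
qed

lemma valid_next_x:
  "valid_state x w g v \<Longrightarrow> valid_state (next_x \<alpha> x w) w g v"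
  unfolding valid_state_def by (auto intro!: next_x_carrier)

lemma valid_step:
  assumes valid: "valid_state y w g v" and s: "s \<in> samples"
  shows "valid_state y (next_w w g (next_g y v s)) (next_g y v s) (next_v y v s)"
  using valid_next[OF valid s] valid unfolding valid_state_def by auto

lemma run_valid:
  assumes x0: "\<And>i. i < n \<Longrightarrow> x0 i \<in> carrier_vec p"
    and "\<And>l i. 1 \<le> l \<Longrightarrow> l \<le> k \<Longrightarrow> i < n \<Longrightarrow> \<omega> (l, i) < m i"
    and "run \<alpha> x0 \<omega> k = (x, w, g, v)"
  shows "valid_state x w g v"
  using assms(2,3)
proof (induction k arbitrary: x w g v)
  case 0
  then show ?case
    using x0 by (auto simp: valid_state_def grad_node)
next
  case (Suc k)
  obtain x' w' g' v' where st: "run \<alpha> x0 \<omega> k = (x', w', g', v')"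
    by (metis prod_cases4)
  have "valid_state (next_x \<alpha> x' w') w' g' v'"
    using Suc.IH[OF _ st] Suc.prems(1) by (intro valid_next_x) auto
  then show ?case
    using run_Suc[OF st, of "\<lambda>i. \<omega> (Suc k, i)"] Suc.prems valid_step[of _ w' g' v' "\<lambda>i. \<omega> (Suc k, i)"]
    by auto
qed

text \<open>Mixing reads only the nodes below \<open>n\<close>, so agreement there makes the two
  functions equal at every index. Validity supplies the carrier facts that allow a comparison by
  coordinates.\<close>

lemma next_x_cong:
  assumes "valid_state x w g v" "valid_state x' w' g' v'" "\<And>i. i < n \<Longrightarrow> x i = x' i \<and> w i = w' i"
  shows "next_x \<alpha> x w = next_x \<alpha> x' w'"
proof
  fix i
  have c: "x i \<in> carrier_vec p" "w i \<in> carrier_vec p" "x' i \<in> carrier_vec p" "w' i \<in> carrier_vec p" if "i < n" for i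
    using that assms(1,2) by (auto simp: valid_state_def)
  show "next_x \<alpha> x w i = next_x \<alpha> x' w' i"
  proof (rule eq_vecI)
    have d: "next_x \<alpha> x w i \<in> carrier_vec p" "next_x \<alpha> x' w' i \<in> carrier_vec p"
      using c by (auto intro!: next_x_carrier)
    then show "dim_vec (next_x \<alpha> x w i) = dim_vec (next_x \<alpha> x' w' i)" by auto
    fix q assume "q < dim_vec (next_x \<alpha> x' w' i)"
    then have q: "q < p" using d by auto
    show "next_x \<alpha> x w i $ q = next_x \<alpha> x' w' i $ q"
      using next_x_coord[OF c(1,2) q] next_x_coord[OF c(3,4) q] assms(3) by (auto intro!: mv_cong)
  qed
qed

lemma next_w_cong:
  assumes "\<And>i. i < n \<Longrightarrow> w i \<in> carrier_vec p \<and> g i \<in> carrier_vec p \<and> h i \<in> carrier_vec p"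
    and "\<And>i. i < n \<Longrightarrow> w i = w' i \<and> g i = g' i \<and> h i = h' i"
  shows "next_w w g h = next_w w' g' h'"
proof
  fix i
  have c: "w' i \<in> carrier_vec p \<and> g' i \<in> carrier_vec p \<and> h' i \<in> carrier_vec p" if "i < n" for i
    using assms that by metis
  show "next_w w g h i = next_w w' g' h' i"
  proof (rule eq_vecI)
    have d: "next_w w g h i \<in> carrier_vec p" "next_w w' g' h' i \<in> carrier_vec p"
      using c assms(1) by (auto intro!: next_w_carrier)
    then show "dim_vec (next_w w g h i) = dim_vec (next_w w' g' h' i)" by auto
    fix q assume "q < dim_vec (next_w w' g' h' i)"
    then have q: "q < p" using d by auto
    show "next_w w g h i $ q = next_w w' g' h' i $ q"
      using next_w_coord[OF assms(1) q] next_w_coord[OF c q] assms(2) by (auto intro!: mv_cong)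
  qed
qed

text \<open>Restricting a sample to the first rounds also alters it at nodes from \<open>n\<close>
  on, so agreement of the states is claimed only below \<open>n\<close>.\<close>

lemma run_cong:
  assumes x0: "\<And>i. i < n \<Longrightarrow> x0 i \<in> carrier_vec p"
    and "\<And>l i. 1 \<le> l \<Longrightarrow> l \<le> k \<Longrightarrow> i < n \<Longrightarrow> \<omega> (l, i) < m i \<and> \<omega>' (l, i) = \<omega> (l, i)"
    and "run \<alpha> x0 \<omega> k = (x, w, g, v)" "run \<alpha> x0 \<omega>' k = (x', w', g', v')" "i < n"
  shows "x i = x' i \<and> w i = w' i \<and> g i = g' i \<and> v i = v' i"
  using assms(2-5)
proof (induction k arbitrary: x w g v x' w' g' v' i)
  case 0
  then show ?case by auto
next
  case (Suc k)
  obtain x1 w1 g1 v1 where st: "run \<alpha> x0 \<omega> k = (x1, w1, g1, v1)"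
    by (metis prod_cases4)
  obtain x2 w2 g2 v2 where st': "run \<alpha> x0 \<omega>' k = (x2, w2, g2, v2)"
    by (metis prod_cases4)
  define s s' where "s i = \<omega> (Suc k, i)" and "s' i = \<omega>' (Suc k, i)" for i
  have IH: "x1 i = x2 i \<and> w1 i = w2 i \<and> g1 i = g2 i \<and> v1 i = v2 i" if "i < n" for i
    using Suc.IH[OF _ st st' that] Suc.prems(1) by auto
  have v: "valid_state x1 w1 g1 v1" "valid_state x2 w2 g2 v2"
    using run_valid[OF x0 _ st] run_valid[OF x0 _ st'] Suc.prems(1) by auto
  have s: "s \<in> samples" "\<And>i. i < n \<Longrightarrow> s' i = s i"
    using Suc.prems(1) by (auto simp: s_def s'_def)
  define y where "y = next_x \<alpha> x1 w1"
  have y: "next_x \<alpha> x2 w2 = y"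
    unfolding y_def using IH v by (intro next_x_cong[symmetric]) auto
  have vy: "valid_state y w1 g1 v1"
    using valid_next_x[OF v(1)] by (simp add: y_def)
  have g: "next_g y v1 s i = next_g y v2 s' i" if "i < n" for i
    using IH[OF that] s(2)[OF that] by (simp add: next_g_def)
  have w: "next_w w1 g1 (next_g y v1 s) = next_w w2 g2 (next_g y v2 s')"
    using carriers(2,3)[OF vy] next_g_carrier[OF vy s(1)] IH g by (intro next_w_cong) auto
  have "next_v y v1 s i = next_v y v2 s' i" if "i < n" for i
    using IH[OF that] s(2)[OF that] by (auto simp: next_v_def)
  then show ?case
    using run_Suc[OF st, of s] run_Suc[OF st', of s'] Suc.prems g w
    by (auto simp: s_def s'_def y y_def[symmetric])
qed

section \<open>Decay of the expected Lyapunov function and of the error\<close>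

definition run_lyapunov :: "real \<Rightarrow> (nat \<Rightarrow> real vec) \<Rightarrow> (nat \<times> nat \<Rightarrow> nat) \<Rightarrow> nat \<Rightarrow> real" where
  "run_lyapunov \<alpha> x0 \<omega> k = (case run \<alpha> x0 \<omega> k of (x, w, g, v) \<Rightarrow> lyapunov \<alpha> (next_x \<alpha> x w) w g v)"

lemma run_add_round:
  "l \<le> k \<Longrightarrow> run \<alpha> x0 (add_round (Suc k) \<omega> s) l = run \<alpha> x0 \<omega> l"
  by (induction l) (auto simp: add_round_def)

lemma first_draws_bound:
  "\<omega> \<in> first_draws n m k \<Longrightarrow> 1 \<le> l \<Longrightarrow> l \<le> k \<Longrightarrow> i < n \<Longrightarrow> \<omega> (l, i) < m i"
  by (auto simp: PiE_def Pi_def)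

lemma gap_bounds:
  assumes "0 < \<alpha>" shows "0 < gap \<alpha>" "gap \<alpha> \<le> 1 / 2"
proof -
  have "1 \<le> m_max" using sizes(3,4) by linarith
  then have "1 / (2 * m_max) \<le> 1 / 2" by simp
  then show "gap \<alpha> \<le> 1 / 2" by (simp add: gap_def min_le_iff_disj)
  show "0 < gap \<alpha>"
    using assms \<open>1 \<le> m_max\<close> n_positive pr_pc_pos mu_pos by (simp add: gap_def rate_def)
qed

text \<open>Averaging over the last round first contracts the conditional expectation once per
  round. The sample \<open>\<omega>'\<close> is arbitrary because the initial state ignores
  it.\<close>

lemma avg_run_lyapunov_le:
  assumes x0: "\<And>i. i < n \<Longrightarrow> x0 i \<in> carrier_vec p" and \<alpha>: "0 < \<alpha>" "\<alpha> \<le> \<alpha>\<^sub>m\<^sub>a\<^sub>x"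
  shows "avg (first_draws n m k) (\<lambda>\<omega>. run_lyapunov \<alpha> x0 \<omega> k)
    \<le> (1 - gap \<alpha>) ^ k * run_lyapunov \<alpha> x0 \<omega>' 0"
proof (induction k)
  case 0
  have "avg (first_draws n m 0) (\<lambda>\<omega>. run_lyapunov \<alpha> x0 \<omega> 0)
      = avg (first_draws n m 0) (\<lambda>\<omega>. run_lyapunov \<alpha> x0 \<omega>' 0)"
    by (intro avg_cong) (simp add: run_lyapunov_def)
  also have "\<dots> = run_lyapunov \<alpha> x0 \<omega>' 0"
    using m_pos by (intro avg_const finite_first_draws first_draws_nonempty)
  finally show ?case by simp
next
  case (Suc k)
  have step: "avg (round_draws n m) (\<lambda>s. run_lyapunov \<alpha> x0 (add_round (Suc k) \<omega> s) (Suc k))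
      \<le> (1 - gap \<alpha>) * run_lyapunov \<alpha> x0 \<omega> k" if \<omega>: "\<omega> \<in> first_draws n m k" for \<omega>
  proof -
    obtain x w g v where st: "run \<alpha> x0 \<omega> k = (x, w, g, v)"
      by (metis prod_cases4)
    let ?y = "next_x \<alpha> x w"
    have "valid_state x w g v"
      using run_valid[OF x0 _ st] first_draws_bound[OF \<omega>] by blast
    then have valid: "valid_state ?y w g v"
      by (rule valid_next_x)
    have "run_lyapunov \<alpha> x0 (add_round (Suc k) \<omega> s) (Suc k)
        = lyapunov \<alpha> (next_x \<alpha> ?y (next_w w g (next_g ?y v s))) (next_w w g (next_g ?y v s))
            (next_g ?y v s) (next_v ?y v s)" for s
    proof -
      have "run \<alpha> x0 (add_round (Suc k) \<omega> s) k = (x, w, g, v)"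
        using run_add_round[of k k] st by simp
      from run_Suc[OF this, of s] show ?thesis
        by (simp add: run_lyapunov_def add_round_def del: ab_saga.simps)
    qed
    then show ?thesis
      using lyapunov_step[OF valid \<alpha>] st by (simp add: run_lyapunov_def)
  qed
  have "avg (first_draws n m (Suc k)) (\<lambda>\<omega>. run_lyapunov \<alpha> x0 \<omega> (Suc k))
      \<le> avg (first_draws n m k) (\<lambda>\<omega>. (1 - gap \<alpha>) * run_lyapunov \<alpha> x0 \<omega> k)"
    unfolding avg_first_draws_Suc by (intro avg_mono step)
  also have "\<dots> \<le> (1 - gap \<alpha>) * ((1 - gap \<alpha>) ^ k * run_lyapunov \<alpha> x0 \<omega>' 0)"
    unfolding avg_cmult using Suc gap_bounds[OF \<alpha>(1)] by (intro mult_left_mono) auto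
  finally show ?case by simp
qed

lemma square_dist_le_lyapunov:
  assumes y: "\<And>i. i < n \<Longrightarrow> y i \<in> carrier_vec p" and i: "i < n" and \<alpha>: "0 < \<alpha>"
    and valid: "valid_state y w g v"
  shows "(vnorm (y i - xs))\<^sup>2 \<le> 2 * lyapunov \<alpha> y w g v"
proof -
  have "(vnorm (y i - xs))\<^sup>2 = sqn p (\<lambda>q. y i $ q - xs $ q)"
    using y[OF i] xs_carrier by (rule vnorm_square_minus)
  also have "\<dots> \<le> node_err y"
    unfolding node_err_def using i by (intro member_le_sum) auto
  also have "\<dots> \<le> 2 * real n * opt_err y + 2 * (real n * h\<^sub>r) * cons_err y"
    by (rule node_err_le[OF valid])
  also have "\<dots> \<le> 2 * lyapunov \<alpha> y w g v"
  proof -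
    have r: "0 \<le> rate \<alpha>" using \<alpha> pr_pc_pos mu_pos by (simp add: rate_def)
    have "0 \<le> rate \<alpha> * m_min / 4 * table_err v" "0 \<le> 3 * \<alpha> / \<mu> * track_err w g"
      "0 \<le> rate \<alpha> * m_min / (160 * m_max * L\<^sup>2) * grad_err g" "0 \<le> 2 * (real n * h\<^sub>r) * cons_err y"
      using r \<alpha> mu_pos err_nonneg ratios_ge_1
      by (auto intro!: mult_nonneg_nonneg divide_nonneg_nonneg)
    moreover have "2 * a + c \<le> 2 * (a + t + c + k + h)"
      if "0 \<le> t" "0 \<le> k" "0 \<le> h" "0 \<le> c" for a c t k h :: real
      using that unfolding distrib_left by linarith
    ultimately show ?thesis unfolding lyapunov_def mult.assoc[of 2 "real n"] by blast
  qed
  finally show ?thesis .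
qed

text \<open>The iterate with index \<open>Suc k\<close> is determined by the first \<open>k\<close>
  rounds, since mixing precedes the draw. Its error is therefore bounded by the Lyapunov value with
  index \<open>k\<close>.\<close>

lemma mean_sq_error_Suc_le:
  assumes x0: "\<And>i. i < n \<Longrightarrow> x0 i \<in> carrier_vec p" and \<alpha>: "0 < \<alpha>" and i: "i < n"
  shows "mean_sq_error n p m f A B rounds_c rounds_d \<alpha> x0 xs (Suc k) i
    \<le> 2 * avg (first_draws n m k) (\<lambda>\<omega>. run_lyapunov \<alpha> x0 \<omega> k)"
proof -
  let ?F = "\<lambda>\<omega>. (vnorm (fst (run \<alpha> x0 \<omega> (Suc k)) i - xs))\<^sup>2"
  have fst_run: "fst (run \<alpha> x0 \<omega> (Suc k)) = next_x \<alpha> x w" if "run \<alpha> x0 \<omega> k = (x, w, g, v)" for \<omega> x w g v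
    using run_Suc[OF that, of "\<lambda>i. \<omega> (Suc k, i)"] by simp
  have "mean_sq_error n p m f A B rounds_c rounds_d \<alpha> x0 xs (Suc k) i = avg (first_draws n m k) ?F"
    unfolding mean_sq_error_def
  proof (rule integral_draws)
    fix \<omega> :: "nat \<times> nat \<Rightarrow> nat"
    assume \<omega>: "\<And>l i. 1 \<le> l \<Longrightarrow> i < n \<Longrightarrow> \<omega> (l, i) < m i"
    let ?\<omega>' = "restrict \<omega> ({1..k} \<times> {..<n})"
    obtain x w g v where st: "run \<alpha> x0 \<omega> k = (x, w, g, v)"
      by (metis prod_cases4)
    obtain x' w' g' v' where st': "run \<alpha> x0 ?\<omega>' k = (x', w', g', v')"
      by (metis prod_cases4)
    have "next_x \<alpha> x' w' = next_x \<alpha> x w"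
    proof (rule next_x_cong)
      show "valid_state x' w' g' v'" using run_valid[OF x0 _ st'] \<omega> by auto
      show "valid_state x w g v" using run_valid[OF x0 _ st] \<omega> by auto
      show "x' i = x i \<and> w' i = w i" if "i < n" for i
        using run_cong[OF x0 _ st st' that] \<omega> by auto
    qed
    then show "?F ?\<omega>' = ?F \<omega>"
      unfolding fst_run[OF st] fst_run[OF st'] by simp
  qed (rule m_pos)
  also have "\<dots> \<le> avg (first_draws n m k) (\<lambda>\<omega>. 2 * run_lyapunov \<alpha> x0 \<omega> k)"
  proof (intro avg_mono)
    fix \<omega> assume \<omega>: "\<omega> \<in> first_draws n m k"
    obtain x w g v where st: "run \<alpha> x0 \<omega> k = (x, w, g, v)"
      by (metis prod_cases4)
    have "valid_state x w g v"
      using run_valid[OF x0 _ st] first_draws_bound[OF \<omega>] by blast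
    then have valid: "valid_state (next_x \<alpha> x w) w g v"
      by (rule valid_next_x)
    show "?F \<omega> \<le> 2 * run_lyapunov \<alpha> x0 \<omega> k"
      unfolding fst_run[OF st] run_lyapunov_def st
      using square_dist_le_lyapunov[OF carriers(1)[OF valid] i \<alpha> valid] by simp
  qed
  finally show ?thesis by (simp add: avg_cmult)
qed

text \<open>The Lyapunov function contains only iterates from the first one on, so the starting
  point is treated apart.\<close>

lemma mean_sq_error_0:
  "mean_sq_error n p m f A B c d \<alpha> x0 xs 0 i = (vnorm (x0 i - xs))\<^sup>2"
proof -
  have "mean_sq_error n p m f A B c d \<alpha> x0 xs 0 i = avg (first_draws n m 0) (\<lambda>_. (vnorm (x0 i - xs))\<^sup>2)"
    unfolding mean_sq_error_def using m_pos by (subst integral_draws[where k = 0]) auto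
  also have "\<dots> = (vnorm (x0 i - xs))\<^sup>2"
    by (rule avg_const[OF finite_first_draws first_draws_nonempty[OF m_pos]])
  finally show ?thesis .
qed

lemma linear_convergence:
  assumes x0: "\<And>i. i < n \<Longrightarrow> x0 i \<in> carrier_vec p" and \<alpha>: "0 < \<alpha>" "\<alpha> \<le> \<alpha>\<^sub>m\<^sub>a\<^sub>x"
  shows "\<exists>C. \<forall>i<n. \<forall>k. mean_sq_error n p m f A B rounds_c rounds_d \<alpha> x0 xs k i \<le> C * (1 - gap \<alpha>) ^ k"
proof -
  define V where "V = run_lyapunov \<alpha> x0 (\<lambda>_. 0) 0"
  \<comment> \<open>The index shift costs one factor \<open>?\<gamma>\<close>, and
    \<open>?\<gamma> \<ge> 1 / 2\<close> turns the 2 of \<open>mean_sq_error_Suc_le\<close> into 4.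
    The sum covers the starting point.\<close>
  define C where "C = 4 * V + (\<Sum>i<n. (vnorm (x0 i - xs))\<^sup>2)"
  let ?\<gamma> = "1 - gap \<alpha>"
  have \<gamma>: "1 / 2 \<le> ?\<gamma>" using gap_bounds[OF \<alpha>(1)] by simp
  \<comment> \<open>Read off from the nonnegative mean squared error of the first iterate, which is
    at most \<open>2 * V\<close>.\<close>
  have V: "0 \<le> V"
  proof -
    have "0 \<le> mean_sq_error n p m f A B rounds_c rounds_d \<alpha> x0 xs (Suc 0) 0"
      unfolding mean_sq_error_def by (intro Bochner_Integration.integral_nonneg) simp
    also have "\<dots> \<le> 2 * avg (first_draws n m 0) (\<lambda>\<omega>. run_lyapunov \<alpha> x0 \<omega> 0)"
      by (rule mean_sq_error_Suc_le[of x0, OF x0 \<alpha>(1) n_positive])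
    also have "\<dots> \<le> 2 * V"
      using avg_run_lyapunov_le[of x0, OF x0 \<alpha>, of 0 "\<lambda>_. 0"] by (simp add: V_def)
    finally show ?thesis by simp
  qed
  have "mean_sq_error n p m f A B rounds_c rounds_d \<alpha> x0 xs k i \<le> C * ?\<gamma> ^ k" if i: "i < n" for i k
  proof (cases k)
    case 0
    have "(vnorm (x0 i - xs))\<^sup>2 \<le> (\<Sum>i<n. (vnorm (x0 i - xs))\<^sup>2)"
      using i by (intro member_le_sum) auto
    then show ?thesis
      using V by (simp add: 0 mean_sq_error_0 C_def)
  next
    case (Suc k')
    have "mean_sq_error n p m f A B rounds_c rounds_d \<alpha> x0 xs k i
        \<le> 2 * avg (first_draws n m k') (\<lambda>\<omega>. run_lyapunov \<alpha> x0 \<omega> k')"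
      unfolding Suc by (rule mean_sq_error_Suc_le[of x0, OF x0 \<alpha>(1) i])
    also have "\<dots> \<le> 2 * (?\<gamma> ^ k' * V)"
      unfolding V_def by (intro mult_left_mono avg_run_lyapunov_le[of x0, OF x0 \<alpha>]) auto
    also have "\<dots> \<le> (4 * ?\<gamma>) * (?\<gamma> ^ k' * V)"
      using \<gamma> V by (intro mult_right_mono) auto
    also have "\<dots> = 4 * V * ?\<gamma> ^ k" by (simp add: Suc)
    also have "\<dots> \<le> C * ?\<gamma> ^ k"
      using \<gamma> by (intro mult_right_mono) (auto simp: C_def intro: sum_nonneg)
    finally show ?thesis .
  qed
  then show ?thesis by blast
qed

section \<open>The rate at the largest step-size and the oracle complexity\<close>

text \<open>Whichever entry of the minimum is attained, the rate is at least the reciprocal of 35,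
  288 or 9 times the corresponding term of the maximum, so 288 serves all cases. The quarter of the
  rate in \<open>gap\<close> gives 1152 = 4 * 288.\<close>

lemma gap_alpha_bar:
  defines "K \<equiv> Max {L / \<mu> * psi n pr pc, (L / \<mu>)\<^sup>2 * m_max / m_min, m_max}"
  shows "0 < K" "m_max \<le> K" "1 / (1152 * K) \<le> gap \<alpha>\<^sub>m\<^sub>a\<^sub>x"
proof -
  have pos: "0 < m_min" "0 < m_max" "0 < h\<^sub>r" "0 < h\<^sub>c" "0 < real n" "0 < \<rho>" "0 < L" "0 < \<mu>"
    using sizes(3,4) ratios_ge_1 n_positive pr_pc_pos L_pos mu_pos by auto
  have K: "L / \<mu> * psi n pr pc \<le> K" "(L / \<mu>)\<^sup>2 * m_max / m_min \<le> K" "m_max \<le> K"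
    unfolding K_def by auto
  show "m_max \<le> K" "0 < K" using K(3) pos by auto
  define S where "S = sqrt (h\<^sub>r * h\<^sub>c)"
  have S: "0 < S" using pos by (simp add: S_def)
  have inv: "1 / (288 * K) \<le> 1 / (288 * b)" if "0 < b" "b \<le> K" for b
    using that by (intro divide_left_mono) auto
  have "1 / (288 * K) \<le> rate \<alpha>\<^sub>m\<^sub>a\<^sub>x"
  proof -
    have "\<alpha>\<^sub>m\<^sub>a\<^sub>x \<in> {1 / (35 * L * sqrt (h\<^sub>r * h\<^sub>c)), m_min / (288 * m_max * real n * (L / \<mu>) * L * \<rho>),
        1 / (9 * \<mu> * m_max * \<rho>)}"
      unfolding alpha_bar_def by (rule Min_in) auto
    then consider "\<alpha>\<^sub>m\<^sub>a\<^sub>x = 1 / (35 * L * S)" | "\<alpha>\<^sub>m\<^sub>a\<^sub>x = m_min / (288 * m_max * real n * (L / \<mu>) * L * \<rho>)"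
      | "\<alpha>\<^sub>m\<^sub>a\<^sub>x = 1 / (9 * \<mu> * m_max * \<rho>)"
      unfolding S_def by blast
    then show ?thesis
    proof cases
      case 1
      have b: "0 < L / \<mu> * psi n pr pc"
        using pos psi_ge_1 by (intro mult_pos_pos) auto
      have "1 / (288 * K) \<le> 1 / (288 * (L / \<mu> * psi n pr pc))"
        using b K(1) by (rule inv)
      also have "\<dots> \<le> 1 / (35 * (L / \<mu> * psi n pr pc))"
      proof -
        have "1 / (288 * t) \<le> 1 / (35 * t)" if "0 < t" for t :: real
          using that by (simp add: field_simps)
        then show ?thesis using b by blast
      qed
      also have "\<dots> = rate \<alpha>\<^sub>m\<^sub>a\<^sub>x"
        unfolding 1 rate_def psi_def S_def[symmetric] using pos S by (simp add: mult_ac)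
      finally show ?thesis .
    next
      case 2
      have "1 / (288 * K) \<le> 1 / (288 * ((L / \<mu>)\<^sup>2 * m_max / m_min))"
        using pos K(2) by (intro inv) auto
      also have "\<dots> = rate \<alpha>\<^sub>m\<^sub>a\<^sub>x"
        unfolding 2 rate_def using pos by (simp add: power2_eq_square mult_ac)
      finally show ?thesis .
    next
      case 3
      have "1 / (288 * K) \<le> 1 / (288 * m_max)"
        using pos K(3) by (intro inv) auto
      also have "\<dots> \<le> 1 / (9 * m_max)"
        using pos by (intro divide_left_mono) auto
      also have "\<dots> \<le> real n * (1 / (9 * m_max))"
        using n_pos pos mult_right_mono[of 1 "real n" "1 / (9 * m_max)"] by simp
      also have "\<dots> = rate \<alpha>\<^sub>m\<^sub>a\<^sub>x"
        unfolding 3 rate_def using pos by simp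
      finally show ?thesis .
    qed
  qed
  moreover have "1 / (1152 * K) \<le> 1 / (2 * m_max)"
    using pos K(3) by (intro divide_left_mono) auto
  ultimately show "1 / (1152 * K) \<le> gap \<alpha>\<^sub>m\<^sub>a\<^sub>x"
    by (simp add: gap_def)
qed

lemma oracle_complexity:
  assumes x0: "\<And>i. i < n \<Longrightarrow> x0 i \<in> carrier_vec p"
  shows "\<exists>C0\<ge>exp 1. \<forall>\<epsilon>. 0 < \<epsilon> \<and> \<epsilon> < 1 \<longrightarrow>
    (\<forall>k. (\<forall>i<n. 1153 * Max {L / \<mu> * psi n pr pc, (L / \<mu>)\<^sup>2 * m_max / m_min, m_max} * ln (C0 / \<epsilon>)
          \<le> real (grad_evals m k i)) \<longrightarrow>
      (\<forall>i<n. mean_sq_error n p m f A B rounds_c rounds_d \<alpha>\<^sub>m\<^sub>a\<^sub>x x0 xs k i \<le> \<epsilon>))"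
proof -
  define K where "K = Max {L / \<mu> * psi n pr pc, (L / \<mu>)\<^sup>2 * m_max / m_min, m_max}"
  note gap = gap_alpha_bar[folded K_def]
  let ?g = "gap \<alpha>\<^sub>m\<^sub>a\<^sub>x"
  obtain C where C: "\<And>i k. i < n \<Longrightarrow>
      mean_sq_error n p m f A B rounds_c rounds_d \<alpha>\<^sub>m\<^sub>a\<^sub>x x0 xs k i \<le> C * (1 - ?g) ^ k"
    using linear_convergence[of x0, OF x0 alpha_bar_pos] by auto
  \<comment> \<open>The lower bound \<open>exp 1\<close> makes the logarithm at least 1 for every
    admissible accuracy, so that the cost of the initialization can be charged to it.\<close>
  define C0 where "C0 = max (exp 1) C"
  have C0: "exp 1 \<le> C0" "C \<le> C0" "0 < C0"
    by (auto simp: C0_def less_max_iff_disj)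
  show ?thesis
    unfolding K_def[symmetric]
  proof (intro exI[of _ C0] conjI allI impI C0(1))
    fix \<epsilon> :: real and k i
    assume \<epsilon>: "0 < \<epsilon> \<and> \<epsilon> < 1" and i: "i < n"
      and evals: "\<forall>i<n. 1153 * K * ln (C0 / \<epsilon>) \<le> real (grad_evals m k i)"
    let ?l = "ln (C0 / \<epsilon>)"
    have "exp 1 * \<epsilon> \<le> exp 1 * 1" using \<epsilon> by (intro mult_left_mono) auto
    then have "exp 1 * \<epsilon> \<le> C0" using C0(1) by linarith
    then have "exp 1 \<le> C0 / \<epsilon>" using C0 \<epsilon> by (simp add: pos_le_divide_eq)
    then have l: "1 \<le> ?l" using C0 \<epsilon> by (subst ln_ge_iff) auto
    have "1153 * K * ?l \<le> real (m i) + real k"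
      using evals i by (simp add: grad_evals_def)
    \<comment> \<open>Filling the table costs at most one more unit of \<open>K * ?l\<close>, the
      difference between 1153 and 1152.\<close>
    moreover have "real (m i) \<le> K * ?l"
    proof -
      have "real (m i) \<le> K * 1" using sizes(2)[OF i] gap(2) by simp
      also have "\<dots> \<le> K * ?l" using l gap(1) by (intro mult_left_mono) auto
      finally show ?thesis .
    qed
    ultimately have "1152 * K * ?l \<le> real k" by simp
    then have "?l \<le> real k * (1 / (1152 * K))"
      using gap(1) by (simp add: pos_le_divide_eq mult_ac)
    also have "\<dots> \<le> real k * ?g" using gap(3) by (intro mult_left_mono) auto
    finally have kg: "?l \<le> real k * ?g" .
    have g: "0 \<le> 1 - ?g" using gap_bounds[OF alpha_bar_pos] by simp
    have "(1 - ?g) ^ k \<le> exp (- ?g) ^ k"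
      using g exp_ge_add_one_self[of "- ?g"] by (intro power_mono) auto
    also have "\<dots> = exp (- (real k * ?g))" by (simp flip: exp_of_nat_mult)
    also have "\<dots> \<le> exp (- ?l)" using kg by simp
    also have "\<dots> = \<epsilon> / C0" using C0 \<epsilon> by (simp add: exp_minus)
    finally have p: "(1 - ?g) ^ k \<le> \<epsilon> / C0" .
    have "mean_sq_error n p m f A B rounds_c rounds_d \<alpha>\<^sub>m\<^sub>a\<^sub>x x0 xs k i \<le> C * (1 - ?g) ^ k"
      using C[OF i] .
    also have "\<dots> \<le> C0 * (1 - ?g) ^ k" using C0(2) g by (intro mult_right_mono) auto
    also have "\<dots> \<le> C0 * (\<epsilon> / C0)" using p C0(3) by (intro mult_left_mono) auto
    also have "\<dots> = \<epsilon>" using C0(3) by simp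
    finally show "mean_sq_error n p m f A B rounds_c rounds_d \<alpha>\<^sub>m\<^sub>a\<^sub>x x0 xs k i \<le> \<epsilon>" .
  qed
qed

lemma convergence_and_complexity:
  assumes x0: "\<forall>i<n. x0 i \<in> carrier_vec p"
  shows "let c = rounds_A n m L \<mu> A B pr pc;
          d = rounds_B n m L \<mu> B pr pc;
          \<alpha>bar = alpha_bar n m L \<mu> pr pc;
          \<kappa> = L / \<mu>;
          \<psi> = psi n pr pc;
          M = real (max_size n m);
          mn = real (min_size n m)
      in (\<forall>\<alpha>. 0 < \<alpha> \<and> \<alpha> < \<alpha>bar \<longrightarrow>
            (\<exists>C \<gamma>. 0 < \<gamma> \<and> \<gamma> < 1 \<and>
               (\<forall>i<n. \<forall>k. mean_sq_error n p m f A B c d \<alpha> x0 xs k i \<le> C * \<gamma> ^ k))) \<and>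
         1 \<le> \<psi> \<and>
         (\<exists>C0 \<ge> exp 1. \<forall>\<epsilon>. 0 < \<epsilon> \<and> \<epsilon> < 1 \<longrightarrow>
            (\<forall>k. (\<forall>i<n. 1153 * Max {\<kappa> * \<psi>, \<kappa>\<^sup>2 * M / mn, M} * ln (C0 / \<epsilon>) \<le> real (grad_evals m k i)) \<longrightarrow>
               (\<forall>i<n. mean_sq_error n p m f A B c d \<alpha>bar x0 xs k i \<le> \<epsilon>)))"
  unfolding Let_def
proof (intro conjI allI impI)
  fix \<alpha> assume \<alpha>: "0 < \<alpha> \<and> \<alpha> < \<alpha>\<^sub>m\<^sub>a\<^sub>x"
  then obtain C where "\<forall>i<n. \<forall>k. mean_sq_error n p m f A B rounds_c rounds_d \<alpha> x0 xs k i \<le> C * (1 - gap \<alpha>) ^ k"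
    using linear_convergence[of x0 \<alpha>] x0 by auto
  moreover have "0 < 1 - gap \<alpha>" "1 - gap \<alpha> < 1"
    using gap_bounds[of \<alpha>] \<alpha> by auto
  ultimately show "\<exists>C \<gamma>. 0 < \<gamma> \<and> \<gamma> < 1 \<and>
      (\<forall>i<n. \<forall>k. mean_sq_error n p m f A B rounds_c rounds_d \<alpha> x0 xs k i \<le> C * \<gamma> ^ k)"
    by blast
next
  show "1 \<le> psi n pr pc" by (rule psi_ge_1)
next
  show "\<exists>C0\<ge>exp 1. \<forall>\<epsilon>. 0 < \<epsilon> \<and> \<epsilon> < 1 \<longrightarrow>
    (\<forall>k. (\<forall>i<n. 1153 * Max {L / \<mu> * psi n pr pc, (L / \<mu>)\<^sup>2 * m_max / m_min, m_max} * ln (C0 / \<epsilon>)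
          \<le> real (grad_evals m k i)) \<longrightarrow>
      (\<forall>i<n. mean_sq_error n p m f A B rounds_c rounds_d \<alpha>\<^sub>m\<^sub>a\<^sub>x x0 xs k i \<le> \<epsilon>))"
    using x0 by (intro oracle_complexity) auto
qed

end

theorem theorem1:
  "\<exists>C1>0::real. \<forall>(n::nat) (p::nat) (m :: nat \<Rightarrow> nat) (f :: nat \<Rightarrow> nat \<Rightarrow> real vec \<Rightarrow> real)
      (L::real) (\<mu>::real) (xs :: real vec) (G :: nat pair_pre_digraph)
      (A :: real mat) (B :: real mat) (pr :: real vec) (pc :: real vec) (x0 :: nat \<Rightarrow> real vec).
     finite_sum_problem n p m f L \<mu> xs \<longrightarrow>
     directed_network n G A B pr pc \<longrightarrow>
     (\<forall>i<n. x0 i \<in> carrier_vec p) \<longrightarrow>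
     (let c = rounds_A n m L \<mu> A B pr pc;
          d = rounds_B n m L \<mu> B pr pc;
          \<alpha>bar = alpha_bar n m L \<mu> pr pc;
          \<kappa> = L / \<mu>;
          \<psi> = psi n pr pc;
          M = real (max_size n m);
          mn = real (min_size n m)
      in (\<forall>\<alpha>. 0 < \<alpha> \<and> \<alpha> < \<alpha>bar \<longrightarrow>
            (\<exists>C \<gamma>. 0 < \<gamma> \<and> \<gamma> < 1 \<and>
               (\<forall>i<n. \<forall>k. mean_sq_error n p m f A B c d \<alpha> x0 xs k i \<le> C * \<gamma> ^ k))) \<and>
         1 \<le> \<psi> \<and>
         (\<exists>C0 \<ge> exp 1. \<forall>\<epsilon>. 0 < \<epsilon> \<and> \<epsilon> < 1 \<longrightarrow>
            (\<forall>k. (\<forall>i<n. C1 * Max {\<kappa> * \<psi>, \<kappa>\<^sup>2 * M / mn, M} * ln (C0 / \<epsilon>) \<le> real (grad_evals m k i)) \<longrightarrow>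
               (\<forall>i<n. mean_sq_error n p m f A B c d \<alpha>bar x0 xs k i \<le> \<epsilon>))))"
  by (intro exI[of _ 1153] conjI allI impI saga_network.convergence_and_complexity
      saga_network.intro) simp_all

end
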